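(* Suppose $h\lesssim d$ (i.e. $h\le C\,d$ with a constant $C$ independent of the discretisation parameters). Suppose that the transfer matrix $R_d^h$ is given and that the inverse stiffness matrix $N_d=L_d^{-1}$ is available for the degrees of freedom in a vicinity of $\Sigma$, i.e. the submatrix $N_d|_{\mathcal N_\Sigma\times\mathcal N_\Sigma}$ is available. Then, in the sparse–dense arithmetic model described in the context, the system matrix $$V_d^h=(R_d^h)^HN_dR_d^h\in\mathbb C^{n_h\times n_h}$$ can be computed with $\mathcal O(n_h^2)$ operations, where $n_h=\dim B_h$ (the implied constant being independent of the mesh sizes $d,h$).
   Context: All spaces are complex; $M^H$ is the conjugate transpose, $\operatorname{nnz}(M)$ the number of nonzero entries of $M$, $[J]:=\{1,\dots,J\}$. Duality pairings are bilinear. Setting. Let $\Omega\subset\mathbb R^n$, $n\ge2$, be a Lipschitz domain, $\Gamma_{\mathrm D}\subset\partial\Omega$ relatively closed, $\Gamma_{\mathrm N}:=\partial\Omega\setminus\Gamma_{\mathrm D}$, $\mathcal V:=H^1_{\Gamma_{\mathrm D}}(\Omega)$ the $H^1(\Omega)$ functions with vanishing trace on $\Gamma_{\mathrm D}$. Let $\mathbb A\in L^\infty(\Omega;\mathbb H^n)$ be Hermitian-valued and uniformly positive definite, $\mathbf b\in L^\infty(\Omega;\mathbb C^n)$, $c\in L^\infty(\Omega)$, $G:\mathcal V\to H^{-1/2}(\Gamma_{\mathrm N})$ bounded linear, and $$\ell(v,w):=\int_\Omega\mathbb A\nabla v\cdot\nabla\overline w+(\mathbf b\cdot\nabla v+cv)\overline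 w\,dx-\langle Gv,\overline w|_{\partial\Omega}\rangle_{\partial\Omega},\qquad v,w\in\mathcal V,$$ assumed coercive: $|\ell(v,v)|\ge c_{\mathcal L}\|v\|_{H^1(\Omega)}^2$ for all $v\in\mathcal V$ with some $c_{\mathcal L}>0$. $\Sigma\subset\Omega\cup\Gamma_{\mathrm N}$ is a Lipschitz interface (an isolated boundary component, i.e. a part of the boundary at positive distance from the rest, of some Lipschitz subset of $\Omega$) that either lies in $\Omega$ and splits $\Omega=\Omega_+\cup\Sigma\cup\Omega_-$ into disjoint Lipschitz sets $\Omega_\pm$, or lies in $\Gamma_{\mathrm N}$ and is an isolated boundary component of $\Omega$. $\gamma_\Sigma:\mathcal V\to X:=H^{1/2}(\Sigma)$ is the Dirichlet trace and $B:=X'=H^{-1/2}(\Sigma)$. Partitions. $\mathcal T$ is a partition of $\Omega$ into elements $T$ with non-overlapping interiors and $\overline\Omega=\bigcup\mathcal T$; each $T$ is the image of the closed unit simplex or unit cube $\widehat T\subset\mathbb R^n$ under a bi-Lipschitz homeomorphism $\Phi_T:\widehat T\to T$. Faces are the images of the faces of $\widehat T$; interior faces are those not contained in $\partial\Omega$. Write $d_T:=\operatorname{diam}T$. $\mathcal T$ is regular if every interior face $F$ equals $T_1\cap T_2$ for exactly two distinct elements and $\Phi_{T_2}^{-1}\circ\Phi_{T_1}$ restricted to $\Phi_{T_1}^{-1}(F)$ is an affine bijection onto the face $\Phi_{T_2}^{-1}(F)$ of $\widehat T$. It is shape regular of order $\mu\in\mathbb N_0$ (with constant $C_{\mathrm{sr}}>0$)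 if it is regular and every $T$ satisfies $\Phi_T\in C^\mu(\widehat T;T)$, $\|D\Phi_T^{-1}\|_{L^\infty(T)}\le C_{\mathrm{sr}}d_T^{-1}$, $\|D^j\Phi_T\|_{L^\infty(\widehat T)}\le C_{\mathrm{sr}}d_T^{\,j}$ for $j=1,\dots,\max\{1,\mu\}$. Likewise $\mathcal P$ is a partition of $\Sigma$ into panels $\tau$ of diameter $h_\tau$, images of the $(n-1)$-dimensional unit simplex or cube $\widehat\tau$ under bi-Lipschitz maps $\Phi_\tau$, with shape regularity defined analogously. $\mathcal T$ is shape regular of order $p\in\mathbb N$, $\mathcal P$ of order $k\in\mathbb N_0$, and $\Gamma_{\mathrm D}$ is a union of faces of $\mathcal T$; $\mathcal T$ need not resolve $\Sigma$. Both are quasi-uniform: $d:=\max_Td_T\le C_{\mathrm{qu}}d_T$, $h:=\max_\tau h_\tau\le C_{\mathrm{qu}}h_\tau$ for all $T,\tau$. The constants $n,p,k,C_{\mathrm{sr}},C_{\mathrm{qu}}$ are fixed. Discrete spaces and matrices. $\mathcal V_d$ is the set of all $v\in H^1_{\Gamma_{\mathrm D}}(\Omega)\cap L^\infty(\Omega)$ such that $v|_T\circ\Phi_T$ is a polynomial of degree at most $p$ (total degree on simplices, maximal degree on cubes) for all $T\in\mathcal T$, and $B_h$ is the set of all $g\in L^\infty(\Sigma)$ such that $g|_\tau\circ\Phi_\tau$ is a polynomial of degree at most $k$ for all $\tau\in\mathcal P$. Let $n_d=\dim\mathcal V_d$, $n_h=\dim B_h$, with bases $\{v_d^j\}_{j=1}^{n_d}$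 of $\mathcal V_d$ and $\{g_h^\ell\}_{\ell=1}^{n_h}$ of $B_h$ that are local: for each $j$ there is $T_j\in\mathcal T$ with $\operatorname{supp}v_d^j\subset\bigcup\{K\in\mathcal T:T_j\cap K\ne\emptyset\}$, and for each $\ell$ there is $\tau_\ell\in\mathcal P$ with $\operatorname{supp}g_h^\ell\subset\tau_\ell$. Define $L_d\in\mathbb C^{n_d\times n_d}$ by $(L_d)_{jm}=\ell(v_d^m,v_d^j)$, $N_d:=L_d^{-1}$, and $R_d^h\in\mathbb C^{n_d\times n_h}$ by $(R_d^h)_{jm}=\langle\gamma_\Sigma v_d^j,\overline{g_h^m}\rangle_{X\times B}$. Let $\mathcal N_\Sigma(\ell):=\{j\in[n_d]:\operatorname{supp}v_d^j\cap\operatorname{supp}g_h^\ell\neq\emptyset\}$ and $\mathcal N_\Sigma:=\bigcup_{\ell\in[n_h]}\mathcal N_\Sigma(\ell)$. Arithmetic model. If $R$ is sparse and $M$ is dense with $m\in\mathbb N$ columns, then the products $MR$ and $R^HM$ can be evaluated in $\mathcal O(m\,\operatorname{nnz}R)$ operations. *)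

theory Defs
  imports
    "Jordan_Normal_Form.Schur_Decomposition"
    "Jordan_Normal_Form.DL_Submatrix"
    "HOL-Analysis.Analysis"
begin

no_notation Matrix.vec_index (infixl \<open>$\<close> 100)
no_notation Matrix.scalar_prod (infix \<open>\<bullet>\<close> 70)


section \<open>Differentiability classes\<close>

text \<open>
  Derivatives are taken within \<open>S\<close>, so for a convex body \<open>S\<close> the predicate \<open>Ck k S\<close> is
  \<open>C\<^sup>k\<close> up to the boundary.  The value of \<open>iter_deriv S f [\<xi>\<^sub>1,\<dots>,\<xi>\<^sub>j]\<close> at \<open>x\<close> is the multilinear
  form \<open>D\<^sup>jf(x)[\<xi>\<^sub>1,\<dots>,\<xi>\<^sub>j]\<close>.
\<close>

primrec Ck :: "nat \<Rightarrow> 'a::real_normed_vector set \<Rightarrow> ('a \<Rightarrow> 'b::real_normed_vector) \<Rightarrow> bool" where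
  "Ck 0 S f \<longleftrightarrow> continuous_on S f"
| "Ck (Suc k) S f \<longleftrightarrow> f differentiable_on S \<and>
     (\<forall>\<xi>. Ck k S (\<lambda>x. frechet_derivative f (at x within S) \<xi>))"

primrec iter_deriv ::
  "'a::real_normed_vector set \<Rightarrow> ('a \<Rightarrow> 'b::real_normed_vector) \<Rightarrow> 'a list \<Rightarrow> 'a \<Rightarrow> 'b" where
  "iter_deriv S f [] = f"
| "iter_deriv S f (\<xi> # \<xi>s) =
     iter_deriv S (\<lambda>x. frechet_derivative f (at x within S) \<xi>) \<xi>s"

definition smooth :: "('a::real_normed_vector \<Rightarrow> 'b::real_normed_vector) \<Rightarrow> bool" where
  "smooth f \<longleftrightarrow> (\<forall>k. Ck k UNIV f)"

definition test_functions :: "(real^'n) set \<Rightarrow> (real^'n \<Rightarrow> complex) set" where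
  "test_functions \<Omega> = {\<phi>. smooth \<phi> \<and> (\<exists>K. compact K \<and> K \<subseteq> \<Omega> \<and> (\<forall>x. x \<notin> K \<longrightarrow> \<phi> x = 0))}"


section \<open>Lebesgue and Sobolev spaces\<close>

text \<open>
  Elements of function spaces are represented by functions; equality in the space is equality
  almost everywhere with respect to the underlying measure.
\<close>

definition L2 :: "'a measure \<Rightarrow> ('a \<Rightarrow> 'b::euclidean_space) set" where
  "L2 M = {f. f \<in> borel_measurable M \<and> integrable M (\<lambda>x. (norm (f x))\<^sup>2)}"

definition Linf :: "'a measure \<Rightarrow> ('a \<Rightarrow> 'b::euclidean_space) set" where
  "Linf M = {f. f \<in> borel_measurable M \<and> (\<exists>C. AE x in M. norm (f x) \<le> C)}"

definition weak_gradient ::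
  "(real^'n) set \<Rightarrow> (real^'n \<Rightarrow> complex) \<Rightarrow> (real^'n \<Rightarrow> complex^'n) \<Rightarrow> bool" where
  "weak_gradient \<Omega> u g \<longleftrightarrow> g \<in> L2 (lebesgue_on \<Omega>) \<and>
     (\<forall>\<phi>\<in>test_functions \<Omega>. \<forall>i.
        (LINT x|lebesgue_on \<Omega>. u x * frechet_derivative \<phi> (at x) (axis i 1))
        = - (LINT x|lebesgue_on \<Omega>. g x $ i * \<phi> x))"

definition H1 :: "(real^'n) set \<Rightarrow> (real^'n \<Rightarrow> complex) set" where
  "H1 \<Omega> = {u. u \<in> L2 (lebesgue_on \<Omega>) \<and> (\<exists>g. weak_gradient \<Omega> u g)}"

definition grad :: "(real^'n) set \<Rightarrow> (real^'n \<Rightarrow> complex) \<Rightarrow> real^'n \<Rightarrow> complex^'n" where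
  "grad \<Omega> u = (SOME g. weak_gradient \<Omega> u g)"

definition H1_norm :: "(real^'n) set \<Rightarrow> (real^'n \<Rightarrow> complex) \<Rightarrow> real" where
  "H1_norm \<Omega> u =
     sqrt ((LINT x|lebesgue_on \<Omega>. (norm (u x))\<^sup>2) + (LINT x|lebesgue_on \<Omega>. (norm (grad \<Omega> u x))\<^sup>2))"


section \<open>Surface measure, fractional spaces and traces\<close>

text \<open>
  The Hausdorff outer measure is countably additive on the Borel sets, so \<open>measure_of\<close> does not
  degenerate here.  The normalisation makes the \<open>s\<close>-dimensional measure the usual surface measure.
\<close>

definition hausdorff_premeasure :: "nat \<Rightarrow> real \<Rightarrow> 'a::metric_space set \<Rightarrow> ennreal" where
  "hausdorff_premeasure s \<delta> A =
     (INF U \<in> {U :: nat \<Rightarrow> 'a set. A \<subseteq> (\<Union>i. U i) \<and> (\<forall>i. bounded (U i) \<and> diameter (U i) \<le> \<delta>)}.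
        \<Sum>i. ennreal (if U i = {} then 0 else unit_ball_vol (real s) * (diameter (U i) / 2) ^ s))"

definition hausdorff_measure :: "nat \<Rightarrow> 'a::metric_space measure" where
  "hausdorff_measure s = measure_of UNIV (sets borel) (\<lambda>A. SUP \<delta> \<in> {0<..}. hausdorff_premeasure s \<delta> A)"

definition surface :: "(real^'n) set \<Rightarrow> (real^'n) measure" where
  "surface S = restrict_space (hausdorff_measure (CARD('n) - 1)) S"

text \<open>Squared Sobolev--Slobodeckij norm on an \<open>(n-1)\<close>-dimensional surface: the kernel exponent is
  \<open>(n - 1) + 2 \<cdot> 1/2 = n\<close>.\<close>

definition Hhalf_sq :: "(real^'n) set \<Rightarrow> (real^'n \<Rightarrow> complex) \<Rightarrow> ennreal" where
  "Hhalf_sq S t =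
     (\<integral>\<^sup>+x. ennreal ((norm (t x))\<^sup>2) \<partial>surface S) +
     (\<integral>\<^sup>+x. (\<integral>\<^sup>+y. ennreal ((norm (t x - t y))\<^sup>2 / norm (x - y) ^ CARD('n)) \<partial>surface S) \<partial>surface S)"

definition Hhalf :: "(real^'n) set \<Rightarrow> (real^'n \<Rightarrow> complex) set" where
  "Hhalf S = {t. t \<in> borel_measurable (surface S) \<and> Hhalf_sq S t < \<infinity>}"

definition Hhalf_norm :: "(real^'n) set \<Rightarrow> (real^'n \<Rightarrow> complex) \<Rightarrow> real" where
  "Hhalf_norm S t = sqrt (enn2real (Hhalf_sq S t))"

text \<open>
  The Dirichlet trace onto \<open>S\<close>: the bounded linear operator \<open>H\<^sup>1(\<Omega>) \<rightarrow> H\<^sup>1\<^sup>/\<^sup>2(S)\<close> that extends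
  the restriction of smooth functions by continuity (smooth functions are dense in \<open>H\<^sup>1\<close> of a
  Lipschitz domain).  It is unique up to equality almost everywhere on \<open>S\<close>.
\<close>

definition dirichlet_trace ::
  "(real^'n) set \<Rightarrow> (real^'n) set \<Rightarrow> ((real^'n \<Rightarrow> complex) \<Rightarrow> real^'n \<Rightarrow> complex) \<Rightarrow> bool" where
  "dirichlet_trace \<Omega> S \<gamma> \<longleftrightarrow>
     (\<forall>u\<in>H1 \<Omega>. \<gamma> u \<in> Hhalf S) \<and>
     (\<forall>u\<in>H1 \<Omega>. \<forall>w\<in>H1 \<Omega>. \<forall>a b.
        AE x in surface S. \<gamma> (\<lambda>y. a * u y + b * w y) x = a * \<gamma> u x + b * \<gamma> w x) \<and>
     (\<exists>C. \<forall>u\<in>H1 \<Omega>. Hhalf_norm S (\<gamma> u) \<le> C * H1_norm \<Omega> u) \<and>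
     (\<forall>\<phi>\<in>H1 \<Omega>. smooth \<phi> \<longrightarrow> (AE x in surface S. \<gamma> \<phi> x = \<phi> x)) \<and>
     (\<forall>u\<in>H1 \<Omega>. \<exists>\<phi>. (\<forall>k. smooth (\<phi> k) \<and> \<phi> k \<in> H1 \<Omega>) \<and>
        (\<lambda>k. H1_norm \<Omega> (\<lambda>x. \<phi> k x - u x)) \<longlonglongrightarrow> 0 \<and>
        (\<lambda>k. Hhalf_norm S (\<lambda>x. \<phi> k x - \<gamma> u x)) \<longlonglongrightarrow> 0)"

text \<open>\<open>\<gamma>\<close> is the trace onto \<open>\<partial>\<Omega>\<close>.\<close>

definition H1_D ::
  "(real^'n) set \<Rightarrow> ((real^'n \<Rightarrow> complex) \<Rightarrow> real^'n \<Rightarrow> complex) \<Rightarrow> (real^'n) set \<Rightarrow> (real^'n \<Rightarrow> complex) set"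
  where
  "H1_D \<Omega> \<gamma> \<Gamma>D = {u \<in> H1 \<Omega>. AE x in surface (frontier \<Omega>). x \<in> \<Gamma>D \<longrightarrow> \<gamma> u x = 0}"

text \<open>Traces on \<open>\<partial>\<Omega>\<close> that vanish on \<open>\<Gamma>\<^sub>D\<close>; the dual space is \<open>H\<^sup>-\<^sup>1\<^sup>/\<^sup>2(\<Gamma>\<^sub>N)\<close>.\<close>

definition Hhalf_N :: "(real^'n) set \<Rightarrow> (real^'n) set \<Rightarrow> (real^'n \<Rightarrow> complex) set" where
  "Hhalf_N \<Omega> \<Gamma>D = {t \<in> Hhalf (frontier \<Omega>). AE x in surface (frontier \<Omega>). x \<in> \<Gamma>D \<longrightarrow> t x = 0}"

text \<open>\<open>G v t\<close> is the bilinear pairing of \<open>G v\<close> with \<open>t\<close>.\<close>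

definition bounded_into_dual ::
  "(real^'n) set \<Rightarrow> (real^'n) set \<Rightarrow> (real^'n \<Rightarrow> complex) set \<Rightarrow>
   ((real^'n \<Rightarrow> complex) \<Rightarrow> (real^'n \<Rightarrow> complex) \<Rightarrow> complex) \<Rightarrow> bool" where
  "bounded_into_dual \<Omega> \<Gamma>D V G \<longleftrightarrow>
     (\<forall>v\<in>V. \<forall>t\<in>Hhalf_N \<Omega> \<Gamma>D. \<forall>s\<in>Hhalf_N \<Omega> \<Gamma>D. \<forall>a b.
        G v (\<lambda>x. a * t x + b * s x) = a * G v t + b * G v s) \<and>
     (\<forall>v\<in>V. \<forall>w\<in>V. \<forall>t\<in>Hhalf_N \<Omega> \<Gamma>D. \<forall>a b.
        G (\<lambda>x. a * v x + b * w x) t = a * G v t + b * G w t) \<and>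
     (\<exists>C. \<forall>v\<in>V. \<forall>t\<in>Hhalf_N \<Omega> \<Gamma>D.
        norm (G v t) \<le> C * H1_norm \<Omega> v * Hhalf_norm (frontier \<Omega>) t)"

text \<open>The pairing \<open>\<langle>\<cdot>,\<cdot>\<rangle>\<close> of \<open>H\<^sup>1\<^sup>/\<^sup>2(S)\<close> with its dual extends the bilinear \<open>L\<^sup>2(S)\<close> pairing; on the
  subspace \<open>L\<^sup>\<infinity>(S)\<close> of the dual it is the surface integral.\<close>

definition surface_pairing ::
  "(real^'n) set \<Rightarrow> (real^'n \<Rightarrow> complex) \<Rightarrow> (real^'n \<Rightarrow> complex) \<Rightarrow> complex" where
  "surface_pairing S t g = (LINT x|surface S. t x * g x)"


section \<open>Geometry\<close>

text \<open>Near each boundary point the set is, for some unit vector \<open>e\<close>, the strict epigraph in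
  direction \<open>e\<close> of a Lipschitz function of the component orthogonal to \<open>e\<close>.\<close>

definition lipschitz_set :: "(real^'n) set \<Rightarrow> bool" where
  "lipschitz_set U \<longleftrightarrow> open U \<and> U \<noteq> {} \<and>
     (\<forall>x\<in>frontier U. \<exists>W e L \<phi>. open W \<and> x \<in> W \<and> norm e = 1 \<and> lipschitz_on L UNIV \<phi> \<and>
        W \<inter> U = {y \<in> W. (\<phi> :: real^'n \<Rightarrow> real) (y - (y \<bullet> e) *\<^sub>R e) < y \<bullet> e})"

definition lipschitz_domain :: "(real^'n) set \<Rightarrow> bool" where
  "lipschitz_domain \<Omega> \<longleftrightarrow> lipschitz_set \<Omega> \<and> connected \<Omega>"

definition isolated_boundary_component :: "(real^'n) set \<Rightarrow> (real^'n) set \<Rightarrow> bool" where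
  "isolated_boundary_component S U \<longleftrightarrow> S \<noteq> {} \<and> S \<subseteq> frontier U \<and>
     (\<exists>\<epsilon>>0. \<forall>x\<in>S. \<forall>y\<in>frontier U - S. \<epsilon> \<le> dist x y)"

definition lipschitz_interface ::
  "(real^'n) set \<Rightarrow> (real^'n) set \<Rightarrow> (real^'n) set \<Rightarrow> bool" where
  "lipschitz_interface \<Omega> \<Gamma>N S \<longleftrightarrow>
     (\<exists>U. lipschitz_set U \<and> U \<subseteq> \<Omega> \<and> isolated_boundary_component S U) \<and>
     ((S \<subseteq> \<Omega> \<and> (\<exists>\<Omega>p \<Omega>m. lipschitz_set \<Omega>p \<and> lipschitz_set \<Omega>m \<and> \<Omega> = \<Omega>p \<union> S \<union> \<Omega>m \<and>
          \<Omega>p \<inter> \<Omega>m = {} \<and> \<Omega>p \<inter> S = {} \<and> \<Omega>m \<inter> S = {}))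
      \<or> (S \<subseteq> \<Gamma>N \<and> isolated_boundary_component S \<Omega>))"


section \<open>The sesquilinear form\<close>

definition cdot :: "complex^'n \<Rightarrow> complex^'n \<Rightarrow> complex" where
  "cdot a b = (\<Sum>i\<in>UNIV. a $ i * b $ i)"

definition conj_vec :: "complex^'n \<Rightarrow> complex^'n" where
  "conj_vec a = (\<chi> i. cnj (a $ i))"

definition hermitian_uniformly_pd :: "(real^'n) set \<Rightarrow> (real^'n \<Rightarrow> complex^'n^'n) \<Rightarrow> bool" where
  "hermitian_uniformly_pd \<Omega> A \<longleftrightarrow>
     (AE x in lebesgue_on \<Omega>. \<forall>i j. A x $ i $ j = cnj (A x $ j $ i)) \<and>
     (\<exists>\<alpha>>0. AE x in lebesgue_on \<Omega>. \<forall>\<xi>. \<alpha> * (norm \<xi>)\<^sup>2 \<le> Re (cdot (A x *v \<xi>) (conj_vec \<xi>)))"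

definition ell ::
  "(real^'n) set \<Rightarrow> (real^'n \<Rightarrow> complex^'n^'n) \<Rightarrow> (real^'n \<Rightarrow> complex^'n) \<Rightarrow> (real^'n \<Rightarrow> complex) \<Rightarrow>
   ((real^'n \<Rightarrow> complex) \<Rightarrow> (real^'n \<Rightarrow> complex) \<Rightarrow> complex) \<Rightarrow>
   ((real^'n \<Rightarrow> complex) \<Rightarrow> real^'n \<Rightarrow> complex) \<Rightarrow>
   (real^'n \<Rightarrow> complex) \<Rightarrow> (real^'n \<Rightarrow> complex) \<Rightarrow> complex" where
  "ell \<Omega> A b c G \<gamma> v w =
     (LINT x|lebesgue_on \<Omega>.
        cdot (A x *v grad \<Omega> v x) (conj_vec (grad \<Omega> w x))
        + (cdot (b x) (grad \<Omega> v x) + c x * v x) * cnj (w x))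
     - G v (\<lambda>x. cnj (\<gamma> w x))"

definition coercive ::
  "(real^'n) set \<Rightarrow> (real^'n \<Rightarrow> complex) set \<Rightarrow>
   ((real^'n \<Rightarrow> complex) \<Rightarrow> (real^'n \<Rightarrow> complex) \<Rightarrow> complex) \<Rightarrow> bool" where
  "coercive \<Omega> V a \<longleftrightarrow> (\<exists>C>0. \<forall>v\<in>V. C * (H1_norm \<Omega> v)\<^sup>2 \<le> norm (a v v))"


section \<open>Partitions\<close>

datatype shape = Simplex | Cube

definition ref_elem :: "shape \<Rightarrow> (real^'m) set" where
  "ref_elem s = (case s of
      Simplex \<Rightarrow> {x. (\<forall>i. 0 \<le> x $ i) \<and> (\<Sum>i\<in>UNIV. x $ i) \<le> 1}
    | Cube \<Rightarrow> {x. \<forall>i. 0 \<le> x $ i \<and> x $ i \<le> 1})"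

text \<open>One type serves for volume partitions (\<open>'m = 'n\<close>) and for panels (\<open>CARD('m) = CARD('n) - 1\<close>).\<close>

record ('m, 'n) mesh =
  cells :: "(real^'n) set set"
  kind :: "(real^'n) set \<Rightarrow> shape"
  param :: "(real^'n) set \<Rightarrow> real^'m \<Rightarrow> real^'n"

abbreviation ref_of :: "('m::finite, 'n::finite) mesh \<Rightarrow> (real^'n) set \<Rightarrow> (real^'m) set" where
  "ref_of \<T> T \<equiv> ref_elem (kind \<T> T)"

definition chart :: "('m::finite, 'n::finite) mesh \<Rightarrow> (real^'n) set \<Rightarrow> real^'n \<Rightarrow> real^'m" where
  "chart \<T> T = inv_into (ref_of \<T> T) (param \<T> T)"

definition bi_lipschitz_onto ::
  "('a::metric_space \<Rightarrow> 'b::metric_space) \<Rightarrow> 'a set \<Rightarrow> 'b set \<Rightarrow> bool" where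
  "bi_lipschitz_onto f S T \<longleftrightarrow> bij_betw f S T \<and>
     (\<exists>C. lipschitz_on C S f) \<and> (\<exists>C. lipschitz_on C T (inv_into S f))"

text \<open>\<open>param \<T> T ` interior (ref_of \<T> T)\<close> is the relative interior of the (possibly
  lower-dimensional) element \<open>T\<close>.\<close>

definition partition_of :: "(real^'n) set \<Rightarrow> ('m::finite, 'n::finite) mesh \<Rightarrow> bool" where
  "partition_of X \<T> \<longleftrightarrow> finite (cells \<T>) \<and> X = \<Union> (cells \<T>) \<and>
     (\<forall>T\<in>cells \<T>. bi_lipschitz_onto (param \<T> T) (ref_of \<T> T) T) \<and>
     (\<forall>T\<in>cells \<T>. \<forall>K\<in>cells \<T>. T \<noteq> K \<longrightarrow>
        param \<T> T ` interior (ref_of \<T> T) \<inter> param \<T> K ` interior (ref_of \<T> K) = {})"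

definition mesh_faces :: "('m::finite, 'n::finite) mesh \<Rightarrow> (real^'n) set set" where
  "mesh_faces \<T> = {param \<T> T ` f | T f. T \<in> cells \<T> \<and> f facet_of ref_of \<T> T}"

definition affine_matching ::
  "('m::finite, 'n::finite) mesh \<Rightarrow> (real^'n) set \<Rightarrow> (real^'n) set \<Rightarrow> (real^'n) set \<Rightarrow> bool" where
  "affine_matching \<T> F T K \<longleftrightarrow>
     chart \<T> T ` F facet_of ref_of \<T> T \<and> chart \<T> K ` F facet_of ref_of \<T> K \<and>
     bij_betw (chart \<T> K \<circ> param \<T> T) (chart \<T> T ` F) (chart \<T> K ` F) \<and>
     (\<exists>A a. linear A \<and> (\<forall>x\<in>chart \<T> T ` F. (chart \<T> K \<circ> param \<T> T) x = A x + a))"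

text \<open>\<open>bd\<close> is the boundary of the partitioned set; faces contained in \<open>bd\<close> are not interior.\<close>

definition regular_mesh :: "(real^'n) set \<Rightarrow> ('m::finite, 'n::finite) mesh \<Rightarrow> bool" where
  "regular_mesh bd \<T> \<longleftrightarrow>
     (\<forall>F\<in>mesh_faces \<T>. \<not> F \<subseteq> bd \<longrightarrow>
        (\<exists>T\<in>cells \<T>. \<exists>K\<in>cells \<T>. T \<noteq> K \<and> F = T \<inter> K \<and> affine_matching \<T> F T K \<and>
           (\<forall>T'\<in>cells \<T>. \<forall>K'\<in>cells \<T>. T' \<noteq> K' \<and> F = T' \<inter> K' \<longrightarrow> {T', K'} = {T, K})))"

text \<open>
  For a panel the derivative of the chart within \<open>T\<close> is determined only along the tangent space;
  the extension by zero in the normal direction has the norm of the tangential derivative, so the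
  existential is the bound on \<open>D\<Phi>\<^sub>T\<inverse>\<close>.  ``Almost every point of \<open>T\<close>'' is expressed through almost
  every point of the reference element, which is equivalent for a bi-Lipschitz parametrisation.
\<close>

definition shape_regular ::
  "nat \<Rightarrow> real \<Rightarrow> (real^'n) set \<Rightarrow> ('m::finite, 'n::finite) mesh \<Rightarrow> bool" where
  "shape_regular \<mu> Csr bd \<T> \<longleftrightarrow> regular_mesh bd \<T> \<and>
     (\<forall>T\<in>cells \<T>.
        Ck \<mu> (ref_of \<T> T) (param \<T> T) \<and>
        (AE x in lebesgue_on (ref_of \<T> T). \<exists>E.
           (chart \<T> T has_derivative E) (at (param \<T> T x) within T) \<and> onorm E \<le> Csr / diameter T) \<and>
        (\<forall>j\<in>{1..max 1 \<mu>}. AE x in lebesgue_on (ref_of \<T> T).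
           \<forall>\<xi>s. length \<xi>s = j \<longrightarrow>
             norm (iter_deriv (ref_of \<T> T) (param \<T> T) \<xi>s x)
               \<le> Csr * diameter T ^ j * prod_list (map norm \<xi>s)))"

definition mesh_size :: "('m::finite, 'n::finite) mesh \<Rightarrow> real" where
  "mesh_size \<T> = Max (diameter ` cells \<T>)"

definition quasi_uniform :: "real \<Rightarrow> ('m::finite, 'n::finite) mesh \<Rightarrow> bool" where
  "quasi_uniform Cqu \<T> \<longleftrightarrow> (\<forall>T\<in>cells \<T>. mesh_size \<T> \<le> Cqu * diameter T)"


section \<open>Discrete spaces\<close>

definition ref_polys :: "shape \<Rightarrow> nat \<Rightarrow> (real^'m \<Rightarrow> complex) set" where
  "ref_polys s p =
     {q. \<exists>a. \<forall>x. q x = (\<Sum>\<alpha> \<in> (case s of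
                               Simplex \<Rightarrow> {\<alpha> :: 'm \<Rightarrow> nat. (\<Sum>i\<in>UNIV. \<alpha> i) \<le> p}
                             | Cube \<Rightarrow> {\<alpha>. \<forall>i. \<alpha> i \<le> p}).
                        a \<alpha> * (\<Prod>i\<in>UNIV. complex_of_real (x $ i) ^ \<alpha> i))}"

definition piecewise_poly :: "nat \<Rightarrow> ('m::finite, 'n::finite) mesh \<Rightarrow> (real^'n \<Rightarrow> complex) set" where
  "piecewise_poly p \<T> =
     {v. \<forall>T\<in>cells \<T>. \<exists>q\<in>ref_polys (kind \<T> T) p.
           AE x in lebesgue_on (ref_of \<T> T). v (param \<T> T x) = q x}"

definition ae_basis ::
  "'a measure \<Rightarrow> ('a \<Rightarrow> complex) set \<Rightarrow> nat \<Rightarrow> (nat \<Rightarrow> 'a \<Rightarrow> complex) \<Rightarrow> bool" where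
  "ae_basis M V n b \<longleftrightarrow> (\<forall>j<n. b j \<in> V) \<and>
     (\<forall>a. (AE x in M. (\<Sum>j<n. a j * b j x) = 0) \<longrightarrow> (\<forall>j<n. a j = 0)) \<and>
     (\<forall>v\<in>V. \<exists>a. AE x in M. v x = (\<Sum>j<n. a j * b j x))"

text \<open>Support of an almost-everywhere class, as a subset of \<open>S\<close>.\<close>

definition ess_supp :: "'a::topological_space measure \<Rightarrow> 'a set \<Rightarrow> ('a \<Rightarrow> complex) \<Rightarrow> 'a set" where
  "ess_supp M S f = {x\<in>S. \<forall>U. open U \<and> x \<in> U \<longrightarrow> \<not> (AE y in M. y \<in> U \<longrightarrow> f y = 0)}"

abbreviation vol_supp :: "(real^'n) set \<Rightarrow> (real^'n \<Rightarrow> complex) \<Rightarrow> (real^'n) set" where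
  "vol_supp \<Omega> v \<equiv> ess_supp (lebesgue_on \<Omega>) (closure \<Omega>) v"

abbreviation surf_supp :: "(real^'n) set \<Rightarrow> (real^'n \<Rightarrow> complex) \<Rightarrow> (real^'n) set" where
  "surf_supp S g \<equiv> ess_supp (surface S) S g"

definition local_vol_basis ::
  "(real^'n) set \<Rightarrow> ('m::finite, 'n::finite) mesh \<Rightarrow> nat \<Rightarrow> (nat \<Rightarrow> real^'n \<Rightarrow> complex) \<Rightarrow> bool" where
  "local_vol_basis \<Omega> \<T> n v \<longleftrightarrow>
     (\<forall>j<n. \<exists>T\<in>cells \<T>. vol_supp \<Omega> (v j) \<subseteq> \<Union> {K \<in> cells \<T>. T \<inter> K \<noteq> {}})"

definition local_surf_basis ::
  "(real^'n) set \<Rightarrow> ('m::finite, 'n::finite) mesh \<Rightarrow> nat \<Rightarrow> (nat \<Rightarrow> real^'n \<Rightarrow> complex) \<Rightarrow> bool" where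
  "local_surf_basis S \<P> n g \<longleftrightarrow> (\<forall>l<n. \<exists>\<tau>\<in>cells \<P>. surf_supp S (g l) \<subseteq> \<tau>)"

text \<open>Indices of basis functions and matrix entries start at \<open>0\<close>.\<close>

definition stiffness_matrix ::
  "((real^'n \<Rightarrow> complex) \<Rightarrow> (real^'n \<Rightarrow> complex) \<Rightarrow> complex) \<Rightarrow> nat \<Rightarrow> (nat \<Rightarrow> real^'n \<Rightarrow> complex) \<Rightarrow>
   complex Matrix.mat" where
  "stiffness_matrix a nd v = Matrix.mat nd nd (\<lambda>(j, m). a (v m) (v j))"

definition transfer_matrix ::
  "(real^'n) set \<Rightarrow> ((real^'n \<Rightarrow> complex) \<Rightarrow> real^'n \<Rightarrow> complex) \<Rightarrow>
   nat \<Rightarrow> (nat \<Rightarrow> real^'n \<Rightarrow> complex) \<Rightarrow> nat \<Rightarrow> (nat \<Rightarrow> real^'n \<Rightarrow> complex) \<Rightarrow> complex Matrix.mat" where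
  "transfer_matrix S \<gamma>S nd v nh g =
     Matrix.mat nd nh (\<lambda>(j, m). surface_pairing S (\<gamma>S (v j)) (\<lambda>x. cnj (g m x)))"

definition vicinity ::
  "(real^'n) set \<Rightarrow> (real^'n) set \<Rightarrow> nat \<Rightarrow> (nat \<Rightarrow> real^'n \<Rightarrow> complex) \<Rightarrow>
   nat \<Rightarrow> (nat \<Rightarrow> real^'n \<Rightarrow> complex) \<Rightarrow> nat set" where
  "vicinity \<Omega> S nd v nh g =
     (\<Union>l<nh. {j. j < nd \<and> vol_supp \<Omega> (v j) \<inter> surf_supp S (g l) \<noteq> {}})"


section \<open>Sparse--dense arithmetic model\<close>

definition nnz :: "complex Matrix.mat \<Rightarrow> nat" where
  "nnz M = card {(i, j). i < dim_row M \<and> j < dim_col M \<and> M $$ (i, j) \<noteq> 0}"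

text \<open>
  \<open>computable \<kappa> \<S> \<D> M c\<close>: the matrix \<open>M\<close> is obtained with \<open>c\<close> operations from the given sparse
  matrices \<open>\<S>\<close> and the given dense matrices \<open>\<D>\<close>.  The only operations are products of a dense
  matrix with a block \<open>R\<close> of a given sparse matrix, as \<open>M R\<close> or \<open>R\<^sup>H M\<close>; selecting a block involves
  no arithmetic.  The constant \<open>\<kappa>\<close> is the one implied in \<open>O(m nnz R)\<close>.  For \<open>M R\<close> the number \<open>m\<close> is
  taken to be the larger dimension of \<open>M\<close>, since the true operation count is governed by its rows;
  for square \<open>M\<close> this is the number of columns.
\<close>

inductive computable ::
  "real \<Rightarrow> complex Matrix.mat set \<Rightarrow> complex Matrix.mat set \<Rightarrow> complex Matrix.mat \<Rightarrow> real \<Rightarrow> bool"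
  for \<kappa> :: real and \<S> \<D> :: "complex Matrix.mat set" where
  given: "M \<in> \<D> \<Longrightarrow> computable \<kappa> \<S> \<D> M 0"
| mult_right: "computable \<kappa> \<S> \<D> M c \<Longrightarrow> S \<in> \<S> \<Longrightarrow> R = submatrix S I J \<Longrightarrow> dim_col M = dim_row R \<Longrightarrow>
    computable \<kappa> \<S> \<D> (M * R) (c + \<kappa> * real (max (dim_row M) (dim_col M)) * real (nnz R))"
| mult_adjoint_left: "computable \<kappa> \<S> \<D> M c \<Longrightarrow> S \<in> \<S> \<Longrightarrow> R = submatrix S I J \<Longrightarrow> dim_row M = dim_row R \<Longrightarrow>
    computable \<kappa> \<S> \<D> (mat_adjoint R * M) (c + \<kappa> * real (dim_col M) * real (nnz R))"

end

theory Submission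
  imports Defs
begin

text \<open>
  If a row \<open>j\<close> of \<open>R\<close> does not vanish, then \<open>j\<close> lies in the vicinity \<open>I\<close>, because the trace is local:
  \<open>supp v\<^sub>j \<inter> supp g\<^sub>l = {}\<close> implies \<open>R\<^sub>j\<^sub>l = 0\<close>.  Hence \<open>R\<^sup>H N R = R\<^sub>I\<^sup>H (N\<^sub>I\<^sub>I R\<^sub>I)\<close>, at cost
  \<open>\<kappa> (card I + n\<^sub>h) nnz R\<close>, and it remains to bound the number of \<open>v\<^sub>j\<close> whose support meets the
  support of a fixed \<open>g\<^sub>l\<close>.  As \<open>h \<lesssim> d\<close>, all these \<open>v\<^sub>j\<close> are supported on elements
  inside one ball of radius \<open>O(d)\<close>.  Every element contains a ball of radius comparable to \<open>d\<close>, so there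
  are \<open>O(1)\<close> such elements, and linear independence of the \<open>v\<^sub>j\<close> bounds their number by the number of
  elements times the dimension of the local polynomial space.
\<close>

section \<open>Linear algebra\<close>

text \<open>The trace \<open>\<gamma>S\<close> is given only by abstract properties: boundedness,
  linearity, agreement with restriction on smooth functions, and approximation by them. Its locality
  must therefore be extracted by cutoffs, and this requires multiplication by a smooth function to
  be bounded on \<open>H1\<close>. As \<open>grad\<close> is a choice operator, even that bound
  presupposes that weak gradients are unique almost everywhere, which is why the fundamental lemma
  of the calculus of variations appears here. On the geometric side, the bi-Lipschitz constants of
  the parametrisations are merely finite, not uniform over meshes; only the derivative bounds with
  \<open>Csr\<close> are. Hence the inscribed ball of an element comes from a quantitative inverse
  function argument. Injectivity together with invariance of domain provides the inverse, and the
  derivative bound controls how far it moves. The bases are arbitrary apart from the size of their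
  supports. Without any nodal structure, overlaps can be counted only by dimension: too many
  functions living on few elements would satisfy a linear relation, found by solving a homogeneous
  system for their local coefficients.\<close>

lemma underdetermined_system:
  fixes q :: "'a \<Rightarrow> 'b \<Rightarrow> 'c::field"
  assumes "finite J" "finite I" "card J < card I"
  shows "\<exists>x. (\<exists>i\<in>I. x i \<noteq> 0) \<and> (\<forall>j\<in>J. (\<Sum>i\<in>I. x i * q i j) = 0)"
  using assms
proof (induction J arbitrary: I q rule: finite_induct)
  case empty
  then have "I \<noteq> {}" by auto
  then show ?case by (intro exI[of _ "\<lambda>_. 1"]) auto
next
  case (insert j J)
  show ?case
  proof (cases "\<exists>k\<in>I. q k j \<noteq> 0")
    case False
    have "card J < card I" using insert by auto
    from insert.IH[OF insert.prems(1) this] obtain x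
      where x: "\<exists>i\<in>I. x i \<noteq> 0" "\<forall>j\<in>J. (\<Sum>i\<in>I. x i * q i j) = 0"
      by blast
    with False have "(\<Sum>i\<in>I. x i * q i j) = 0" by (intro sum.neutral) auto
    with x show ?thesis by (intro exI[of _ x]) auto
  next
    case True
    then obtain k where k: "k \<in> I" "q k j \<noteq> 0" by blast
    let ?I = "I - {k}"
    \<comment> \<open>Gaussian elimination: the unknown \<open>k\<close> is solved from equation
      \<open>j\<close> and substituted into the equations in \<open>J\<close>; \<open>?q\<close>
      holds the resulting coefficients.\<close>
    let ?q = "\<lambda>i l. q i l - q i j / q k j * q k l"
    have "card J < card ?I" "finite ?I"
      using insert k by auto
    from insert.IH[OF this(2,1), of ?q] obtain x where x: "\<exists>i\<in>?I. x i \<noteq> 0"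
      "\<forall>l\<in>J. (\<Sum>i\<in>?I. x i * ?q i l) = 0" by blast
    define s where "s = (\<Sum>i\<in>?I. x i * q i j)"
    \<comment> \<open>\<open>s\<close> is the contribution of the other unknowns to equation
      \<open>j\<close>; the value at \<open>k\<close> cancels it.\<close>
    define y where "y = x(k := - s / q k j)"
    have sum_y: "(\<Sum>i\<in>I. y i * q i l) = (\<Sum>i\<in>?I. x i * q i l) - s / q k j * q k l" for l
    proof -
      have "(\<Sum>i\<in>I. y i * q i l) = y k * q k l + (\<Sum>i\<in>?I. y i * q i l)"
        by (rule sum.remove) (use insert k in auto)
      also have "(\<Sum>i\<in>?I. y i * q i l) = (\<Sum>i\<in>?I. x i * q i l)"
        by (rule sum.cong) (auto simp: y_def)
      finally show ?thesis by (simp add: y_def)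
    qed
    have "(\<Sum>i\<in>?I. x i * ?q i l) = (\<Sum>i\<in>?I. x i * q i l) - s / q k j * q k l" for l
    proof -
      have "(\<Sum>i\<in>?I. x i * ?q i l) = (\<Sum>i\<in>?I. x i * q i l - x i * q i j * (q k l / q k j))"
        by (rule sum.cong) (auto simp: field_simps)
      also have "\<dots> = (\<Sum>i\<in>?I. x i * q i l) - s * (q k l / q k j)"
        by (simp only: s_def sum_subtractf sum_distrib_right)
      finally show ?thesis by simp
    qed
    then have "\<forall>l\<in>J. (\<Sum>i\<in>I. y i * q i l) = 0" using x(2) sum_y by auto
    moreover have "(\<Sum>i\<in>I. y i * q i j) = 0" using sum_y[of j] k by (simp add: s_def)
    moreover have "\<exists>i\<in>I. y i \<noteq> 0" using x(1) by (auto simp: y_def)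
    ultimately show ?thesis by auto
  qed
qed

section \<open>Restriction of a congruence to selected rows, and its cost\<close>

lemma dim_mat_adjoint [simp]:
  "dim_row (mat_adjoint A) = dim_col A" "dim_col (mat_adjoint A) = dim_row A"
  by (auto simp: mat_adjoint_def)

lemma index_mat_adjoint [simp]:
  fixes A :: "complex Matrix.mat"
  shows "i < dim_col A \<Longrightarrow> j < dim_row A \<Longrightarrow> mat_adjoint A $$ (i, j) = cnj (A $$ (j, i))"
  unfolding mat_adjoint_def by (simp add: mat_of_rows_def conjugate_complex_def)

lemma pick_UNIV [simp]: "pick UNIV n = n"
  using card_pick_inf[of UNIV n] by simp

text \<open>The inverse of \<open>pick I\<close> counts the elements of \<open>I\<close> below a
  given one. This turns sums over submatrix indices into sums over \<open>I\<close>.\<close>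

lemma bij_betw_pick:
  assumes "finite I"
  shows "bij_betw (pick I) {..<card I} I"
proof (rule bij_betw_imageI)
  show "inj_on (pick I) {..<card I}"
  proof (rule linorder_inj_onI)
    fix i j assume "i < j" "j \<in> {..<card I}"
    then have "pick I i < pick I j" by (intro pick_mono_le) auto
    then show "pick I i \<noteq> pick I j" by simp
  qed auto
  have "i \<in> pick I ` {..<card I}" if "i \<in> I" for i
  proof -
    have "card {a \<in> I. a < i} < card I"
      by (rule psubset_card_mono) (use assms that in auto)
    then have "pick I (card {a \<in> I. a < i}) \<in> pick I ` {..<card I}" by blast
    then show ?thesis by (simp only: pick_card_in_set[OF that])
  qed
  then show "pick I ` {..<card I} = I"
    using pick_in_set_le by auto
qed

text \<open>Entries of \<open>N\<close> outside \<open>I \<times> I\<close> only ever meet vanishing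
  entries of \<open>R\<close>. The bracketing on the right is the order of evaluation that is later
  charged.\<close>

lemma congruence_restrict_rows:
  fixes R N :: "complex Matrix.mat"
  assumes N: "N \<in> carrier_mat n n" and R: "R \<in> carrier_mat n m" and I: "I \<subseteq> {..<n}"
    and zero: "\<And>i j. i < n \<Longrightarrow> i \<notin> I \<Longrightarrow> j < m \<Longrightarrow> R $$ (i, j) = 0"
  shows "mat_adjoint R * N * R =
    mat_adjoint (submatrix R I UNIV) * (submatrix N I I * submatrix R I UNIV)"
proof -
  have fin: "finite I" using I finite_subset by blast
  have I': "{i. i < n \<and> i \<in> I} = I" using I by auto
  let ?RI = "submatrix R I UNIV" and ?NI = "submatrix N I I"
  have dims: "dim_row ?RI = card I" "dim_col ?RI = m" "dim_row ?NI = card I" "dim_col ?NI = card I"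
    using N R by (simp_all add: dim_submatrix I')
  have RI: "?RI $$ (i, j) = R $$ (pick I i, j)" if "i < card I" "j < m" for i j
    using that R by (subst submatrix_index) (simp_all add: I')
  have NI: "?NI $$ (i, j) = N $$ (pick I i, pick I j)" if "i < card I" "j < card I" for i j
    using that N by (subst submatrix_index) (simp_all add: I')
  \<comment> \<open>Applied twice: to the inner sum, whose terms carry the factor
    \<open>R $$ (j, b)\<close>, and then to the outer one, whose terms carry the conjugate of
    \<open>R $$ (i, a)\<close>.\<close>
  have reindex: "(\<Sum>i<card I. f (pick I i)) = (\<Sum>i<n. f i)"
    if "\<And>i. i < n \<Longrightarrow> i \<notin> I \<Longrightarrow> f i = 0" for f :: "nat \<Rightarrow> complex"
  proof -
    have "(\<Sum>i<card I. f (pick I i)) = (\<Sum>i\<in>I. f i)"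
      by (rule sum.reindex_bij_betw[OF bij_betw_pick[OF fin]])
    also have "\<dots> = (\<Sum>i<n. f i)"
      by (rule sum.mono_neutral_left) (use I that in auto)
    finally show ?thesis .
  qed
  show ?thesis
  proof (rule eq_matI)
    fix a b
    assume "a < dim_row (mat_adjoint ?RI * (?NI * ?RI))" "b < dim_col (mat_adjoint ?RI * (?NI * ?RI))"
    then have ab: "a < m" "b < m" by (simp_all add: dims)
    have "(mat_adjoint ?RI * (?NI * ?RI)) $$ (a, b) =
      (\<Sum>i<card I. cnj (R $$ (pick I i, a)) *
        (\<Sum>j<card I. N $$ (pick I i, pick I j) * R $$ (pick I j, b)))"
      using ab by (simp add: scalar_prod_def dims RI NI atLeast0LessThan)
    also have "\<dots> = (\<Sum>i<card I. cnj (R $$ (pick I i, a)) * (\<Sum>j<n. N $$ (pick I i, j) * R $$ (j, b)))"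
      by (intro sum.cong refl arg_cong[where f="times _"] reindex) (use zero ab in auto)
    also have "\<dots> = (\<Sum>i<n. cnj (R $$ (i, a)) * (\<Sum>j<n. N $$ (i, j) * R $$ (j, b)))"
      by (rule reindex) (use zero ab in auto)
    also have "\<dots> = (\<Sum>i<n. \<Sum>j<n. cnj (R $$ (i, a)) * N $$ (i, j) * R $$ (j, b))"
      by (simp add: sum_distrib_left mult.assoc)
    also have "\<dots> = (\<Sum>j<n. \<Sum>i<n. cnj (R $$ (i, a)) * N $$ (i, j) * R $$ (j, b))"
      by (rule sum.swap)
    also have "\<dots> = (mat_adjoint R * N * R) $$ (a, b)"
      using ab N R by (simp add: scalar_prod_def atLeast0LessThan sum_distrib_right)
    finally show "(mat_adjoint R * N * R) $$ (a, b) = (mat_adjoint ?RI * (?NI * ?RI)) $$ (a, b)"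
      by simp
  qed (use N R in \<open>simp_all add: dims\<close>)
qed

lemma nnz_submatrix_rows_le:
  fixes R :: "complex Matrix.mat"
  assumes "I \<subseteq> {..<dim_row R}"
  shows "nnz (submatrix R I UNIV) \<le> nnz R"
proof -
  have fin: "finite I" using assms finite_subset by blast
  have I': "{i. i < dim_row R \<and> i \<in> I} = I" using assms by auto
  let ?RI = "submatrix R I UNIV"
  have dims: "dim_row ?RI = card I" "dim_col ?RI = dim_col R"
    by (simp_all add: dim_submatrix I')
  have RI: "?RI $$ (i, j) = R $$ (pick I i, j)" if "i < card I" "j < dim_col R" for i j
    using that by (subst submatrix_index) (simp_all add: I')
  have pick: "pick I i < dim_row R" if "i < card I" for i
    using pick_in_set_le[OF that] assms by auto
  show ?thesis
    unfolding nnz_def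
  proof (rule card_inj_on_le)
    show "inj_on (\<lambda>(i, j). (pick I i, j)) {(i, j). i < dim_row ?RI \<and> j < dim_col ?RI \<and> ?RI $$ (i, j) \<noteq> 0}"
      using bij_betw_pick[OF fin] by (auto simp: inj_on_def bij_betw_def dims)
    show "finite {(i, j). i < dim_row R \<and> j < dim_col R \<and> R $$ (i, j) \<noteq> 0}"
      by (rule finite_subset[of _ "{..<dim_row R} \<times> {..<dim_col R}"]) auto
  qed (auto simp: dims RI pick)
qed

text \<open>The first product is charged with \<open>card I\<close>, since the block of
  \<open>N\<close> is square of that size; the second with \<open>m\<close>, the number of columns
  of the intermediate matrix.\<close>

lemma computable_congruence:
  fixes R N :: "complex Matrix.mat"
  assumes N: "N \<in> carrier_mat n n" and R: "R \<in> carrier_mat n m" and I: "I \<subseteq> {..<n}"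
    and zero: "\<And>i j. i < n \<Longrightarrow> i \<notin> I \<Longrightarrow> j < m \<Longrightarrow> R $$ (i, j) = 0"
    and \<kappa>: "\<kappa> \<ge> 0"
  shows "\<exists>cost. computable \<kappa> {R} {submatrix N I I} (mat_adjoint R * N * R) cost \<and>
    cost \<le> \<kappa> * real (card I + m) * real (nnz R)"
proof -
  have I': "{i. i < n \<and> i \<in> I} = I" using I by auto
  let ?RI = "submatrix R I UNIV" and ?NI = "submatrix N I I"
  have dims: "dim_row ?RI = card I" "dim_col ?RI = m" "dim_row ?NI = card I" "dim_col ?NI = card I"
    using N R by (simp_all add: dim_submatrix I')
  have "computable \<kappa> {R} {?NI} (?NI * ?RI) (0 + \<kappa> * real (max (dim_row ?NI) (dim_col ?NI)) * real (nnz ?RI))"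
    by (rule computable.mult_right[OF computable.given, of _ _ R]) (simp_all add: dims)
  then have "computable \<kappa> {R} {?NI} (mat_adjoint ?RI * (?NI * ?RI))
      (0 + \<kappa> * real (max (dim_row ?NI) (dim_col ?NI)) * real (nnz ?RI) +
        \<kappa> * real (dim_col (?NI * ?RI)) * real (nnz ?RI))"
    by (rule computable.mult_adjoint_left) (simp_all add: dims)
  moreover have "\<kappa> * real (card I + m) * real (nnz ?RI) \<le> \<kappa> * real (card I + m) * real (nnz R)"
    using nnz_submatrix_rows_le[of I R] I R \<kappa> by (intro mult_left_mono) auto
  moreover have "0 + \<kappa> * real (max (dim_row ?NI) (dim_col ?NI)) * real (nnz ?RI) +
        \<kappa> * real (dim_col (?NI * ?RI)) * real (nnz ?RI) = \<kappa> * real (card I + m) * real (nnz ?RI)"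
    by (simp add: dims distrib_left distrib_right)
  ultimately show ?thesis
    using congruence_restrict_rows[OF N R I zero] by metis
qed

section \<open>Smooth functions\<close>

lemma Ck_antimono: "Ck (Suc k) S f \<Longrightarrow> Ck k S f"
proof (induction k arbitrary: f)
  case 0
  then show ?case by (simp add: differentiable_imp_continuous_on)
next
  case (Suc k)
  then show ?case by (metis Ck.simps(2))
qed

text \<open>\<open>frechet_derivative\<close> is a choice, but derivatives at points of an open set
  are unique; so an explicit derivative may take its place in the recursion of
  \<open>Ck\<close>.\<close>

lemma Ck_Suc_UNIVI:
  assumes "\<And>x. (f has_derivative f' x) (at x)" "\<And>\<xi>. Ck k UNIV (\<lambda>x. f' x \<xi>)"
  shows "Ck (Suc k) UNIV f"
proof -
  have "frechet_derivative f (at x) = f' x" for x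
    using frechet_derivative_at[OF assms(1)] by simp
  moreover have "f differentiable_on UNIV"
    using assms(1) by (auto simp: differentiable_on_def differentiable_def)
  ultimately show ?thesis using assms(2) by simp
qed

lemma Ck_Suc_has_derivative:
  "Ck (Suc k) UNIV f \<Longrightarrow> (f has_derivative frechet_derivative f (at x)) (at x)"
  by (simp add: differentiable_on_def frechet_derivative_works)

lemma Ck_const: "Ck k UNIV (\<lambda>x. c)"
proof (induction k arbitrary: c)
  case (Suc k)
  show ?case by (rule Ck_Suc_UNIVI[of _ "\<lambda>x \<xi>. 0"]) (auto intro: Suc)
qed simp

lemma Ck_bounded_linear:
  assumes "bounded_linear f" shows "Ck k UNIV f"
proof (cases k)
  case 0
  then show ?thesis by (simp add: linear_continuous_on assms)
next
  case (Suc m)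
  show ?thesis unfolding Suc
    by (rule Ck_Suc_UNIVI[of _ "\<lambda>x. f"]) (auto intro: Ck_const bounded_linear_imp_has_derivative assms)
qed

lemma Ck_add:
  "Ck k UNIV f \<Longrightarrow> Ck k UNIV g \<Longrightarrow> Ck k UNIV (\<lambda>x. f x + g x)"
proof (induction k arbitrary: f g)
  case 0
  then show ?case by (simp add: continuous_on_add)
next
  case (Suc k)
  show ?case
  proof (rule Ck_Suc_UNIVI)
    show "((\<lambda>x. f x + g x) has_derivative
        (\<lambda>\<xi>. frechet_derivative f (at x) \<xi> + frechet_derivative g (at x) \<xi>)) (at x)" for x
      using Suc.prems by (intro has_derivative_add Ck_Suc_has_derivative)
    show "Ck k UNIV (\<lambda>x. frechet_derivative f (at x) \<xi> + frechet_derivative g (at x) \<xi>)" for \<xi>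
      using Suc.prems by (intro Suc.IH) auto
  qed
qed

lemma Ck_mult:
  fixes f g :: "'a::real_normed_vector \<Rightarrow> 'b::real_normed_algebra"
  shows "Ck k UNIV f \<Longrightarrow> Ck k UNIV g \<Longrightarrow> Ck k UNIV (\<lambda>x. f x * g x)"
proof (induction k arbitrary: f g)
  case 0
  then show ?case by (simp add: continuous_on_mult)
next
  case (Suc k)
  show ?case
  proof (rule Ck_Suc_UNIVI)
    show "((\<lambda>x. f x * g x) has_derivative
        (\<lambda>\<xi>. f x * frechet_derivative g (at x) \<xi> + frechet_derivative f (at x) \<xi> * g x)) (at x)" for x
      using Suc.prems by (intro has_derivative_mult Ck_Suc_has_derivative)
    show "Ck k UNIV (\<lambda>x. f x * frechet_derivative g (at x) \<xi> + frechet_derivative f (at x) \<xi> * g x)" for \<xi>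
      using Suc.prems by (intro Ck_add Suc.IH) (auto intro: Ck_antimono)
  qed
qed

lemma Ck_compose_linear:
  assumes h: "bounded_linear h"
  shows "Ck k UNIV f \<Longrightarrow> Ck k UNIV (\<lambda>x. h (f x))"
proof (induction k arbitrary: f)
  case 0
  then show ?case by (simp add: bounded_linear.continuous_on[OF h])
next
  case (Suc k)
  show ?case
  proof (rule Ck_Suc_UNIVI)
    show "((\<lambda>x. h (f x)) has_derivative (\<lambda>\<xi>. h (frechet_derivative f (at x) \<xi>))) (at x)" for x
      using Suc.prems by (intro bounded_linear.has_derivative[OF h] Ck_Suc_has_derivative)
    show "Ck k UNIV (\<lambda>x. h (frechet_derivative f (at x) \<xi>))" for \<xi>
      using Suc.prems by (intro Suc.IH) auto
  qed
qed

lemma Ck_prod: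
  fixes f :: "'i \<Rightarrow> 'a::real_normed_vector \<Rightarrow> 'b::{real_normed_algebra_1, comm_ring_1}"
  assumes "\<And>i. i \<in> I \<Longrightarrow> Ck k UNIV (f i)"
  shows "Ck k UNIV (\<lambda>x. \<Prod>i\<in>I. f i x)"
  using assms
  by (induction I rule: infinite_finite_induct) (auto intro: Ck_mult Ck_const)

text \<open>The derivative of a member of this family is a combination of members, so all of them are smooth.\<close>

definition flat :: "nat \<Rightarrow> real \<Rightarrow> real" where
  "flat m t = (if t \<le> 0 then 0 else exp (- (1 / t)) / t ^ m)"

lemma flat_tendsto: "(flat m \<longlongrightarrow> 0) (at_right 0)"
proof -
  have "((\<lambda>t::real. exp (- (1 / t)) / t ^ m) \<longlongrightarrow> 0) (at_right 0)"
  proof -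
    have "((\<lambda>s::real. s ^ m / exp s) \<longlongrightarrow> 0) at_top"
      by (rule tendsto_power_div_exp_0)
    then have "((\<lambda>t::real. inverse t ^ m / exp (inverse t)) \<longlongrightarrow> 0) (at_right 0)"
      by (rule filterlim_compose) (rule filterlim_inverse_at_top_right)
    then show ?thesis
      by (simp add: exp_minus field_simps)
  qed
  then show ?thesis
    by (rule Lim_transform_eventually) (auto simp: flat_def eventually_at_filter)
qed

lemma flat_has_derivative:
  "(flat m has_real_derivative flat (m + 2) t - real m * flat (m + 1) t) (at t)"
proof (cases t "0::real" rule: linorder_cases)
  case less
  have "((\<lambda>_. 0) has_real_derivative 0) (at t)" by simp
  then have "(flat m has_real_derivative 0) (at t)"
    by (rule has_field_derivative_transform_within_open[of _ _ _ "{..<0}"]) (use less in \<open>auto simp: flat_def\<close>)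
  then show ?thesis using less by (simp add: flat_def)
next
  case greater
  have "((\<lambda>t. exp (- (1 / t)) / t ^ m) has_real_derivative flat (m + 2) t - real m * flat (m + 1) t) (at t)"
    using greater
    \<comment> \<open>The split on \<open>m\<close> deals with the truncated exponent
      \<open>m - 1\<close> of the power rule.\<close>
    by (auto intro!: derivative_eq_intros simp: flat_def field_simps power2_eq_square) (cases m; simp add: field_simps)
  then show ?thesis
    by (rule has_field_derivative_transform_within_open[of _ _ _ "{0<..}"]) (use greater in \<open>auto simp: flat_def\<close>)
next
  case equal
  \<comment> \<open>At the origin the difference quotient is itself in the family: from the right it
    is \<open>flat (Suc m)\<close>, from the left it is zero.\<close>
  have "((\<lambda>h. flat m h / h) \<longlongrightarrow> 0) (at 0)"
  proof -
    have "((\<lambda>h. flat m h / h) \<longlongrightarrow> 0) (at_right 0)"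
      using flat_tendsto[of "Suc m"]
      by (rule Lim_transform_eventually) (auto simp: flat_def eventually_at_filter)
    moreover have "((\<lambda>h. flat m h / h) \<longlongrightarrow> 0) (at_left 0)"
      by (rule Lim_transform_eventually[OF tendsto_const]) (auto simp: flat_def eventually_at_filter)
    ultimately show ?thesis by (simp add: filterlim_split_at)
  qed
  then show ?thesis using equal by (simp add: DERIV_def flat_def)
qed

text \<open>The induction keeps \<open>m\<close> arbitrary because each derivative raises the index
  by one and by two.\<close>

lemma Ck_flat_compose:
  fixes q :: "'a::real_normed_vector \<Rightarrow> real"
  assumes q: "smooth q"
  shows "Ck k UNIV (\<lambda>x. flat m (q x))"
proof (induction k arbitrary: m)
  case 0
  have "continuous_on UNIV (flat m)"
    by (intro continuous_at_imp_continuous_on ballI DERIV_isCont[OF flat_has_derivative])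
  moreover have "continuous_on UNIV q" using q Ck.simps(1) by (metis smooth_def)
  ultimately show ?case by (auto intro: continuous_on_compose2)
next
  case (Suc k)
  have q': "Ck j UNIV q" for j using q by (simp add: smooth_def)
  show ?case
  proof (rule Ck_Suc_UNIVI)
    show "((\<lambda>x. flat m (q x)) has_derivative
       (\<lambda>\<xi>. (flat (m + 2) (q x) + (- real m) * flat (m + 1) (q x)) * frechet_derivative q (at x) \<xi>)) (at x)" for x
      using has_derivative_compose[OF Ck_Suc_has_derivative[OF q'[of 1, simplified One_nat_def]]
        flat_has_derivative[of m "q x", unfolded has_field_derivative_def]]
      by simp
    show "Ck k UNIV (\<lambda>x. (flat (m + 2) (q x) + (- real m) * flat (m + 1) (q x)) * frechet_derivative q (at x) \<xi>)" for \<xi>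
      using q'[of "Suc k"] by (intro Ck_mult Ck_add Suc Ck_const) auto
  qed
qed

section \<open>Smooth functions and cutoffs supported in boxes\<close>

lemma smooth_imp_Ck: "smooth f \<Longrightarrow> Ck k UNIV f"
  by (simp add: smooth_def)

lemma smooth_continuous: "smooth f \<Longrightarrow> continuous_on S f"
  using smooth_imp_Ck[of f 0] continuous_on_subset by auto

lemma smooth_has_derivative: "smooth f \<Longrightarrow> (f has_derivative frechet_derivative f (at x)) (at x)"
  by (rule Ck_Suc_has_derivative[OF smooth_imp_Ck])

lemma smooth_derivative: "smooth f \<Longrightarrow> smooth (\<lambda>x. frechet_derivative f (at x) \<xi>)"
  unfolding smooth_def by (metis Ck.simps(2))

lemma smooth_mult:
  fixes f g :: "'a::real_normed_vector \<Rightarrow> 'b::real_normed_algebra"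
  shows "smooth f \<Longrightarrow> smooth g \<Longrightarrow> smooth (\<lambda>x. f x * g x)"
  by (simp add: smooth_def Ck_mult)

lemma frechet_derivative_smooth_mult:
  fixes f g :: "'a::real_normed_vector \<Rightarrow> 'b::real_normed_algebra"
  assumes "smooth f" "smooth g"
  shows "frechet_derivative (\<lambda>x. f x * g x) (at x) \<xi> =
    f x * frechet_derivative g (at x) \<xi> + frechet_derivative f (at x) \<xi> * g x"
  using frechet_derivative_at[OF has_derivative_mult[OF smooth_has_derivative[OF assms(1)]
    smooth_has_derivative[OF assms(2)], of x]]
  by (metis (no_types, lifting))

text \<open>A product of one-dimensional bumps \<open>exp (- 1 / t)\<close>, with \<open>t\<close>
  positive exactly between the two faces in direction \<open>i\<close>. For \<open>c = 1\<close> it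
  serves as a cutoff; letting \<open>c\<close> grow makes it approach the indicator of the open
  box.\<close>

definition box_bump :: "real \<Rightarrow> real^'n \<Rightarrow> real^'n \<Rightarrow> real^'n \<Rightarrow> complex" where
  "box_bump c a b x = of_real (\<Prod>i\<in>UNIV. flat 0 (c * ((x $ i - a $ i) * (b $ i - x $ i))))"

lemma smooth_box_bump:
  fixes a b :: "real^'n"
  shows "smooth (box_bump c a b)"
proof -
  have lin: "Ck k UNIV (\<lambda>x::real^'n. x $ i)" for k i
    by (rule Ck_bounded_linear) (rule bounded_linear_vec_nth)
  have "smooth (\<lambda>x. c * ((x $ i - a $ i) * (b $ i - x $ i)))" for i
  proof -
    have "Ck k UNIV (\<lambda>x. c * ((x $ i + (- a $ i)) * (b $ i + (-1) * x $ i)))" for k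
      by (intro Ck_mult Ck_add Ck_const lin)
    then show ?thesis by (simp add: smooth_def)
  qed
  then have "Ck k UNIV (\<lambda>x. complex_of_real (\<Prod>i\<in>UNIV. flat 0 (c * ((x $ i - a $ i) * (b $ i - x $ i)))))" for k
    by (rule Ck_compose_linear[OF bounded_linear_of_real Ck_prod[OF Ck_flat_compose]])
  then show ?thesis
    by (simp add: smooth_def box_bump_def[abs_def])
qed

lemma flat_bounds: "0 \<le> flat 0 t" "flat 0 t \<le> 1" "flat 0 t = 0 \<longleftrightarrow> t \<le> 0"
  by (auto simp: flat_def)

lemma box_bump_nonzero_iff:
  fixes a b :: "real^'n"
  assumes "c > 0" "\<And>i. a $ i \<le> b $ i"
  shows "box_bump c a b x \<noteq> 0 \<longleftrightarrow> x \<in> box a b"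
proof -
  \<comment> \<open>Both factors negative would mean \<open>b $ i < x $ i < a $ i\<close>, which the
    ordering of the corners excludes.\<close>
  have "0 < (x $ i - a $ i) * (b $ i - x $ i) \<longleftrightarrow> a $ i < x $ i \<and> x $ i < b $ i" for i
    unfolding zero_less_mult_iff using assms(2)[of i] by linarith
  then have "flat 0 (c * ((x $ i - a $ i) * (b $ i - x $ i))) \<noteq> 0 \<longleftrightarrow> a $ i < x $ i \<and> x $ i < b $ i" for i
    unfolding flat_bounds not_le using zero_less_mult_pos[OF _ assms(1)] mult_pos_pos[OF assms(1)] by metis
  then show ?thesis
    unfolding box_bump_def of_real_eq_0_iff mem_box_cart by (subst prod_zero_iff) auto
qed

lemma norm_box_bump_le: "norm (box_bump c a b x) \<le> 1"
proof -
  have "(\<Prod>i\<in>UNIV. flat 0 (c * ((x $ i - a $ i) * (b $ i - x $ i)))) \<le> (\<Prod>i\<in>(UNIV::'a set). 1)"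
    by (rule prod_mono) (simp add: flat_bounds)
  moreover have "0 \<le> (\<Prod>i\<in>UNIV. flat 0 (c * ((x $ i - a $ i) * (b $ i - x $ i))))"
    by (rule prod_nonneg) (simp add: flat_bounds)
  ultimately show ?thesis unfolding box_bump_def norm_of_real by simp
qed

text \<open>Inside the box each factor is \<open>exp (- 1 / ((n + 1) * d))\<close> with fixed
  \<open>d > 0\<close>; outside, the whole product is zero. With the uniform bound 1 this prepares
  dominated convergence.\<close>

lemma box_bump_tendsto_indicator:
  fixes a b :: "real^'n"
  assumes "\<And>i. a $ i \<le> b $ i"
  shows "(\<lambda>n. box_bump (real (Suc n)) a b x) \<longlonglongrightarrow> indicator (box a b) x"
proof (cases "x \<in> box a b")
  case False
  then have "box_bump (real (Suc n)) a b x = 0" for n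
    using box_bump_nonzero_iff[OF _ assms, of "real (Suc n)"] by auto
  then show ?thesis using False by simp
next
  case True
  have "(\<lambda>n. flat 0 (real (Suc n) * ((x $ i - a $ i) * (b $ i - x $ i)))) \<longlonglongrightarrow> 1" for i
  proof -
    define d where "d = (x $ i - a $ i) * (b $ i - x $ i)"
    have d: "d > 0" using True by (simp add: d_def mem_box_cart)
    have "(\<lambda>n. exp (- (inverse d * inverse (real (Suc n))))) \<longlonglongrightarrow> exp (- (inverse d * 0))"
      by (intro tendsto_intros LIMSEQ_inverse_real_of_nat)
    moreover have "flat 0 (real (Suc n) * d) = exp (- (inverse d * inverse (real (Suc n))))" for n
    proof -
      have "0 < real (Suc n) * d" using d by simp
      then show ?thesis
        by (simp add: flat_def inverse_eq_divide not_le mult.commute del: of_nat_Suc)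
    qed
    ultimately show ?thesis
      unfolding d_def[symmetric] by simp
  qed
  then have "(\<lambda>n. \<Prod>i\<in>UNIV. flat 0 (real (Suc n) * ((x $ i - a $ i) * (b $ i - x $ i)))) \<longlonglongrightarrow> (\<Prod>i\<in>(UNIV::'n set). 1)"
    by (intro tendsto_prod)
  from tendsto_of_real[OF this, where 'a=complex] show ?thesis
    using True by (simp add: box_bump_def[abs_def] del: of_real_prod)
qed

lemma box_bump_test_function:
  fixes a b :: "real^'n"
  assumes "cbox a b \<subseteq> \<Omega>" "c > 0" "\<And>i. a $ i \<le> b $ i"
  shows "box_bump c a b \<in> test_functions \<Omega>"
proof -
  have "box_bump c a b x = 0" if "x \<notin> cbox a b" for x
    using that box_bump_nonzero_iff[OF assms(2,3), of x] box_subset_cbox[of a b] by blast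
  then show ?thesis
    using assms(1) smooth_box_bump[of c a b] compact_cbox[of a b] unfolding test_functions_def by blast
qed

section \<open>Weak gradients\<close>

text \<open>By Lindelof countably many of the neighbourhoods already cover \<open>A\<close>, so the
  union of their exceptional sets is still null.\<close>

lemma AE_locally:
  fixes A :: "'a::second_countable_topology set"
  assumes "\<And>x. x \<in> A \<Longrightarrow> \<exists>U. open U \<and> x \<in> U \<and> (AE y in M. y \<in> U \<longrightarrow> P y)"
  shows "AE y in M. y \<in> A \<longrightarrow> P y"
proof -
  define \<F> where "\<F> = {U. open U \<and> (AE y in M. y \<in> U \<longrightarrow> P y)}"
  obtain \<F>' where F: "\<F>' \<subseteq> \<F>" "countable \<F>'" "\<Union>\<F>' = \<Union>\<F>"
    using Lindelof[of \<F>] by (auto simp: \<F>_def)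
  have "AE y in M. \<forall>U\<in>\<F>'. y \<in> U \<longrightarrow> P y"
    using F by (subst AE_ball_countable) (auto simp: \<F>_def)
  moreover have "A \<subseteq> \<Union>\<F>'"
    using assms unfolding F(3) \<F>_def by blast
  ultimately show ?thesis by (auto elim!: eventually_mono)
qed

text \<open>Boxes form an intersection-stable generator, so vanishing integrals pass from boxes to
  Borel subsets, then to Lebesgue subsets of \<open>box a b\<close>; a function whose integrals over
  all of these vanish is zero almost everywhere.\<close>

lemma AE_zero_of_box_integrals:
  fixes h :: "'a::euclidean_space \<Rightarrow> 'b::{second_countable_topology, banach}"
  assumes h: "integrable lebesgue h"
    and box: "\<And>c d. box c d \<subseteq> box a b \<Longrightarrow> (LINT x|lebesgue. indicator (box c d) x *\<^sub>R h x) = 0"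
  shows "AE x in lebesgue. x \<in> box a b \<longrightarrow> h x = 0"
proof -
  let ?Q = "box a b"
  let ?G = "{B. \<exists>c d. B = box c d \<and> B \<subseteq> ?Q}"
  have int: "integrable lebesgue (\<lambda>x. indicator A x *\<^sub>R h x)" if "A \<in> sets lebesgue" for A
    using integrable_mult_indicator[OF that h] .
  have sub: "sigma_sets ?Q ?G \<subseteq> sets borel"
  proof
    fix A assume "A \<in> sigma_sets ?Q ?G"
    then show "A \<in> sets borel"
    proof induction
      case (Basic B)
      then show ?case using open_box by (auto intro: borel_open)
    next
      case (Compl B)
      then show ?case by (intro sets.Diff[OF borel_open[OF open_box]])
    next
      case (Union B)
      then show ?case by (intro sets.countable_UN) auto
    qed simp
  qed
  have stable: "Int_stable ?G"
    unfolding Int_stable_def by (auto simp: box_Int_box) blast+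
  \<comment> \<open>Dynkin argument. The complement step uses that \<open>?Q\<close> is itself one
    of the boxes; the union step is countable additivity of the integral.\<close>
  have zero: "(LINT x|lebesgue. indicator A x *\<^sub>R h x) = 0" if "A \<in> sigma_sets ?Q ?G" for A
  proof (rule sigma_sets_induct_disjoint[OF stable _ that])
    fix B assume B: "B \<in> sigma_sets ?Q ?G" "(LINT x|lebesgue. indicator B x *\<^sub>R h x) = 0"
    have B': "B \<subseteq> ?Q" using sigma_sets_into_sp[OF _ B(1)] by blast
    have "(LINT x|lebesgue. indicator (?Q - B) x *\<^sub>R h x) =
      (LINT x|lebesgue. indicator ?Q x *\<^sub>R h x - indicator B x *\<^sub>R h x)"
      by (rule Bochner_Integration.integral_cong) (use B' in \<open>auto simp: indicator_def\<close>)
    also have "\<dots> = (LINT x|lebesgue. indicator ?Q x *\<^sub>R h x) - (LINT x|lebesgue. indicator B x *\<^sub>R h x)"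
      using B(1) sub by (intro Bochner_Integration.integral_diff int) auto
    finally show "(LINT x|lebesgue. indicator (?Q - B) x *\<^sub>R h x) = 0" using B(2) box by simp
  next
    fix B :: "nat \<Rightarrow> 'a set"
    assume B: "disjoint_family B" "range B \<subseteq> sigma_sets ?Q ?G"
      "\<And>i. (LINT x|lebesgue. indicator (B i) x *\<^sub>R h x) = 0"
    have "B i \<in> sets borel" for i using B(2) sub by blast
    then have "B i \<in> sets lebesgue" for i by simp
    then have "(LINT x:(\<Union>i. B i)|lebesgue. h x) = (\<Sum>i. LINT x:B i|lebesgue. h x)"
      using B(1) h
      by (intro lebesgue_integral_countable_add)
        (auto simp: disjoint_family_on_def set_integrable_def intro!: int)
    then show "(LINT x|lebesgue. indicator (\<Union>i. B i) x *\<^sub>R h x) = 0"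
      using B(3) by (simp add: set_lebesgue_integral_def)
  qed (use box in auto)
  have borel: "(LINT x|lebesgue. indicator (?Q \<inter> A) x *\<^sub>R h x) = 0" if A: "A \<in> sets borel" for A
  proof -
    \<comment> \<open>The Borel sets cut down to \<open>?Q\<close> are generated by boxes cut down
      to \<open>?Q\<close>, and these are boxes again.\<close>
    have eq: "sets (borel :: 'a measure) = sigma_sets UNIV (range (\<lambda>(c, d). box c d))"
      by (subst borel_eq_box) simp
    have "?Q \<inter> A \<in> (\<inter>) ?Q ` sigma_sets UNIV (range (\<lambda>(c, d). box c d))"
      using A unfolding eq by (rule imageI)
    also have "\<dots> = sigma_sets ?Q ((\<inter>) ?Q ` range (\<lambda>(c, d). box c d))"
      using borel_open[OF open_box[of a b]] unfolding eq by (rule sigma_sets_Int) simp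
    also have "\<dots> \<subseteq> sigma_sets ?Q ?G"
      by (rule sigma_sets_mono') (auto simp: box_Int_box, metis box_Int_box inf.cobounded1)
    finally show ?thesis by (rule zero)
  qed
  have "AE x in lebesgue_on ?Q. h x = 0"
  proof (rule sigma_finite_measure.density_zero)
    show "sigma_finite_measure (lebesgue_on ?Q)"
      by (rule finite_measure.axioms(1)[OF finite_measure_lebesgue_on[OF lmeasurable_box]])
    show "integrable (lebesgue_on ?Q) h"
      by (subst integrable_restrict_space) (auto intro!: int)
    fix A :: "'a set" assume "A \<in> sets (lebesgue_on ?Q)"
    then have A: "A \<in> sets lebesgue" by (auto simp: sets_restrict_space)
    \<comment> \<open>\<open>density_zero\<close> asks for all Lebesgue sets, while
      \<open>borel\<close> covers Borel ones; the two differ by the null set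
      \<open>T\<close>.\<close>
    obtain C T where CT: "fsigma C" "T \<in> null_sets lebesgue" "C \<union> T = A"
      by (rule lebesgue_set_almost_fsigma[OF A])
    from CT(1) have C: "C \<in> sets borel"
    proof cases
      case (1 F)
      show ?thesis unfolding 1(1) by (rule sets.countable_UN) (use 1(2) in auto)
    qed
    have QC: "?Q \<inter> C \<in> sets lebesgue" using C by simp
    have "A \<inter> ?Q \<in> sets lebesgue" using A by (rule sets.Int) simp
    from borel_measurable_integrable[OF int[OF this]]
    have QA: "(\<lambda>x. indicator A x *\<^sub>R indicator ?Q x *\<^sub>R h x) \<in> borel_measurable lebesgue"
      by (simp add: indicator_inter_arith scaleR_scaleR[symmetric] del: scaleR_scaleR)
    have "AE x in lebesgue. x \<notin> T" using CT(2) by (rule AE_not_in)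
    then have "AE x in lebesgue. indicator A x *\<^sub>R indicator ?Q x *\<^sub>R h x = indicator (?Q \<inter> C) x *\<^sub>R h x"
      by (rule eventually_mono) (auto simp: CT(3)[symmetric] indicator_def)
    then have "(LINT x:A|lebesgue. indicator ?Q x *\<^sub>R h x) = (LINT x|lebesgue. indicator (?Q \<inter> C) x *\<^sub>R h x)"
      unfolding set_lebesgue_integral_def
      by (rule integral_cong_AE[OF QA borel_measurable_integrable[OF int[OF QC]]])
    then show "(LINT x:A|lebesgue_on ?Q. h x) = 0"
      using borel[OF C] by (subst set_integral_restrict_space) auto
  qed
  then show ?thesis by (subst (asm) AE_restrict_space_iff) auto
qed

text \<open>On a finite measure space \<open>norm (f x) \<le> 1 + (norm (f x))\<^sup>2\<close>
  supplies an integrable majorant.\<close>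

lemma integrable_times_bounded:
  fixes f \<psi> :: "'a \<Rightarrow> complex"
  assumes "f \<in> L2 M" "finite_measure M" "\<psi> \<in> borel_measurable M"
    and b: "\<And>x. x \<in> space M \<Longrightarrow> norm (\<psi> x) \<le> C"
  shows "integrable M (\<lambda>x. f x * \<psi> x)"
proof -
  interpret finite_measure M by fact
  have f: "f \<in> borel_measurable M" "integrable M (\<lambda>x. (norm (f x))\<^sup>2)"
    using assms(1) by (auto simp: L2_def)
  show ?thesis
  proof (rule Bochner_Integration.integrable_bound)
    show "integrable M (\<lambda>x. C * (1 + (norm (f x))\<^sup>2))" using f by simp
    show "(\<lambda>x. f x * \<psi> x) \<in> borel_measurable M"
      using f assms(3) by (intro borel_measurable_times)
    have "norm (f x * \<psi> x) \<le> norm (C * (1 + (norm (f x))\<^sup>2))" if x: "x \<in> space M" for x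
    proof -
      have "0 \<le> C" using b[OF x] norm_ge_zero order_trans by blast
      have "norm (f x) \<le> 1 + (norm (f x))\<^sup>2"
        using sum_squares_ge_zero[of "norm (f x) - 1" 0] by (simp add: power2_eq_square algebra_simps) (smt (verit) zero_le_square)
      then have "norm (f x) * norm (\<psi> x) \<le> (1 + (norm (f x))\<^sup>2) * C"
        using b[OF x] by (intro mult_mono) auto
      then show ?thesis using \<open>0 \<le> C\<close> by (simp add: norm_mult abs_mult mult.commute)
    qed
    then show "AE x in M. norm (f x * \<psi> x) \<le> norm (C * (1 + (norm (f x))\<^sup>2))" by simp
  qed
qed

lemma continuous_bounded_on_bounded:
  fixes f :: "'a::heine_borel \<Rightarrow> 'b::real_normed_vector"
  assumes "continuous_on UNIV f" "bounded \<Omega>"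
  obtains C where "C \<ge> 0" "\<And>x. x \<in> \<Omega> \<Longrightarrow> norm (f x) \<le> C"
proof -
  have "compact (closure \<Omega>)" using assms by (simp add: compact_closure)
  then have "bounded (f ` closure \<Omega>)"
    by (intro compact_imp_bounded compact_continuous_image continuous_on_subset[OF assms(1)]) auto
  then obtain C where "\<And>x. x \<in> closure \<Omega> \<Longrightarrow> norm (f x) \<le> C"
    unfolding bounded_iff by blast
  then have "\<And>x. x \<in> \<Omega> \<Longrightarrow> norm (f x) \<le> max C 0"
    using closure_subset[of \<Omega>] by (metis max.coboundedI1 subsetD)
  then show ?thesis using that[of "max C 0"] by simp
qed

lemma integrable_times_continuous:
  fixes f \<psi> :: "'a::euclidean_space \<Rightarrow> complex"
  assumes f: "f \<in> L2 (lebesgue_on \<Omega>)" and \<psi>: "continuous_on UNIV \<psi>" and \<Omega>: "open \<Omega>" "bounded \<Omega>"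
  shows "integrable (lebesgue_on \<Omega>) (\<lambda>x. f x * \<psi> x)"
proof -
  obtain C where "\<And>x. x \<in> \<Omega> \<Longrightarrow> norm (\<psi> x) \<le> C"
    using continuous_bounded_on_bounded[OF \<psi> \<Omega>(2)] by blast
  moreover have "\<psi> \<in> borel_measurable (lebesgue_on \<Omega>)"
    using \<Omega>(1) by (intro continuous_imp_measurable_on_sets_lebesgue continuous_on_subset[OF \<psi>]) auto
  moreover have "finite_measure (lebesgue_on \<Omega>)"
    using \<Omega> by (intro finite_measure_lebesgue_on lmeasurable_open)
  ultimately show ?thesis
    using f by (intro integrable_times_bounded[where C = C]) auto
qed

text \<open>Rests on \<open>(a + b)\<^sup>2 \<le> 2 * a\<^sup>2 + 2 * b\<^sup>2\<close>. Two
  summands with free coefficients cover differences, single components (one coefficient zero) and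
  the two terms of the product rule alike.\<close>

lemma L2_comparison:
  fixes f :: "'a \<Rightarrow> 'b::euclidean_space" and g :: "'a \<Rightarrow> 'c::euclidean_space" and h :: "'a \<Rightarrow> 'd::euclidean_space"
  assumes f: "f \<in> borel_measurable M" and g: "g \<in> L2 M" and h: "h \<in> L2 M"
    and b: "\<And>x. x \<in> space M \<Longrightarrow> norm (f x) \<le> A * norm (g x) + B * norm (h x)"
  shows "f \<in> L2 M"
    and "(LINT x|M. (norm (f x))\<^sup>2) \<le> 2 * A\<^sup>2 * (LINT x|M. (norm (g x))\<^sup>2) + 2 * B\<^sup>2 * (LINT x|M. (norm (h x))\<^sup>2)"
proof -
  have int: "integrable M (\<lambda>x. (norm (g x))\<^sup>2)" "integrable M (\<lambda>x. (norm (h x))\<^sup>2)"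
    using g h by (auto simp: L2_def)
  let ?b = "\<lambda>x. 2 * A\<^sup>2 * (norm (g x))\<^sup>2 + 2 * B\<^sup>2 * (norm (h x))\<^sup>2"
  have int': "integrable M ?b" using int by simp
  have le: "(norm (f x))\<^sup>2 \<le> ?b x" if "x \<in> space M" for x
  proof -
    have "(norm (f x))\<^sup>2 \<le> (A * norm (g x) + B * norm (h x))\<^sup>2"
      using b[OF that] by (intro power_mono) auto
    also have "\<dots> \<le> 2 * (A * norm (g x))\<^sup>2 + 2 * (B * norm (h x))\<^sup>2"
      using zero_le_power2[of "A * norm (g x) - B * norm (h x)"] by (simp add: power2_sum power2_diff)
    finally show ?thesis by (simp add: power_mult_distrib)
  qed
  have intf: "integrable M (\<lambda>x. (norm (f x))\<^sup>2)"
    using f by (intro Bochner_Integration.integrable_bound[OF int'] AE_I2) (auto intro: order_trans[OF le])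
  then show "f \<in> L2 M" using f by (simp add: L2_def)
  have "(LINT x|M. (norm (f x))\<^sup>2) \<le> (LINT x|M. ?b x)"
    using intf int' le by (intro integral_mono) auto
  also have "\<dots> = 2 * A\<^sup>2 * (LINT x|M. (norm (g x))\<^sup>2) + 2 * B\<^sup>2 * (LINT x|M. (norm (h x))\<^sup>2)"
    using int by simp
  finally show "(LINT x|M. (norm (f x))\<^sup>2) \<le> \<dots>" .
qed

lemma borel_measurable_vec_nth:
  fixes f :: "'a \<Rightarrow> 'b::real_normed_vector^'n"
  assumes "f \<in> borel_measurable M" shows "(\<lambda>x. f x $ i) \<in> borel_measurable M"
  using borel_measurable_continuous_on[OF linear_continuous_on[OF bounded_linear_vec_nth] assms] .

lemma borel_measurable_vec_lambda:
  fixes f :: "'n::finite \<Rightarrow> 'a \<Rightarrow> complex"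
  assumes "\<And>i. f i \<in> borel_measurable M"
  shows "(\<lambda>x. \<chi> i. f i x) \<in> borel_measurable M"
proof (rule iffD2[OF borel_measurable_euclidean_space], rule ballI)
  fix b :: "complex^'n" assume "b \<in> Basis"
  then obtain i u where "b = axis i u" unfolding Basis_vec_def by blast
  then show "(\<lambda>x. (\<chi> i. f i x) \<bullet> b) \<in> borel_measurable M"
    by (simp only: inner_axis vec_lambda_beta) (rule borel_measurable_inner[OF assms borel_measurable_const])
qed

lemma norm_vec_le_sum: "norm x \<le> (\<Sum>i\<in>UNIV. norm (x $ i))"
  unfolding norm_vec_def by (rule L2_set_le_sum) simp

lemma L2_vec_nth:
  fixes g :: "'a \<Rightarrow> complex^'n"
  assumes "g \<in> L2 M" shows "(\<lambda>x. g x $ i) \<in> L2 M"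
  by (rule L2_comparison(1)[OF borel_measurable_vec_nth assms assms, of _ _ 1 0])
    (use assms Finite_Cartesian_Product.norm_nth_le in \<open>auto simp: L2_def\<close>)

lemma L2_diff:
  fixes f g :: "'a \<Rightarrow> 'b::euclidean_space"
  assumes "f \<in> L2 M" "g \<in> L2 M" shows "(\<lambda>x. f x - g x) \<in> L2 M"
  by (rule L2_comparison(1)[OF _ assms, of _ 1 1])
    (use assms norm_triangle_ineq4 in \<open>auto simp: L2_def\<close>)

lemma test_function_continuous:
  "\<phi> \<in> test_functions \<Omega> \<Longrightarrow> continuous_on UNIV \<phi>"
  by (auto simp: test_functions_def smooth_continuous)

text \<open>The fundamental lemma of the calculus of variations. Bumps converge boundedly to
  indicators of boxes whose closed hull lies in \<Omega>, so the integrals over such boxes vanish;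
  boxes of this kind surround every point of \<Omega>.\<close>

lemma AE_zero_of_test_integrals:
  fixes h :: "real^'n \<Rightarrow> complex"
  assumes h: "h \<in> L2 (lebesgue_on \<Omega>)" and \<Omega>: "open \<Omega>" "bounded \<Omega>"
    and zero: "\<And>\<phi>. \<phi> \<in> test_functions \<Omega> \<Longrightarrow> (LINT x|lebesgue_on \<Omega>. h x * \<phi> x) = 0"
  shows "AE x in lebesgue_on \<Omega>. h x = 0"
proof -
  have \<Omega>': "\<Omega> \<in> sets lebesgue" "\<Omega> \<inter> space lebesgue \<in> sets lebesgue" using \<Omega>(1) by auto
  have int: "integrable (lebesgue_on \<Omega>) h"
    using integrable_times_continuous[OF h _ \<Omega>, of "\<lambda>_. 1"] by simp
  \<comment> \<open>Extension by zero, because the criterion with boxes is stated for Lebesgue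
    measure on the whole space.\<close>
  define H where "H x = indicat_real \<Omega> x *\<^sub>R h x" for x
  have H: "integrable lebesgue H"
    using int unfolding H_def by (subst (asm) integrable_restrict_space[OF \<Omega>'(2)])
  have box_ab: "(LINT x|lebesgue. indicator (box c d) x *\<^sub>R H x) = 0"
    if cd: "cbox c d \<subseteq> \<Omega>" "\<And>i. c $ i \<le> d $ i" for c d
  proof -
    have "(\<lambda>n. LINT x|lebesgue_on \<Omega>. h x * box_bump (real (Suc n)) c d x)
      \<longlonglongrightarrow> (LINT x|lebesgue_on \<Omega>. h x * indicator (box c d) x)"
    proof (rule integral_dominated_convergence)
      show "integrable (lebesgue_on \<Omega>) (\<lambda>x. norm (h x))" using int by simp
      show "(\<lambda>x. h x * indicator (box c d) x) \<in> borel_measurable (lebesgue_on \<Omega>)"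
        by (intro borel_measurable_times[OF borel_measurable_integrable[OF int]]
            measurable_restrict_space1 borel_measurable_indicator) simp
      show "(\<lambda>x. h x * box_bump (real (Suc n)) c d x) \<in> borel_measurable (lebesgue_on \<Omega>)" for n
        by (intro borel_measurable_integrable integrable_times_continuous[OF h _ \<Omega>] smooth_continuous smooth_box_bump)
      show "AE x in lebesgue_on \<Omega>. norm (h x * box_bump (real (Suc n)) c d x) \<le> norm (h x)" for n
        using norm_box_bump_le by (auto simp: norm_mult intro!: AE_I2 mult_left_le)
      show "AE x in lebesgue_on \<Omega>. (\<lambda>n. h x * box_bump (real (Suc n)) c d x) \<longlonglongrightarrow> h x * indicator (box c d) x"
        by (intro AE_I2 tendsto_mult_left box_bump_tendsto_indicator cd)
    qed
    moreover have "(LINT x|lebesgue_on \<Omega>. h x * box_bump (real (Suc n)) c d x) = 0" for n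
      by (intro zero box_bump_test_function cd) simp
    ultimately have "(LINT x|lebesgue_on \<Omega>. h x * indicator (box c d) x) = 0"
      by (simp only: LIMSEQ_const_iff)
    then have "(LINT x|lebesgue. indicat_real \<Omega> x *\<^sub>R (h x * indicator (box c d) x)) = 0"
      by (simp only: integral_restrict_space[OF \<Omega>'(2)])
    moreover have "(\<lambda>x. indicat_real \<Omega> x *\<^sub>R (h x * indicator (box c d) x)) = (\<lambda>x. indicator (box c d) x *\<^sub>R H x)"
      by (auto simp: H_def indicator_def)
    ultimately show ?thesis by simp
  qed
  have "AE x in lebesgue. x \<in> \<Omega> \<longrightarrow> H x = 0"
  proof (rule AE_locally)
    fix x assume x: "x \<in> \<Omega>"
    obtain a b where ab: "x \<in> box a b" "cbox a b \<subseteq> \<Omega>"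
      by (rule open_contains_cbox[OF \<Omega>(1) x]) (rule that)
    have "AE x in lebesgue. x \<in> box a b \<longrightarrow> H x = 0"
    proof (rule AE_zero_of_box_integrals[OF H])
      fix c d assume cd: "box c d \<subseteq> box a b"
      show "(LINT x|lebesgue. indicator (box c d) x *\<^sub>R H x) = 0"
      \<comment> \<open>Only for a nonempty open box is \<open>cbox c d\<close> its closure, which
        keeps it inside \<Omega>; an empty box has integral zero anyway.\<close>
      proof (cases "box c d = {}")
        case False
        then have "cbox c d = closure (box c d)" by (simp add: closure_box)
        also have "\<dots> \<subseteq> closure (box a b)" using cd by (rule closure_mono)
        also have "\<dots> \<subseteq> cbox a b" by (intro closure_minimal box_subset_cbox closed_cbox)
        finally have "cbox c d \<subseteq> \<Omega>" using ab by blast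
        moreover obtain z where "z \<in> box c d" using False by blast
        then have "c $ i \<le> d $ i" for i by (auto simp: mem_box_cart intro: less_imp_le less_trans)
        ultimately show ?thesis by (intro box_ab)
      qed simp
    qed
    then show "\<exists>U. open U \<and> x \<in> U \<and> (AE y in lebesgue. y \<in> U \<longrightarrow> H y = 0)"
      using ab(1) by (intro exI[of _ "box a b"] conjI open_box)
  qed
  then show ?thesis
    by (subst AE_restrict_space_iff[OF \<Omega>'(2)]) (auto simp: H_def elim!: eventually_mono)
qed

lemma weak_gradientD:
  assumes "weak_gradient \<Omega> u g" "\<phi> \<in> test_functions \<Omega>"
  shows "(LINT x|lebesgue_on \<Omega>. u x * frechet_derivative \<phi> (at x) (axis i 1))
    = - (LINT x|lebesgue_on \<Omega>. g x $ i * \<phi> x)"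
  using assms unfolding weak_gradient_def by blast

lemma weak_gradient_unique:
  assumes g: "weak_gradient \<Omega> u g" and g': "weak_gradient \<Omega> u g'" and \<Omega>: "open \<Omega>" "bounded \<Omega>"
  shows "AE x in lebesgue_on \<Omega>. g x = g' x"
proof -
  have L2: "(\<lambda>x. g x $ i) \<in> L2 (lebesgue_on \<Omega>)" "(\<lambda>x. g' x $ i) \<in> L2 (lebesgue_on \<Omega>)" for i
    using g g' by (auto simp: weak_gradient_def intro: L2_vec_nth)
  have "AE x in lebesgue_on \<Omega>. g x $ i - g' x $ i = 0" for i
  proof (rule AE_zero_of_test_integrals[OF L2_diff[OF L2] \<Omega>])
    fix \<phi> assume \<phi>: "\<phi> \<in> test_functions \<Omega>"
    note int = L2[of i, THEN integrable_times_continuous, OF test_function_continuous[OF \<phi>] \<Omega>]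
    have "(LINT x|lebesgue_on \<Omega>. g x $ i * \<phi> x) = (LINT x|lebesgue_on \<Omega>. g' x $ i * \<phi> x)"
      using weak_gradientD[OF g \<phi>, of i] weak_gradientD[OF g' \<phi>, of i]
      by (simp only: neg_equal_iff_equal)
    then show "(LINT x|lebesgue_on \<Omega>. (g x $ i - g' x $ i) * \<phi> x) = 0"
      using int by (simp add: left_diff_distrib)
  qed
  then have "AE x in lebesgue_on \<Omega>. \<forall>i. g x $ i - g' x $ i = 0" by (simp add: AE_all_countable)
  then show ?thesis by (rule eventually_mono) (simp add: vec_eq_iff)
qed

section \<open>Algebra of weak gradients and of the Sobolev norm\<close>

lemma L2_measurable: "f \<in> L2 M \<Longrightarrow> f \<in> borel_measurable M"
  by (simp add: L2_def)

lemma H1_L2: "u \<in> H1 \<Omega> \<Longrightarrow> u \<in> L2 (lebesgue_on \<Omega>)"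
  by (simp add: H1_def)

lemma weak_gradient_L2: "weak_gradient \<Omega> u g \<Longrightarrow> g \<in> L2 (lebesgue_on \<Omega>)"
  by (simp add: weak_gradient_def)

lemma weak_gradient_grad:
  assumes "u \<in> H1 \<Omega>" shows "weak_gradient \<Omega> u (grad \<Omega> u)"
proof -
  have "\<exists>g. weak_gradient \<Omega> u g" using assms by (simp add: H1_def)
  from someI_ex[OF this] show ?thesis unfolding grad_def .
qed

lemma test_function_smooth: "\<phi> \<in> test_functions \<Omega> \<Longrightarrow> smooth \<phi>"
  by (simp add: test_functions_def)

lemma test_function_mult:
  assumes "smooth \<eta>" "\<phi> \<in> test_functions \<Omega>"
  shows "(\<lambda>x. \<eta> x * \<phi> x) \<in> test_functions \<Omega>"
proof -
  obtain K where "compact K" "K \<subseteq> \<Omega>" "\<And>x. x \<notin> K \<Longrightarrow> \<phi> x = 0"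
    using assms(2) by (auto simp: test_functions_def)
  moreover have "smooth (\<lambda>x. \<eta> x * \<phi> x)"
    by (rule smooth_mult[OF assms(1) test_function_smooth[OF assms(2)]])
  ultimately show ?thesis
    unfolding test_functions_def by (intro CollectI conjI exI[of _ K]) auto
qed

lemma weak_gradient_diff:
  fixes u w :: "real^'n \<Rightarrow> complex"
  assumes g: "weak_gradient \<Omega> u g" "u \<in> L2 (lebesgue_on \<Omega>)"
    and k: "weak_gradient \<Omega> w k" "w \<in> L2 (lebesgue_on \<Omega>)" and \<Omega>: "open \<Omega>" "bounded \<Omega>"
  shows "weak_gradient \<Omega> (\<lambda>x. u x - w x) (\<lambda>x. g x - k x)"
  unfolding weak_gradient_def
proof (intro conjI ballI allI)
  show "(\<lambda>x. g x - k x) \<in> L2 (lebesgue_on \<Omega>)"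
    by (intro L2_diff weak_gradient_L2[OF g(1)] weak_gradient_L2[OF k(1)])
  fix \<phi> i assume \<phi>: "\<phi> \<in> test_functions \<Omega>"
  note cont = test_function_continuous[OF \<phi>]
    smooth_continuous[OF smooth_derivative[OF test_function_smooth[OF \<phi>]], of _ "axis i 1"]
  note int = integrable_times_continuous[OF _ cont(1) \<Omega>] integrable_times_continuous[OF _ cont(2) \<Omega>]
  have "(LINT x|lebesgue_on \<Omega>. (u x - w x) * frechet_derivative \<phi> (at x) (axis i 1)) =
    (LINT x|lebesgue_on \<Omega>. u x * frechet_derivative \<phi> (at x) (axis i 1))
    - (LINT x|lebesgue_on \<Omega>. w x * frechet_derivative \<phi> (at x) (axis i 1))"
    unfolding left_diff_distrib by (intro Bochner_Integration.integral_diff int g k)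
  also have "\<dots> = - ((LINT x|lebesgue_on \<Omega>. g x $ i * \<phi> x) - (LINT x|lebesgue_on \<Omega>. k x $ i * \<phi> x))"
    unfolding weak_gradientD[OF g(1) \<phi>] weak_gradientD[OF k(1) \<phi>] by simp
  also have "(LINT x|lebesgue_on \<Omega>. g x $ i * \<phi> x) - (LINT x|lebesgue_on \<Omega>. k x $ i * \<phi> x) =
    (LINT x|lebesgue_on \<Omega>. (g x - k x) $ i * \<phi> x)"
    unfolding vector_minus_component left_diff_distrib
    by (intro Bochner_Integration.integral_diff[symmetric] int L2_vec_nth weak_gradient_L2[OF g(1)] weak_gradient_L2[OF k(1)])
  finally show "(LINT x|lebesgue_on \<Omega>. (u x - w x) * frechet_derivative \<phi> (at x) (axis i 1)) =
    - (LINT x|lebesgue_on \<Omega>. (g x - k x) $ i * \<phi> x)" .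
qed

lemma H1_diff:
  fixes u w :: "real^'n \<Rightarrow> complex"
  assumes "u \<in> H1 \<Omega>" "w \<in> H1 \<Omega>" "open \<Omega>" "bounded \<Omega>"
  shows "(\<lambda>x. u x - w x) \<in> H1 \<Omega>"
proof -
  have "weak_gradient \<Omega> (\<lambda>x. u x - w x) (\<lambda>x. grad \<Omega> u x - grad \<Omega> w x)"
    by (rule weak_gradient_diff[OF weak_gradient_grad[OF assms(1)] H1_L2[OF assms(1)]
      weak_gradient_grad[OF assms(2)] H1_L2[OF assms(2)] assms(3,4)])
  moreover have "(\<lambda>x. u x - w x) \<in> L2 (lebesgue_on \<Omega>)"
    using assms by (intro L2_diff H1_L2)
  ultimately show ?thesis unfolding H1_def by blast
qed

text \<open>Allows the norm to be evaluated with an explicit weak gradient in place of the one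
  picked by \<open>grad\<close>; uniqueness almost everywhere makes the two integrals equal.\<close>

lemma H1_norm_eqI:
  fixes u :: "real^'n \<Rightarrow> complex"
  assumes g: "weak_gradient \<Omega> u g" and u: "u \<in> L2 (lebesgue_on \<Omega>)" and \<Omega>: "open \<Omega>" "bounded \<Omega>"
  shows "u \<in> H1 \<Omega>"
    and "H1_norm \<Omega> u =
      sqrt ((LINT x|lebesgue_on \<Omega>. (norm (u x))\<^sup>2) + (LINT x|lebesgue_on \<Omega>. (norm (g x))\<^sup>2))"
proof -
  show u': "u \<in> H1 \<Omega>" using g u by (auto simp: H1_def)
  have g': "weak_gradient \<Omega> u (grad \<Omega> u)" using weak_gradient_grad[OF u'] .
  have "AE x in lebesgue_on \<Omega>. grad \<Omega> u x = g x"
    using weak_gradient_unique[OF g' g \<Omega>] .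
  then have "AE x in lebesgue_on \<Omega>. (norm (grad \<Omega> u x))\<^sup>2 = (norm (g x))\<^sup>2"
    by (rule eventually_mono) simp
  then have "(LINT x|lebesgue_on \<Omega>. (norm (grad \<Omega> u x))\<^sup>2) = (LINT x|lebesgue_on \<Omega>. (norm (g x))\<^sup>2)"
    using weak_gradient_L2[OF g] weak_gradient_L2[OF g']
    by (intro integral_cong_AE borel_measurable_integrable) (auto simp: L2_def)
  then show "H1_norm \<Omega> u =
      sqrt ((LINT x|lebesgue_on \<Omega>. (norm (u x))\<^sup>2) + (LINT x|lebesgue_on \<Omega>. (norm (g x))\<^sup>2))"
    by (simp add: H1_norm_def)
qed

text \<open>Leibniz rule: test \<open>u\<close> with \<open>\<eta> * \<phi>\<close>, which is again
  a test function, and split its derivative. Square integrability of the new gradient is left to the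
  caller, where bounds on \<eta> are at hand.\<close>

lemma weak_gradient_mult:
  fixes u \<eta> :: "real^'n \<Rightarrow> complex"
  assumes g: "weak_gradient \<Omega> u g" and u: "u \<in> L2 (lebesgue_on \<Omega>)"
    and \<eta>: "smooth \<eta>" and \<Omega>: "open \<Omega>" "bounded \<Omega>"
    and L2: "(\<lambda>x. \<chi> i. \<eta> x * g x $ i + u x * frechet_derivative \<eta> (at x) (axis i 1)) \<in> L2 (lebesgue_on \<Omega>)"
  shows "weak_gradient \<Omega> (\<lambda>x. \<eta> x * u x)
    (\<lambda>x. \<chi> i. \<eta> x * g x $ i + u x * frechet_derivative \<eta> (at x) (axis i 1))"
  unfolding weak_gradient_def
proof (intro conjI ballI allI L2)
  fix \<phi> :: "real^'n \<Rightarrow> complex" and i :: 'n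
  assume \<phi>: "\<phi> \<in> test_functions \<Omega>"
  have \<phi>': "smooth \<phi>" using \<phi> by (rule test_function_smooth)
  let ?D = "\<lambda>(f :: real^'n \<Rightarrow> complex) x. frechet_derivative f (at x) (axis i 1)"
  have \<eta>\<phi>: "(\<lambda>x. \<eta> x * \<phi> x) \<in> test_functions \<Omega>" by (rule test_function_mult[OF \<eta> \<phi>])
  have cont: "continuous_on UNIV \<eta>" "continuous_on UNIV \<phi>" "continuous_on UNIV (?D \<eta>)" "continuous_on UNIV (?D \<phi>)"
    by (intro smooth_continuous smooth_derivative \<eta> \<phi>')+
  note int = integrable_times_continuous[OF _ _ \<Omega>]
  have gi: "(\<lambda>x. g x $ i) \<in> L2 (lebesgue_on \<Omega>)" by (rule L2_vec_nth[OF weak_gradient_L2[OF g]])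
  have int1: "integrable (lebesgue_on \<Omega>) (\<lambda>x. u x * (\<eta> x * ?D \<phi> x))"
    and int2: "integrable (lebesgue_on \<Omega>) (\<lambda>x. u x * (?D \<eta> x * \<phi> x))"
    and int3: "integrable (lebesgue_on \<Omega>) (\<lambda>x. g x $ i * (\<eta> x * \<phi> x))"
    by (intro int u gi continuous_on_mult cont)+
  have "(LINT x|lebesgue_on \<Omega>. u x * (\<eta> x * ?D \<phi> x)) + (LINT x|lebesgue_on \<Omega>. u x * (?D \<eta> x * \<phi> x))
    = (LINT x|lebesgue_on \<Omega>. u x * ?D (\<lambda>x. \<eta> x * \<phi> x) x)"
    unfolding frechet_derivative_smooth_mult[OF \<eta> \<phi>'] distrib_left
    using int1 int2 by (rule Bochner_Integration.integral_add[symmetric])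
  also have "\<dots> = - (LINT x|lebesgue_on \<Omega>. g x $ i * (\<eta> x * \<phi> x))"
    by (rule weak_gradientD[OF g \<eta>\<phi>])
  finally have sum: "(LINT x|lebesgue_on \<Omega>. u x * (\<eta> x * ?D \<phi> x)) + (LINT x|lebesgue_on \<Omega>. u x * (?D \<eta> x * \<phi> x))
    = - (LINT x|lebesgue_on \<Omega>. g x $ i * (\<eta> x * \<phi> x))" .
  have alg: "y = - (w + z)" if "y + z = - w" for y z w :: complex
  proof -
    have "y = - w - z" using that by (simp only: eq_diff_eq)
    then show ?thesis by simp
  qed
  have "(LINT x|lebesgue_on \<Omega>. u x * (\<eta> x * ?D \<phi> x)) =
    - ((LINT x|lebesgue_on \<Omega>. g x $ i * (\<eta> x * \<phi> x)) + (LINT x|lebesgue_on \<Omega>. u x * (?D \<eta> x * \<phi> x)))"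
    by (rule alg[OF sum])
  also have "(LINT x|lebesgue_on \<Omega>. g x $ i * (\<eta> x * \<phi> x)) + (LINT x|lebesgue_on \<Omega>. u x * (?D \<eta> x * \<phi> x))
    = (LINT x|lebesgue_on \<Omega>. g x $ i * (\<eta> x * \<phi> x) + u x * (?D \<eta> x * \<phi> x))"
    using int3 int2 by (rule Bochner_Integration.integral_add[symmetric])
  finally have *: "(LINT x|lebesgue_on \<Omega>. u x * (\<eta> x * ?D \<phi> x)) =
    - (LINT x|lebesgue_on \<Omega>. g x $ i * (\<eta> x * \<phi> x) + u x * (?D \<eta> x * \<phi> x))" .
  have e1: "(\<lambda>x. \<eta> x * u x * ?D \<phi> x) = (\<lambda>x. u x * (\<eta> x * ?D \<phi> x))"
    by (simp add: fun_eq_iff mult_ac)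
  have e2: "(\<lambda>x. (\<eta> x * g x $ i + u x * ?D \<eta> x) * \<phi> x) =
    (\<lambda>x. g x $ i * (\<eta> x * \<phi> x) + u x * (?D \<eta> x * \<phi> x))"
    by (simp add: fun_eq_iff algebra_simps)
  from * show "(LINT x|lebesgue_on \<Omega>. \<eta> x * u x * ?D \<phi> x) =
    - (LINT x|lebesgue_on \<Omega>. (\<chi> i. \<eta> x * g x $ i + u x * frechet_derivative \<eta> (at x) (axis i 1)) $ i * \<phi> x)"
    unfolding vec_lambda_beta e1 e2 .
qed

lemma H1_norm_mult_smooth:
  fixes \<Omega> :: "(real^'n) set"
  assumes \<eta>: "smooth \<eta>" and \<Omega>: "open \<Omega>" "bounded \<Omega>"
  obtains C where "C \<ge> 0" "\<And>u. u \<in> H1 \<Omega> \<Longrightarrow> (\<lambda>x. \<eta> x * u x) \<in> H1 \<Omega>"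
    "\<And>u. u \<in> H1 \<Omega> \<Longrightarrow> H1_norm \<Omega> (\<lambda>x. \<eta> x * u x) \<le> C * H1_norm \<Omega> u"
proof -
  let ?D = "\<lambda>i x. frechet_derivative \<eta> (at x) (axis i (1::real)) :: complex"
  let ?N = "real CARD('n)"
  obtain A where A: "A \<ge> 0" "\<And>x. x \<in> \<Omega> \<Longrightarrow> norm (\<eta> x) \<le> A"
    by (rule continuous_bounded_on_bounded[OF smooth_continuous[OF \<eta>] \<Omega>(2)]) (rule that)
  have "\<exists>B. \<forall>x\<in>\<Omega>. norm (?D i x) \<le> B" for i
  proof -
    obtain B where "\<And>x. x \<in> \<Omega> \<Longrightarrow> norm (?D i x) \<le> B"
      by (rule continuous_bounded_on_bounded[OF smooth_continuous[OF smooth_derivative[OF \<eta>]] \<Omega>(2), of "axis i 1"]) (rule that)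
    then show ?thesis by blast
  qed
  then obtain B' where B': "\<And>i. \<forall>x\<in>\<Omega>. norm (?D i x) \<le> B' i" by metis
  \<comment> \<open>One bound for all coordinate directions: the sum of absolute values dominates
    each summand.\<close>
  define B where "B = (\<Sum>i\<in>UNIV. \<bar>B' i\<bar>)"
  have B: "norm (?D i x) \<le> B" if "x \<in> \<Omega>" for i x
  proof -
    have "norm (?D i x) \<le> \<bar>B' i\<bar>" using bspec[OF B' that, of i] by linarith
    also have "\<dots> \<le> B" unfolding B_def by (rule member_le_sum) auto
    finally show ?thesis .
  qed
  \<comment> \<open>The three terms come from \<eta> u, from \<eta> times the gradient, and from u
    times the gradient of \<eta>. Each 2 stems from \<open>L2_comparison\<close>, and
    \<open>?N\<close> from bounding a vector by the sum of its components.\<close>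
  define C where "C = sqrt (2 * A\<^sup>2 + 2 * (?N * A)\<^sup>2 + 2 * (?N * B)\<^sup>2)"
  have *: "(\<lambda>x. \<eta> x * u x) \<in> H1 \<Omega> \<and> H1_norm \<Omega> (\<lambda>x. \<eta> x * u x) \<le> C * H1_norm \<Omega> u" if u: "u \<in> H1 \<Omega>" for u
  proof -
    define g where "g = grad \<Omega> u"
    have g: "weak_gradient \<Omega> u g" unfolding g_def by (rule weak_gradient_grad[OF u])
    have uL2: "u \<in> L2 (lebesgue_on \<Omega>)" by (rule H1_L2[OF u])
    have gL2: "g \<in> L2 (lebesgue_on \<Omega>)" by (rule weak_gradient_L2[OF g])
    let ?G = "\<lambda>x. \<chi> i. \<eta> x * g x $ i + u x * ?D i x"
    have cont: "continuous_on UNIV f \<Longrightarrow> f \<in> borel_measurable (lebesgue_on \<Omega>)" for f :: "real^'n \<Rightarrow> complex"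
      by (rule continuous_imp_measurable_on_sets_lebesgue[OF continuous_on_subset[OF _ subset_UNIV]])
        (use \<Omega>(1) in auto)
    note m\<eta> = cont[OF smooth_continuous[OF \<eta>]]
    note mD = cont[OF smooth_continuous[OF smooth_derivative[OF \<eta>]]]
    have mG: "?G \<in> borel_measurable (lebesgue_on \<Omega>)"
      by (intro borel_measurable_vec_lambda borel_measurable_add borel_measurable_times m\<eta> mD
          borel_measurable_vec_nth L2_measurable[OF uL2] L2_measurable[OF gL2])
    have bG: "norm (?G x) \<le> (?N * A) * norm (g x) + (?N * B) * norm (u x)" if x: "x \<in> space (lebesgue_on \<Omega>)" for x
    proof -
      have x: "x \<in> \<Omega>" using x by simp
      have "norm (?G x) \<le> (\<Sum>i\<in>UNIV. norm (?G x $ i))" by (rule norm_vec_le_sum)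
      also have "\<dots> \<le> (\<Sum>i\<in>(UNIV::'n set). A * norm (g x) + B * norm (u x))"
      proof (rule sum_mono)
        fix i
        have "norm (?G x $ i) \<le> norm (\<eta> x) * norm (g x $ i) + norm (?D i x) * norm (u x)"
          using norm_triangle_ineq[of "\<eta> x * g x $ i" "u x * ?D i x"] by (simp add: norm_mult mult.commute)
        also have "\<dots> \<le> A * norm (g x) + B * norm (u x)"
          by (intro add_mono mult_mono A B x Finite_Cartesian_Product.norm_nth_le order_refl norm_ge_zero)
            (use order_trans[OF norm_ge_zero B[OF x]] in simp)
        finally show "norm (?G x $ i) \<le> A * norm (g x) + B * norm (u x)" .
      qed
      finally show ?thesis by (simp add: algebra_simps)
    qed
    have m\<eta>u: "(\<lambda>x. \<eta> x * u x) \<in> borel_measurable (lebesgue_on \<Omega>)"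
      by (rule borel_measurable_times[OF m\<eta> L2_measurable[OF uL2]])
    have b\<eta>u: "norm (\<eta> x * u x) \<le> A * norm (u x) + 0 * norm (u x)" if x: "x \<in> space (lebesgue_on \<Omega>)" for x
      using A(2)[of x] x by (simp add: norm_mult mult_right_mono)
    define a where "a = (LINT x|lebesgue_on \<Omega>. (norm (u x))\<^sup>2)"
    define b where "b = (LINT x|lebesgue_on \<Omega>. (norm (g x))\<^sup>2)"
    have GL2: "?G \<in> L2 (lebesgue_on \<Omega>)"
      by (rule L2_comparison(1)[OF mG gL2 uL2 bG])
    have G2: "(LINT x|lebesgue_on \<Omega>. (norm (?G x))\<^sup>2) \<le> 2 * (?N * A)\<^sup>2 * b + 2 * (?N * B)\<^sup>2 * a"
      unfolding a_def b_def by (rule L2_comparison(2)[OF mG gL2 uL2 bG])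
    have \<eta>uL2: "(\<lambda>x. \<eta> x * u x) \<in> L2 (lebesgue_on \<Omega>)"
      by (rule L2_comparison(1)[OF m\<eta>u uL2 uL2 b\<eta>u])
    have U2: "(LINT x|lebesgue_on \<Omega>. (norm (\<eta> x * u x))\<^sup>2) \<le> 2 * A\<^sup>2 * a + 2 * 0\<^sup>2 * a"
      unfolding a_def by (rule L2_comparison(2)[OF m\<eta>u uL2 uL2 b\<eta>u])
    have wG: "weak_gradient \<Omega> (\<lambda>x. \<eta> x * u x) ?G"
      by (rule weak_gradient_mult[OF g uL2 \<eta> \<Omega> GL2])
    note H = H1_norm_eqI[OF wG \<eta>uL2 \<Omega>]
    have ab: "a \<ge> 0" "b \<ge> 0" by (auto simp: a_def b_def)
    have "H1_norm \<Omega> (\<lambda>x. \<eta> x * u x) \<le> sqrt ((2 * A\<^sup>2 + 2 * (?N * A)\<^sup>2 + 2 * (?N * B)\<^sup>2) * (a + b))"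
    proof -
      have "(LINT x|lebesgue_on \<Omega>. (norm (\<eta> x * u x))\<^sup>2) + (LINT x|lebesgue_on \<Omega>. (norm (?G x))\<^sup>2)
        \<le> (2 * A\<^sup>2 * a) + (2 * (?N * A)\<^sup>2 * b + 2 * (?N * B)\<^sup>2 * a)"
        using G2 U2 by simp
      also have "\<dots> \<le> (2 * A\<^sup>2 * (a + b)) + (2 * (?N * A)\<^sup>2 * (a + b) + 2 * (?N * B)\<^sup>2 * (a + b))"
        using ab by (intro add_mono mult_left_mono) auto
      also have "\<dots> = (2 * A\<^sup>2 + 2 * (?N * A)\<^sup>2 + 2 * (?N * B)\<^sup>2) * (a + b)"
        by (simp only: distrib_right)
      finally show ?thesis unfolding H(2) by (rule real_sqrt_le_mono)
    qed
    also have "\<dots> = C * H1_norm \<Omega> u"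
      unfolding C_def real_sqrt_mult H1_norm_def a_def b_def g_def ..
    finally show ?thesis using H(1) by blast
  qed
  show ?thesis
  proof (rule that[of C])
    show "C \<ge> 0" unfolding C_def by simp
  qed (use * in auto)
qed

text \<open>Equality of the predicates, not just of their solutions up to null sets, so that the
  choice in \<open>grad\<close> returns literally the same function for \<open>u\<close> and
  \<open>w\<close>.\<close>

lemma weak_gradient_cong_AE:
  fixes u w :: "real^'n \<Rightarrow> complex"
  assumes "AE x in lebesgue_on \<Omega>. u x = w x"
    "u \<in> borel_measurable (lebesgue_on \<Omega>)" "w \<in> borel_measurable (lebesgue_on \<Omega>)" "open \<Omega>"
  shows "weak_gradient \<Omega> u = weak_gradient \<Omega> w"
proof (rule ext)
  fix g
  have eq: "(LINT x|lebesgue_on \<Omega>. u x * frechet_derivative \<phi> (at x) (axis i 1)) =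
      (LINT x|lebesgue_on \<Omega>. w x * frechet_derivative \<phi> (at x) (axis i 1))"
    if \<phi>: "\<phi> \<in> test_functions \<Omega>" for \<phi> i
  proof (rule integral_cong_AE)
    have "continuous_on \<Omega> (\<lambda>x. frechet_derivative \<phi> (at x) (axis i 1))"
      by (intro smooth_continuous smooth_derivative test_function_smooth[OF \<phi>])
    then have m: "(\<lambda>x. frechet_derivative \<phi> (at x) (axis i 1)) \<in> borel_measurable (lebesgue_on \<Omega>)"
      using assms(4) by (intro continuous_imp_measurable_on_sets_lebesgue) auto
    show "(\<lambda>x. u x * frechet_derivative \<phi> (at x) (axis i 1)) \<in> borel_measurable (lebesgue_on \<Omega>)"
      "(\<lambda>x. w x * frechet_derivative \<phi> (at x) (axis i 1)) \<in> borel_measurable (lebesgue_on \<Omega>)"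
      by (rule borel_measurable_times[OF assms(2) m] borel_measurable_times[OF assms(3) m])+
  qed (use assms(1) in \<open>auto elim!: eventually_mono\<close>)
  show "weak_gradient \<Omega> u g = weak_gradient \<Omega> w g"
    unfolding weak_gradient_def by (simp only: eq cong: ball_cong)
qed

lemma H1_norm_cong_AE:
  fixes u w :: "real^'n \<Rightarrow> complex"
  assumes "AE x in lebesgue_on \<Omega>. u x = w x" "u \<in> H1 \<Omega>" "w \<in> H1 \<Omega>" "open \<Omega>"
  shows "H1_norm \<Omega> u = H1_norm \<Omega> w"
proof -
  note m = L2_measurable[OF H1_L2[OF assms(2)]] L2_measurable[OF H1_L2[OF assms(3)]]
  have "grad \<Omega> u = grad \<Omega> w"
    unfolding grad_def weak_gradient_cong_AE[OF assms(1) m assms(4)] ..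
  moreover have "(LINT x|lebesgue_on \<Omega>. (norm (u x))\<^sup>2) = (LINT x|lebesgue_on \<Omega>. (norm (w x))\<^sup>2)"
  proof (rule integral_cong_AE)
    show "(\<lambda>x. (norm (u x))\<^sup>2) \<in> borel_measurable (lebesgue_on \<Omega>)"
      "(\<lambda>x. (norm (w x))\<^sup>2) \<in> borel_measurable (lebesgue_on \<Omega>)"
      by (rule borel_measurable_power[OF measurable_compose[OF m(1) borel_measurable_norm]]
        borel_measurable_power[OF measurable_compose[OF m(2) borel_measurable_norm]])+
  qed (use assms(1) in \<open>auto elim!: eventually_mono\<close>)
  ultimately show ?thesis by (simp only: H1_norm_def)
qed

section \<open>Locality of the trace\<close>

lemma space_surface: "space (surface S) = S"
  by (simp add: surface_def space_restrict_space hausdorff_measure_def)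

lemma sets_hausdorff_measure: "sets (hausdorff_measure s) = sets borel"
proof -
  have "sets (hausdorff_measure s :: 'a measure) = sigma_sets UNIV (sets (borel :: 'a measure))"
    unfolding hausdorff_measure_def by (rule sets_measure_of) simp
  also have "\<dots> = sets borel"
    using sets.sigma_sets_eq[of "borel :: 'a measure"] by simp
  finally show ?thesis .
qed

lemma continuous_borel_measurable_surface:
  assumes "continuous_on UNIV f" shows "f \<in> borel_measurable (surface S)"
proof -
  have "f \<in> borel_measurable borel"
    using assms by (rule borel_measurable_continuous_onI)
  then have "f \<in> borel_measurable (hausdorff_measure (CARD('a) - 1))"
    by (simp only: measurable_cong_sets[OF sets_hausdorff_measure refl])
  then show ?thesis unfolding surface_def by (rule measurable_restrict_space1)
qed

text \<open>Drops the double integral of the Slobodeckij norm; membership in \<open>Hhalf\<close>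
  makes the norm finite, so \<open>enn2real\<close> loses nothing.\<close>

lemma nn_integral_le_Hhalf_norm:
  assumes t: "t \<in> Hhalf S" and b: "Hhalf_norm S t \<le> b"
  shows "(\<integral>\<^sup>+x. ennreal ((norm (t x))\<^sup>2) \<partial>surface S) \<le> ennreal (b\<^sup>2)"
proof -
  have "(\<integral>\<^sup>+x. ennreal ((norm (t x))\<^sup>2) \<partial>surface S) \<le> Hhalf_sq S t"
    unfolding Hhalf_sq_def by simp
  also have "\<dots> = ennreal (enn2real (Hhalf_sq S t))"
    using t by (simp add: Hhalf_def)
  also have "\<dots> = ennreal ((Hhalf_norm S t)\<^sup>2)"
    by (simp add: Hhalf_norm_def)
  also have "\<dots> \<le> ennreal (b\<^sup>2)"
    using b by (intro ennreal_leI power_mono) (auto simp: Hhalf_norm_def)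
  finally show ?thesis .
qed

lemma nn_integral_norm_square_sum_le:
  fixes f g h :: "'a \<Rightarrow> complex"
  assumes m: "g \<in> borel_measurable M" "h \<in> borel_measurable M"
    and le: "AE x in M. norm (f x) \<le> norm (g x) + norm (h x)"
  shows "(\<integral>\<^sup>+x. ennreal ((norm (f x))\<^sup>2) \<partial>M) \<le>
    2 * (\<integral>\<^sup>+x. ennreal ((norm (g x))\<^sup>2) \<partial>M) + 2 * (\<integral>\<^sup>+x. ennreal ((norm (h x))\<^sup>2) \<partial>M)"
proof -
  note m[measurable]
  have "ennreal (a\<^sup>2) \<le> 2 * ennreal (b\<^sup>2) + 2 * ennreal (c\<^sup>2)" if "a \<le> b + c" "0 \<le> a" for a b c :: real
  proof -
    have "a\<^sup>2 \<le> (b + c)\<^sup>2" using that by (intro power_mono) auto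
    also have "\<dots> \<le> 2 * b\<^sup>2 + 2 * c\<^sup>2"
      using zero_le_power2[of "b - c"] by (simp add: power2_sum power2_diff)
    finally have "ennreal (a\<^sup>2) \<le> ennreal (2 * b\<^sup>2 + 2 * c\<^sup>2)" by (rule ennreal_leI)
    also have "\<dots> = 2 * ennreal (b\<^sup>2) + 2 * ennreal (c\<^sup>2)"
      by (simp add: ennreal_plus ennreal_mult)
    finally show ?thesis .
  qed
  then have "(\<integral>\<^sup>+x. ennreal ((norm (f x))\<^sup>2) \<partial>M) \<le>
    (\<integral>\<^sup>+x. 2 * ennreal ((norm (g x))\<^sup>2) + 2 * ennreal ((norm (h x))\<^sup>2) \<partial>M)"
    using le by (intro nn_integral_mono_AE) (auto elim!: eventually_mono)
  also have "\<dots> = (\<integral>\<^sup>+x. 2 * ennreal ((norm (g x))\<^sup>2) \<partial>M) + (\<integral>\<^sup>+x. 2 * ennreal ((norm (h x))\<^sup>2) \<partial>M)"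
    by (intro nn_integral_add) measurable
  also have "\<dots> = 2 * (\<integral>\<^sup>+x. ennreal ((norm (g x))\<^sup>2) \<partial>M) + 2 * (\<integral>\<^sup>+x. ennreal ((norm (h x))\<^sup>2) \<partial>M)"
    by (simp add: nn_integral_cmult)
  finally show ?thesis .
qed

lemma dirichlet_trace_diff:
  assumes "dirichlet_trace \<Omega> S \<gamma>" "u \<in> H1 \<Omega>" "w \<in> H1 \<Omega>"
  shows "AE x in surface S. \<gamma> (\<lambda>y. u y - w y) x = \<gamma> u x - \<gamma> w x"
proof -
  have "AE x in surface S. \<gamma> (\<lambda>y. 1 * u y + (-1) * w y) x = 1 * \<gamma> u x + (-1) * \<gamma> w x"
    using assms unfolding dirichlet_trace_def by blast
  then show ?thesis by simp
qed

text \<open>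
  Smooth \<open>\<phi>\<^sub>k\<close> converging to \<open>u\<close> in \<open>H\<^sup>1\<close> satisfy \<open>\<eta> \<phi>\<^sub>k \<longrightarrow> \<eta> u = 0\<close> in \<open>H\<^sup>1\<close> for a cutoff \<open>\<eta>\<close> supported
  in the box, so the traces \<open>\<eta> \<phi>\<^sub>k\<close> tend to \<open>0\<close> in \<open>L\<^sup>2(S)\<close>; but they also tend to \<open>\<eta> \<gamma> u\<close>.
\<close>

lemma dirichlet_trace_local:
  fixes \<Omega> S :: "(real^'n) set"
  assumes tr: "dirichlet_trace \<Omega> S \<gamma>" and \<Omega>: "open \<Omega>" "bounded \<Omega>" and u: "u \<in> H1 \<Omega>"
    and z: "AE y in lebesgue_on \<Omega>. y \<in> box a b \<longrightarrow> u y = 0"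
  shows "AE y in surface S. y \<in> box a b \<longrightarrow> \<gamma> u y = 0"
proof (cases "box a b = {}")
  case False
  then obtain z where z': "z \<in> box a b" by blast
  have ab: "a $ i \<le> b $ i" for i
    using z' less_trans[of "a $ i" "z $ i" "b $ i"] by (simp add: mem_box_cart)
  define \<eta> where "\<eta> = box_bump 1 a b"
  have \<eta>: "smooth \<eta>" unfolding \<eta>_def by (rule smooth_box_bump)
  have \<eta>_supp: "\<eta> x \<noteq> 0 \<longleftrightarrow> x \<in> box a b" for x
    unfolding \<eta>_def by (rule box_bump_nonzero_iff) (simp_all add: ab)
  have \<eta>_le: "norm (\<eta> x) \<le> 1" for x unfolding \<eta>_def by (rule norm_box_bump_le)
  obtain C' where C': "\<And>u. u \<in> H1 \<Omega> \<Longrightarrow> (\<lambda>x. \<eta> x * u x) \<in> H1 \<Omega>"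
    "\<And>u. u \<in> H1 \<Omega> \<Longrightarrow> H1_norm \<Omega> (\<lambda>x. \<eta> x * u x) \<le> C' * H1_norm \<Omega> u"
    by (rule H1_norm_mult_smooth[OF \<eta> \<Omega>]) (rule that)
  have Hhalf: "\<gamma> v \<in> Hhalf S" if "v \<in> H1 \<Omega>" for v
    using tr that unfolding dirichlet_trace_def by blast
  have meas: "\<gamma> v \<in> borel_measurable (surface S)" if "v \<in> H1 \<Omega>" for v
    using Hhalf[OF that] by (simp add: Hhalf_def)
  have smooth: "AE x in surface S. \<gamma> v x = v x" if "v \<in> H1 \<Omega>" "smooth v" for v
    using tr that unfolding dirichlet_trace_def by blast
  obtain C where C: "\<And>v. v \<in> H1 \<Omega> \<Longrightarrow> Hhalf_norm S (\<gamma> v) \<le> C * H1_norm \<Omega> v"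
    using tr unfolding dirichlet_trace_def by blast
  have "\<exists>\<phi>. (\<forall>k. smooth (\<phi> k) \<and> \<phi> k \<in> H1 \<Omega>) \<and> (\<lambda>k. H1_norm \<Omega> (\<lambda>x. \<phi> k x - u x)) \<longlonglongrightarrow> 0"
    using tr u unfolding dirichlet_trace_def by blast
  then obtain \<phi> where \<phi>: "\<And>k::nat. smooth (\<phi> k)" "\<And>k. \<phi> k \<in> H1 \<Omega>"
    "(\<lambda>k. H1_norm \<Omega> (\<lambda>x. \<phi> k x - u x)) \<longlonglongrightarrow> 0" by blast
  define h where "h k = H1_norm \<Omega> (\<lambda>x. \<phi> k x - u x)" for k
  have bound: "(\<integral>\<^sup>+x. ennreal ((norm (\<eta> x * \<gamma> u x))\<^sup>2) \<partial>surface S) \<le>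
    ennreal (2 * (C * h k)\<^sup>2 + 2 * (\<bar>C\<bar> * (C' * h k))\<^sup>2)" for k
  proof -
    let ?w = "\<lambda>x. \<phi> k x - u x" and ?v = "\<lambda>x. \<eta> x * \<phi> k x"
    have w: "?w \<in> H1 \<Omega>" by (rule H1_diff[OF \<phi>(2) u \<Omega>])
    have v: "?v \<in> H1 \<Omega>" by (rule C'(1)[OF \<phi>(2)])
    have \<eta>w: "(\<lambda>x. \<eta> x * ?w x) \<in> H1 \<Omega>" by (rule C'(1)[OF w])
    \<comment> \<open>Subtracting \<open>u\<close> changes nothing almost everywhere:
      \<open>u\<close> vanishes on the box and \<eta> off it. So the norm is small although
      \<open>\<phi> k\<close> itself is not.\<close>
    have "H1_norm \<Omega> ?v = H1_norm \<Omega> (\<lambda>x. \<eta> x * ?w x)"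
    proof (rule H1_norm_cong_AE[OF _ v \<eta>w \<Omega>(1)])
      show "AE x in lebesgue_on \<Omega>. \<eta> x * \<phi> k x = \<eta> x * (\<phi> k x - u x)"
        using z \<eta>_supp by (auto simp: right_diff_distrib elim!: eventually_mono)
    qed
    also have "\<dots> \<le> C' * h k" unfolding h_def by (rule C'(2)[OF w])
    finally have "Hhalf_norm S (\<gamma> ?v) \<le> \<bar>C\<bar> * (C' * h k)"
    proof -
      assume le: "H1_norm \<Omega> ?v \<le> C' * h k"
      have "0 \<le> H1_norm \<Omega> ?v" by (simp add: H1_norm_def)
      have "Hhalf_norm S (\<gamma> ?v) \<le> C * H1_norm \<Omega> ?v" by (rule C[OF v])
      also have "\<dots> \<le> \<bar>C\<bar> * H1_norm \<Omega> ?v"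
        using \<open>0 \<le> H1_norm \<Omega> ?v\<close> by (intro mult_right_mono) auto
      also have "\<dots> \<le> \<bar>C\<bar> * (C' * h k)" using le by (intro mult_left_mono) auto
      finally show ?thesis .
    qed
    note v_le = nn_integral_le_Hhalf_norm[OF Hhalf[OF v] this]
    note w_le = nn_integral_le_Hhalf_norm[OF Hhalf[OF w] C[OF w, folded h_def]]
    have sv: "smooth ?v" by (rule smooth_mult[OF \<eta> \<phi>(1)])
    \<comment> \<open>\<open>\<phi> k\<close> and \<open>?v\<close> are smooth, so their traces are
      restrictions; hence \<eta> times the trace of \<open>u\<close> equals the trace of
      \<open>?v\<close> minus \<eta> times the trace of \<open>?w\<close>, both small.\<close>
    have "AE x in surface S. norm (\<eta> x * \<gamma> u x) \<le> norm (\<gamma> ?w x) + norm (\<gamma> ?v x)"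
      using dirichlet_trace_diff[OF tr \<phi>(2)[of k] u] smooth[OF \<phi>(2,1), of k] smooth[OF v sv]
    proof eventually_elim
      case (elim x)
      have "\<eta> x * \<gamma> u x = \<gamma> ?v x - \<eta> x * \<gamma> ?w x"
        unfolding elim right_diff_distrib by simp
      then have "norm (\<eta> x * \<gamma> u x) \<le> norm (\<gamma> ?v x) + norm (\<eta> x * \<gamma> ?w x)"
        by (simp only: norm_triangle_ineq4)
      also have "norm (\<eta> x * \<gamma> ?w x) \<le> norm (\<gamma> ?w x)"
        unfolding norm_mult by (rule mult_left_le_one_le[OF norm_ge_zero norm_ge_zero \<eta>_le])
      finally show ?case by simp
    qed
    then have "(\<integral>\<^sup>+x. ennreal ((norm (\<eta> x * \<gamma> u x))\<^sup>2) \<partial>surface S) \<le>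
      2 * (\<integral>\<^sup>+x. ennreal ((norm (\<gamma> ?w x))\<^sup>2) \<partial>surface S) + 2 * (\<integral>\<^sup>+x. ennreal ((norm (\<gamma> ?v x))\<^sup>2) \<partial>surface S)"
      by (rule nn_integral_norm_square_sum_le[OF meas[OF w] meas[OF v]])
    also have "\<dots> \<le> 2 * ennreal ((C * h k)\<^sup>2) + 2 * ennreal ((\<bar>C\<bar> * (C' * h k))\<^sup>2)"
      by (intro add_mono mult_left_mono w_le v_le) auto
    also have "\<dots> = ennreal (2 * (C * h k)\<^sup>2 + 2 * (\<bar>C\<bar> * (C' * h k))\<^sup>2)"
      by (simp add: ennreal_plus ennreal_mult del: power_mult_distrib)
    finally show ?thesis .
  qed
  have "(\<lambda>k. 2 * (C * h k)\<^sup>2 + 2 * (\<bar>C\<bar> * (C' * h k))\<^sup>2) \<longlonglongrightarrow> 2 * (C * 0)\<^sup>2 + 2 * (\<bar>C\<bar> * (C' * 0))\<^sup>2"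
    using \<phi>(3) unfolding h_def[symmetric] by (intro tendsto_intros)
  then have "(\<lambda>k. ennreal (2 * (C * h k)\<^sup>2 + 2 * (\<bar>C\<bar> * (C' * h k))\<^sup>2)) \<longlonglongrightarrow> ennreal 0"
    by (intro tendsto_ennrealI) simp
  \<comment> \<open>The left side is independent of \<open>k\<close>, while the bound tends to zero
    with \<open>h k\<close>.\<close>
  then have "(\<integral>\<^sup>+x. ennreal ((norm (\<eta> x * \<gamma> u x))\<^sup>2) \<partial>surface S) \<le> ennreal 0"
    by (rule LIMSEQ_le_const) (use bound in blast)
  then have "(\<integral>\<^sup>+x. ennreal ((norm (\<eta> x * \<gamma> u x))\<^sup>2) \<partial>surface S) = 0" by simp
  moreover have "(\<lambda>x. ennreal ((norm (\<eta> x * \<gamma> u x))\<^sup>2)) \<in> borel_measurable (surface S)"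
  proof -
    have "(\<lambda>x. \<eta> x * \<gamma> u x) \<in> borel_measurable (surface S)"
      by (rule borel_measurable_times[OF continuous_borel_measurable_surface[OF smooth_continuous[OF \<eta>]] meas[OF u]])
    then show ?thesis by measurable
  qed
  ultimately have "AE x in surface S. ennreal ((norm (\<eta> x * \<gamma> u x))\<^sup>2) = 0"
    by (simp only: nn_integral_0_iff_AE)
  then show ?thesis
    by (rule eventually_mono) (use \<eta>_supp in auto)
qed simp

text \<open>Off the support of \<open>u\<close> the trace vanishes by locality, off the support of
  \<open>g\<close> so does \<open>g\<close>, and every point of \<open>S\<close> is off one of them.
  As \<open>vol_supp\<close> only contains points of \<open>closure \<Omega>\<close>, the inclusion
  of \<open>S\<close> guarantees that a point outside it really has a neighbourhood on which
  \<open>u\<close> is zero.\<close>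

lemma surface_pairing_eq_zero:
  fixes \<Omega> S :: "(real^'n) set"
  assumes tr: "dirichlet_trace \<Omega> S \<gamma>" and \<Omega>: "open \<Omega>" "bounded \<Omega>" and u: "u \<in> H1 \<Omega>"
    and S: "S \<subseteq> closure \<Omega>" and disj: "vol_supp \<Omega> u \<inter> surf_supp S g = {}"
  shows "surface_pairing S (\<gamma> u) (\<lambda>x. cnj (g x)) = 0"
proof -
  have "AE y in surface S. y \<in> S - vol_supp \<Omega> u \<longrightarrow> \<gamma> u y = 0"
  proof (rule AE_locally)
    fix x assume x: "x \<in> S - vol_supp \<Omega> u"
    then obtain U where U: "open U" "x \<in> U" "AE y in lebesgue_on \<Omega>. y \<in> U \<longrightarrow> u y = 0"
      using S unfolding ess_supp_def by blast
    obtain a b where ab: "cbox a b \<subseteq> U" "x \<in> box a b"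
      by (rule open_contains_cbox[OF U(1,2)]) (rule that)
    have "AE y in lebesgue_on \<Omega>. y \<in> box a b \<longrightarrow> u y = 0"
      using U(3) by (rule eventually_mono) (use ab(1) box_subset_cbox[of a b] in blast)
    from dirichlet_trace_local[OF tr \<Omega> u this] ab(2)
    show "\<exists>U. open U \<and> x \<in> U \<and> (AE y in surface S. y \<in> U \<longrightarrow> \<gamma> u y = 0)"
      by (intro exI[of _ "box a b"] conjI open_box)
  qed
  moreover have "AE y in surface S. y \<in> S - surf_supp S g \<longrightarrow> g y = 0"
    by (rule AE_locally) (auto simp: ess_supp_def)
  moreover have "AE y in surface S. y \<in> S" using AE_space[of "surface S"] by (simp only: space_surface)
  ultimately have "AE y in surface S. \<gamma> u y * cnj (g y) = 0"
    by eventually_elim (use disj in auto)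
  then show ?thesis unfolding surface_pairing_def by (rule integral_eq_zero_AE)
qed

section \<open>Counting mesh elements\<close>

text \<open>Path lifting: the preimage of the segment from \<open>f x\<close> to \<open>y\<close> moves at speed at most
  \<open>L * norm (y - f x) < r\<close>, hence cannot leave the ball before the segment ends.\<close>

lemma ball_subset_image_ball:
  fixes f :: "'a::euclidean_space \<Rightarrow> 'a"
  assumes inj: "inj_on f (ball x r)"
    and der: "\<And>z. z \<in> ball x r \<Longrightarrow> (f has_derivative f' z) (at z)"
    and lower: "\<And>z \<xi>. z \<in> ball x r \<Longrightarrow> norm \<xi> \<le> L * norm (f' z \<xi>)"
    and L: "L > 0"
  shows "ball (f x) (r / L) \<subseteq> f ` ball x r"
proof
  fix y assume y: "y \<in> ball (f x) (r / L)"
  \<comment> \<open>The radius to which the lifted path stays confined; being strictly below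
    \<open>r\<close>, it leaves a compact ball inside the open one.\<close>
  define q where "q = L * norm (y - f x)"
  have q: "q < r" "0 \<le> q"
    using y L by (auto simp: q_def dist_norm norm_minus_commute field_simps)
  let ?B = "ball x r"
  have cont: "continuous_on ?B f"
    by (intro continuous_at_imp_continuous_on ballI has_derivative_continuous[OF der])
  \<comment> \<open>Only pointwise differentiability is at hand, so openness of the image and
    continuity of the inverse come from injectivity by invariance of domain.\<close>
  have op: "open (f ` ?B)" by (rule invariance_of_domain[OF cont open_ball inj])
  obtain g where g: "homeomorphism ?B (f ` ?B) f g"
    by (rule invariance_of_domain_homeomorphism[OF open_ball cont _ inj]) auto
  have gf: "g (f z) = z" if "z \<in> ?B" for z
    using g that by (simp add: homeomorphism_def)
  have fg: "f (g w) = w" if "w \<in> f ` ?B" for w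
    using g that unfolding homeomorphism_def by auto
  have gB: "g w \<in> ?B" if "w \<in> f ` ?B" for w
  proof -
    have "g w \<in> g ` f ` ?B" using that by (rule imageI)
    then show ?thesis using g by (simp add: homeomorphism_def)
  qed
  \<comment> \<open>The lower bound makes \<open>D\<close> injective, hence invertible in finite
    dimension, and becomes the bound \<open>L\<close> for the derivative of the inverse.\<close>
  have g_der: "\<exists>g'. (g has_derivative g') (at w) \<and> onorm g' \<le> L" if w: "w \<in> f ` ?B" for w
  proof -
    define D where "D = f' (g w)"
    have D: "(f has_derivative D) (at (g w))" unfolding D_def by (rule der[OF gB[OF w]])
    have D_lower: "norm \<xi> \<le> L * norm (D \<xi>)" for \<xi> unfolding D_def by (rule lower[OF gB[OF w]])
    have lin: "linear D" using has_derivative_linear[OF D] .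
    have "inj D"
      unfolding linear_injective_0[OF lin]
    proof (intro allI impI)
      fix \<xi> assume "D \<xi> = 0" then show "\<xi> = 0" using D_lower[of \<xi>] by simp
    qed
    then obtain g' where g': "linear g'" "g' \<circ> D = id"
      using linear_injective_left_inverse[OF lin] by blast
    have "surj D" by (rule linear_injective_imp_surjective[OF lin \<open>inj D\<close>]) simp
    have "norm (g' \<zeta>) \<le> L * norm \<zeta>" for \<zeta>
    proof -
      obtain \<xi> where \<xi>: "\<zeta> = D \<xi>" using \<open>surj D\<close> by (rule surjE)
      have "g' \<zeta> = \<xi>" using fun_cong[OF g'(2), of \<xi>] by (simp add: \<xi>)
      then show ?thesis using D_lower[of \<xi>] by (simp add: \<xi>)
    qed
    then have "onorm g' \<le> L" by (rule onorm_le)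
    moreover have "(g has_derivative g') (at w)"
    proof (rule has_derivative_inverse_basic[where f = f and g = g and y = w, OF D _ g'(2) _ op w])
      show "bounded_linear g'" using g'(1) by (simp add: linear_conv_bounded_linear)
      have "continuous_on (f ` ?B) g" using g by (simp add: homeomorphism_def)
      then show "isCont g w" using continuous_on_eq_continuous_at[OF op] w by blast
    qed (rule fg)
    ultimately show ?thesis by blast
  qed
  then obtain g' where g': "\<And>w. w \<in> f ` ?B \<Longrightarrow> (g has_derivative g' w) (at w)"
    "\<And>w. w \<in> f ` ?B \<Longrightarrow> onorm (g' w) \<le> L"
    by metis
  define p where "p t = f x + t *\<^sub>R (y - f x)" for t :: real
  have p_cont: "continuous_on UNIV p" unfolding p_def by (intro continuous_intros)
  \<comment> \<open>Compact, so positions reached by lifts within \<open>cball x q\<close> persist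
    in the limit.\<close>
  define K where "K = f ` cball x q"
  have sub: "cball x q \<subseteq> ?B" using q by auto
  have K: "closed K" "K \<subseteq> f ` ?B"
    unfolding K_def using sub
    by (auto intro!: compact_imp_closed compact_continuous_image continuous_on_subset[OF cont])
  show "y \<in> f ` ?B"
  proof (rule ccontr)
    assume ny: "y \<notin> f ` ?B"
    \<comment> \<open>The times at which the segment lies outside the image. \<open>E\<close> is
      closed because the image is open, so it contains a first such time \<open>s\<close>.\<close>
    define E where "E = {t \<in> {0..1}. p t \<notin> f ` ?B}"
    have "closed E"
    proof -
      have "E = {0..1} \<inter> p -` (- (f ` ?B))" by (auto simp: E_def)
      moreover have "closed (p -` (- (f ` ?B)))"
        by (rule continuous_closed_vimage[OF closed_Compl[OF op]])
          (use p_cont in \<open>simp add: continuous_on_eq_continuous_at\<close>)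
      ultimately show ?thesis by (simp add: closed_Int)
    qed
    moreover have "1 \<in> E" using ny by (simp add: E_def p_def)
    moreover have bdd: "bdd_below E" by (rule bdd_belowI[of _ 0]) (simp add: E_def)
    ultimately have s: "Inf E \<in> E" by (intro closed_contains_Inf) auto
    define s where "s = Inf E"
    have r: "0 < r" using q by simp
    have p0: "p 0 \<in> f ` ?B" using r by (simp add: p_def)
    have "s \<in> E" unfolding s_def by (rule s)
    then have sE: "s \<in> {0..1} \<and> p s \<notin> f ` ?B" unfolding E_def by (rule CollectD)
    have "s \<noteq> 0"
    proof
      assume "s = 0"
      with sE p0 show False by blast
    qed
    with sE have s0: "0 < s" "s \<le> 1" "p s \<notin> f ` ?B" by simp_all
    have before: "p t \<in> f ` ?B" if "0 \<le> t" "t < s" for t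
    proof (rule ccontr)
      assume "p t \<notin> f ` ?B"
      then have "t \<in> E" using that s0 unfolding E_def by auto
      then have "s \<le> t" unfolding s_def by (rule cInf_lower[OF _ bdd])
      then show False using that by simp
    qed
    \<comment> \<open>Before \<open>s\<close> the whole segment up to \<open>p t\<close> lies in the
      image, and the mean value inequality for \<open>g\<close> along it keeps the lift in
      \<open>cball x q\<close>. Closedness of \<open>K\<close> then puts \<open>p s\<close> into the
      image, a contradiction.\<close>
    have "p t \<in> K" if t: "t \<in> {0..<s}" for t
    proof -
      have seg: "closed_segment (f x) (p t) \<subseteq> f ` ?B"
      proof
        fix w assume "w \<in> closed_segment (f x) (p t)"
        then obtain c where c: "0 \<le> c" "c \<le> 1" "w = f x + c *\<^sub>R (p t - f x)"
          unfolding closed_segment_image_interval by (auto simp: algebra_simps)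
        then have "w = p (c * t)" by (simp add: p_def)
        moreover have "c * t < s" using c t mult_left_le_one_le[of t c] by auto
        ultimately show "w \<in> f ` ?B" using before[of "c * t"] c t by simp
      qed
      have "norm (g (p t) - g (f x)) \<le> L * norm (p t - f x)"
      proof (rule differentiable_bound[OF convex_closed_segment, of "f x" "p t" g g'])
        show "(g has_derivative g' w) (at w within closed_segment (f x) (p t))"
          if "w \<in> closed_segment (f x) (p t)" for w
          using g'(1) seg that by (blast intro: has_derivative_at_withinI)
      qed (use g'(2) seg in auto)
      also have "\<dots> = t * q" using t by (simp add: p_def q_def)
      also have "\<dots> \<le> q" using t s0 q by (intro mult_left_le_one_le) auto
      finally have "g (p t) \<in> cball x q"
        using gf[of x] r by (simp add: dist_norm norm_minus_commute)
      moreover have "f (g (p t)) = p t" using before t by (intro fg) auto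
      ultimately show ?thesis unfolding K_def by (metis imageI)
    qed
    then have "{0..<s} \<subseteq> p -` K" by blast
    moreover have "closed (p -` K)"
      by (rule continuous_closed_vimage[OF K(1)]) (use p_cont in \<open>simp add: continuous_on_eq_continuous_at\<close>)
    ultimately have "closure {0..<s} \<subseteq> p -` K" by (rule closure_minimal)
    moreover have "s \<in> closure {0..<s}" using s0 by (simp add: closure_atLeastLessThan)
    ultimately have "p s \<in> K" by blast
    then show False using s0 K by blast
  qed
qed

section \<open>Reference elements and the ball inscribed in an element\<close>

lemma Ck_imp_continuous_on: "Ck k S f \<Longrightarrow> continuous_on S f"
  by (cases k) (auto intro: differentiable_imp_continuous_on)

lemma closed_ref_elem: "closed (ref_elem s :: (real^'m) set)"
proof (cases s)
  case Simplex
  have "closed {x :: real^'m. (\<forall>i. 0 \<le> x $ i) \<and> (\<Sum>i\<in>UNIV. x $ i) \<le> 1}"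
    by (intro closed_Collect_conj closed_Collect_all closed_Collect_le continuous_intros)
  then show ?thesis by (simp add: ref_elem_def Simplex)
next
  case Cube
  have "closed {x :: real^'m. \<forall>i. 0 \<le> x $ i \<and> x $ i \<le> 1}"
    by (intro closed_Collect_conj closed_Collect_all closed_Collect_le continuous_intros)
  then show ?thesis by (simp add: ref_elem_def Cube)
qed

lemma sets_lebesgue_ref_elem: "(ref_elem s :: (real^'m) set) \<in> sets lebesgue"
  by (rule sets_completionI_sets) (simp add: borel_closed closed_ref_elem)

lemma bounded_ref_elem: "bounded (ref_elem s :: (real^'m) set)"
proof (rule bounded_subset[OF bounded_cbox[of 0 "vec 1"]])
  show "(ref_elem s :: (real^'m) set) \<subseteq> cbox 0 (vec 1)"
  proof (cases s)
    case Simplex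
    have "x $ i \<le> 1" if "\<forall>i. 0 \<le> x $ i" "(\<Sum>i\<in>UNIV. x $ i) \<le> 1" for x :: "real^'m" and i
      using member_le_sum[of i UNIV "\<lambda>i. x $ i"] that by auto
    then show ?thesis by (auto simp: ref_elem_def Simplex mem_box_cart)
  qed (auto simp: ref_elem_def mem_box_cart)
qed

text \<open>Every coordinate of a point in this ball lies between 0 and \<open>1 / CARD('m)\<close>,
  so the coordinates sum to at most 1; thus one ball fits both the simplex and the cube.\<close>

lemma ball_subset_interior_ref_elem:
  "ball (\<chi> i. 1 / (2 * real CARD('m))) (1 / (2 * real CARD('m))) \<subseteq> interior (ref_elem s :: (real^'m) set)"
proof (rule interior_maximal[OF _ open_ball], rule subsetI)
  let ?n = "real CARD('m)"
  have n: "?n \<ge> 1" by (simp add: Suc_leI)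
  fix x :: "real^'m" assume x: "x \<in> ball (\<chi> i. 1 / (2 * ?n)) (1 / (2 * ?n))"
  have b: "0 \<le> x $ i \<and> x $ i \<le> 1 / ?n" for i
  proof -
    have "\<bar>((\<chi> i. 1 / (2 * ?n)) - x) $ i\<bar> < 1 / (2 * ?n)"
      using component_le_norm_cart[of "(\<chi> i. 1 / (2 * ?n)) - x" i] x by (simp add: dist_norm)
    then have "\<bar>1 / (2 * ?n) - x $ i\<bar> < 1 / (2 * ?n)" by simp
    moreover have "1 / ?n = 1 / (2 * ?n) + 1 / (2 * ?n)" by simp
    ultimately show ?thesis by linarith
  qed
  have "(\<Sum>i\<in>UNIV. x $ i) \<le> (\<Sum>i\<in>(UNIV :: 'm set). 1 / ?n)" using b by (intro sum_mono) auto
  then have "(\<Sum>i\<in>UNIV. x $ i) \<le> 1" by simp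
  moreover have "x $ i \<le> 1" for i
  proof -
    have "1 / ?n \<le> 1" using n by simp
    then show ?thesis using b[of i] by linarith
  qed
  ultimately show "x \<in> ref_elem s" using b by (cases s) (auto simp: ref_elem_def)
qed

lemma AE_lebesgue_on_negligible:
  assumes "AE x in lebesgue_on R. P x" "R \<in> sets lebesgue"
  shows "negligible {x \<in> R. \<not> P x}"
proof -
  have "AE x in lebesgue. x \<in> R \<longrightarrow> P x"
    using assms by (simp add: AE_restrict_space_iff)
  then obtain N where N: "{x \<in> space lebesgue. \<not> (x \<in> R \<longrightarrow> P x)} \<subseteq> N" "emeasure lebesgue N = 0" "N \<in> sets lebesgue"
    by (rule AE_E)
  have "negligible N" using N by (auto simp: negligible_iff_null_sets)
  then show ?thesis by (rule negligible_subset) (use N in auto)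
qed

text \<open>The set of violations inside \<open>U\<close> is open by continuity and null by
  hypothesis, hence empty.\<close>

lemma AE_closed_property:
  fixes F :: "'a::euclidean_space \<Rightarrow> real"
  assumes ae: "AE x in lebesgue_on R. F x \<ge> 0" and R: "R \<in> sets lebesgue"
    and U: "open U" "U \<subseteq> R" "continuous_on U F" and x: "x \<in> U"
  shows "F x \<ge> 0"
proof (rule ccontr)
  assume "\<not> F x \<ge> 0"
  let ?W = "U \<inter> F -` {..<0}"
  have "open ?W" using continuous_open_preimage[OF U(3,1) open_lessThan] .
  moreover have "x \<in> ?W" using x \<open>\<not> F x \<ge> 0\<close> by auto
  moreover have "negligible ?W"
    by (rule negligible_subset[OF AE_lebesgue_on_negligible[OF ae R]]) (use U in auto)
  ultimately show False using open_not_negligible[of ?W] by blast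
qed

lemma bounded_cell:
  assumes "bi_lipschitz_onto (param \<T> T) (ref_of \<T> T) T"
  shows "bounded T"
proof -
  obtain C where "lipschitz_on C (ref_of \<T> T) (param \<T> T)" and im: "param \<T> T ` ref_of \<T> T = T"
    using assms by (auto simp: bi_lipschitz_onto_def bij_betw_def)
  then have "bounded (param \<T> T ` ref_of \<T> T)"
    by (intro bounded_uniformly_continuous_image[OF lipschitz_on_uniformly_continuous bounded_ref_elem])
  then show ?thesis by (simp only: im)
qed

text \<open>
  Shape regularity controls the derivative of the chart only almost everywhere.  The resulting lower
  bound on the derivative of the parametrisation extends to every interior point by continuity, which
  is where \<open>p \<ge> 1\<close> enters.
\<close>

lemma element_contains_ball:
  fixes \<T> :: "('n::finite, 'n) mesh"
  defines "c \<equiv> (\<chi> i. 1 / (2 * real CARD('n))) :: real^'n" and "r \<equiv> 1 / (2 * real CARD('n))"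
  assumes reg: "shape_regular p Csr bd \<T>" and p: "p \<ge> 1" and T: "T \<in> cells \<T>"
    and bil: "bi_lipschitz_onto (param \<T> T) (ref_of \<T> T) T" and Csr: "Csr > 0"
  shows "diameter T > 0"
    and "ball (param \<T> T c) (r * diameter T / Csr) \<subseteq> param \<T> T ` interior (ref_of \<T> T)"
proof -
  let ?R = "ref_of \<T> T" and ?\<Phi> = "param \<T> T" and ?\<Psi> = "chart \<T> T"
  let ?L = "Csr / diameter T"
  define D where "D z = frechet_derivative ?\<Phi> (at z within ?R)" for z
  have R: "?R \<in> sets lebesgue" by (rule sets_lebesgue_ref_elem)
  have inj: "inj_on ?\<Phi> ?R" and im: "?\<Phi> ` ?R = T"
    using bil by (auto simp: bi_lipschitz_onto_def bij_betw_def)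
  have Ckp: "Ck p ?R ?\<Phi>" and chart_der: "AE x in lebesgue_on ?R. \<exists>E.
      (?\<Psi> has_derivative E) (at (?\<Phi> x) within T) \<and> onorm E \<le> ?L"
    using reg T by (auto simp: shape_regular_def)
  obtain p' where p': "p = Suc p'" using p by (cases p) auto
  \<comment> \<open>For order \<open>Suc p'\<close> every directional derivative is of class
    \<open>Ck p'\<close>, in particular continuous on the whole reference element.\<close>
  have diff: "?\<Phi> differentiable_on ?R" and D_cont: "continuous_on ?R (\<lambda>z. D z \<xi>)" for \<xi>
    using Ckp unfolding p' D_def by (auto intro: Ck_imp_continuous_on)
  have der: "(?\<Phi> has_derivative D z) (at z)" if z: "z \<in> interior ?R" for z
  proof -
    have "z \<in> ?R" using z interior_subset by blast
    then have "(?\<Phi> has_derivative D z) (at z within ?R)"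
      using diff unfolding D_def differentiable_on_def frechet_derivative_works[symmetric] by blast
    then show ?thesis by (simp add: at_within_interior[OF z])
  qed
  have lower: "norm \<xi> \<le> ?L * norm (D z \<xi>)" if z: "z \<in> interior ?R" for z \<xi>
  proof -
    \<comment> \<open>Where the chart has a derivative \<open>E\<close>, the chain rule for chart
      after parametrisation gives \<open>E \<circ> D x = id\<close>, so the bound on
      \<open>E\<close> is a lower bound on \<open>D x\<close>.\<close>
    have good: "norm \<xi> \<le> ?L * norm (D x \<xi>)"
      if x: "x \<in> interior ?R" and E: "(?\<Psi> has_derivative E) (at (?\<Phi> x) within T)" "onorm E \<le> ?L" for x E
    proof -
      have "(?\<Psi> \<circ> ?\<Phi> has_derivative E \<circ> D x) (at x within ?R)"
        using der[OF x] E(1) by (intro diff_chain_within) (auto simp: im intro: has_derivative_at_withinI)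
      then have "(?\<Psi> \<circ> ?\<Phi> has_derivative E \<circ> D x) (at x)" by (simp add: at_within_interior[OF x])
      then have "((\<lambda>y. y) has_derivative E \<circ> D x) (at x)"
      proof (rule has_derivative_transform_within_open[OF _ open_interior x])
        fix y assume "y \<in> interior ?R"
        then have "y \<in> ?R" using interior_subset by blast
        then show "(?\<Psi> \<circ> ?\<Phi>) y = y" by (simp add: chart_def inv_into_f_f[OF inj])
      qed
      then have "E \<circ> D x = (\<lambda>y. y)" by (rule has_derivative_unique[OF _ has_derivative_ident])
      from fun_cong[OF this, of \<xi>] have "\<xi> = E (D x \<xi>)" by (simp add: o_def)
      then have "norm \<xi> = norm (E (D x \<xi>))" by simp
      also have "\<dots> \<le> onorm E * norm (D x \<xi>)" by (rule onorm[OF has_derivative_bounded_linear[OF E(1)]])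
      also have "\<dots> \<le> ?L * norm (D x \<xi>)" using E(2) by (intro mult_right_mono) auto
      finally show ?thesis .
    qed
    have "?L * norm (D z \<xi>) - norm \<xi> \<ge> 0 "
    proof (rule AE_closed_property[where F = "\<lambda>x. ?L * norm (D x \<xi>) - norm \<xi>" and R = "interior ?R" and U = "interior ?R"])
      show "AE x in lebesgue_on (interior ?R). 0 \<le> ?L * norm (D x \<xi>) - norm \<xi>"
      proof -
        have "AE x in lebesgue. x \<in> ?R \<longrightarrow> (\<exists>E. (?\<Psi> has_derivative E) (at (?\<Phi> x) within T) \<and> onorm E \<le> ?L)"
          using chart_der R by (simp add: AE_restrict_space_iff)
        then have "AE x in lebesgue. x \<in> interior ?R \<longrightarrow> 0 \<le> ?L * norm (D x \<xi>) - norm \<xi>"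
        proof (rule eventually_mono, intro impI)
          fix x assume "x \<in> ?R \<longrightarrow> (\<exists>E. (?\<Psi> has_derivative E) (at (?\<Phi> x) within T) \<and> onorm E \<le> ?L)"
            and x: "x \<in> interior ?R"
          then obtain E where "(?\<Psi> has_derivative E) (at (?\<Phi> x) within T)" "onorm E \<le> ?L"
            using interior_subset by blast
          from good[OF x this] show "0 \<le> ?L * norm (D x \<xi>) - norm \<xi>" by simp
        qed
        then show ?thesis by (subst AE_restrict_space_iff) auto
      qed
      show "continuous_on (interior ?R) (\<lambda>x. ?L * norm (D x \<xi>) - norm \<xi>)"
        by (intro continuous_intros continuous_on_subset[OF D_cont interior_subset])
    qed (use z in auto)
    then show ?thesis by simp
  qed
  have ball: "ball c r \<subseteq> interior ?R" unfolding c_def r_def by (rule ball_subset_interior_ref_elem)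
  have r: "r > 0" by (simp add: r_def)
  then have c: "c \<in> interior ?R" using ball by auto
  have "bounded T" by (rule bounded_cell[OF bil])
  then have "diameter T \<ge> 0" by (rule diameter_ge_0)
  \<comment> \<open>For diameter 0 the quotient \<open>?L\<close> would be 0 by the convention for
    division, and \<open>lower\<close> would force a unit vector to vanish.\<close>
  moreover have "diameter T \<noteq> 0"
    using lower[OF c, of "axis undefined 1"] by auto
  ultimately show pos: "diameter T > 0" by simp
  have "ball (?\<Phi> c) (r / ?L) \<subseteq> ?\<Phi> ` ball c r"
  proof (rule ball_subset_image_ball[where f' = D])
    show "inj_on ?\<Phi> (ball c r)" using inj ball interior_subset by (blast intro: inj_on_subset)
  qed (use ball der lower pos Csr in auto)
  also have "\<dots> \<subseteq> ?\<Phi> ` interior ?R" using ball by blast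
  finally show "ball (?\<Phi> c) (r * diameter T / Csr) \<subseteq> ?\<Phi> ` interior ?R" by simp
qed

section \<open>Packing of elements by comparison of volumes\<close>

lemma card_disjoint_balls_le:
  fixes c :: "'i \<Rightarrow> 'a::euclidean_space"
  assumes I: "finite I" and s: "0 < s" and r: "0 \<le> r"
    and disj: "disjoint_family_on (\<lambda>i. ball (c i) s) I"
    and sub: "\<And>i. i \<in> I \<Longrightarrow> ball (c i) s \<subseteq> cball z r"
  shows "real (card I) \<le> (r / s) ^ DIM('a)"
proof -
  let ?v = "unit_ball_vol (real DIM('a))"
  have "ennreal (real (card I) * (?v * s ^ DIM('a))) = (\<Sum>i\<in>I. emeasure lborel (ball (c i) s))"
    using s by (simp add: emeasure_ball ennreal_mult ennreal_of_nat_eq_real_of_nat)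
  also have "\<dots> = emeasure lborel (\<Union>i\<in>I. ball (c i) s)"
    by (rule sum_emeasure[OF _ disj I]) auto
  also have "\<dots> \<le> emeasure lborel (cball z r)"
    by (rule emeasure_mono) (use sub in auto)
  also have "\<dots> = ennreal (?v * r ^ DIM('a))" using r by (rule emeasure_cball)
  finally have "real (card I) * (?v * s ^ DIM('a)) \<le> ?v * r ^ DIM('a)"
    using r by (subst (asm) ennreal_le_iff) simp_all
  then have "?v * (real (card I) * s ^ DIM('a)) \<le> ?v * r ^ DIM('a)"
    by (simp only: mult.left_commute)
  then have "real (card I) * s ^ DIM('a) \<le> r ^ DIM('a)" by simp
  then show ?thesis using s by (simp add: power_divide field_simps)
qed

text \<open>The inscribed balls lie in the disjoint relative interiors and can be shrunk to one
  common radius. The bound is the ratio of radii to the power of the dimension, in which the mesh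
  size cancels.\<close>

lemma card_cells_le:
  fixes \<T> :: "('n::finite, 'n) mesh"
  assumes part: "partition_of X \<T>" and reg: "shape_regular p Csr bd \<T>" and p: "p \<ge> 1" and Csr: "Csr > 0"
    and qu: "quasi_uniform Cqu \<T>" and K: "\<K> \<subseteq> cells \<T>" and \<rho>: "\<rho> \<ge> 0"
    and sub: "\<And>T. T \<in> \<K> \<Longrightarrow> T \<subseteq> cball z (\<rho> * mesh_size \<T>)"
  shows "real (card \<K>) \<le> (2 * real CARD('n) * Csr * \<bar>Cqu\<bar> * \<rho>) ^ CARD('n)"
proof (cases "\<K> = {}")
  case False
  let ?d = "mesh_size \<T>" and ?n = "real CARD('n)"
  define c where "c = ((\<chi> i. 1 / (2 * ?n)) :: real^'n)"
  have bil: "bi_lipschitz_onto (param \<T> T) (ref_of \<T> T) T" if "T \<in> cells \<T>" for T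
    using part that by (auto simp: partition_of_def)
  have pos: "diameter T > 0" and ball: "ball (param \<T> T c) (1 / (2 * ?n) * diameter T / Csr) \<subseteq> param \<T> T ` interior (ref_of \<T> T)"
    if "T \<in> \<K>" for T
    using element_contains_ball[OF reg p _ bil Csr] K that unfolding c_def by blast+
  have fin: "finite (cells \<T>)" using part by (simp add: partition_of_def)
  have d: "0 < ?d" "?d \<le> Cqu * diameter T" if "T \<in> \<K>" for T
  proof -
    have "diameter T \<le> ?d" unfolding mesh_size_def using fin K that by (intro Max_ge) auto
    then show "0 < ?d" using pos[OF that] by linarith
    show "?d \<le> Cqu * diameter T" using qu K that by (auto simp: quasi_uniform_def)
  qed
  obtain T0 where T0: "T0 \<in> \<K>" using False by blast
  \<comment> \<open>The sign of \<open>Cqu\<close> is not assumed; it follows as soon as one cell is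
    present. The absolute value in the bound covers the empty family.\<close>
  have "0 < Cqu * diameter T0" using d(1)[OF T0] d(2)[OF T0] by (rule less_le_trans)
  then have Cqu: "Cqu > 0" by (rule zero_less_mult_pos2[OF _ pos[OF T0]])
  \<comment> \<open>An element contains a ball of radius \<open>diameter T / (2 * ?n * Csr)\<close>,
    and quasi-uniformity replaces the diameter by the mesh size over \<open>Cqu\<close>.\<close>
  define s where "s = ?d / (2 * ?n * Csr * Cqu)"
  have s: "s > 0" unfolding s_def using d(1)[OF T0] Csr Cqu by simp
  have balls: "ball (param \<T> T c) s \<subseteq> param \<T> T ` interior (ref_of \<T> T)" if "T \<in> \<K>" for T
  proof -
    have "s \<le> (Cqu * diameter T) / (2 * ?n * Csr * Cqu)"
      unfolding s_def using d(2)[OF that] Csr Cqu by (intro divide_right_mono) auto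
    also have "\<dots> = 1 / (2 * ?n) * diameter T / Csr" using Cqu by (simp add: field_simps)
    finally have "ball (param \<T> T c) s \<subseteq> ball (param \<T> T c) (1 / (2 * ?n) * diameter T / Csr)"
      by (rule subset_ball)
    then show ?thesis using ball[OF that] by (rule subset_trans)
  qed
  have "real (card \<K>) \<le> (\<rho> * ?d / s) ^ DIM(real^'n)"
  proof (rule card_disjoint_balls_le)
    show "finite \<K>" using K fin by (rule finite_subset)
    show "0 \<le> \<rho> * ?d" using \<rho> d(1)[OF T0] by simp
    show "disjoint_family_on (\<lambda>T. ball (param \<T> T c) s) \<K>"
      unfolding disjoint_family_on_def
    proof (intro ballI impI)
      fix T T' assume T: "T \<in> \<K>" "T' \<in> \<K>" "T \<noteq> T'"
      have "param \<T> T ` interior (ref_of \<T> T) \<inter> param \<T> T' ` interior (ref_of \<T> T') = {}"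
        using part K T unfolding partition_of_def by blast
      then show "ball (param \<T> T c) s \<inter> ball (param \<T> T' c) s = {}"
        using balls[OF T(1)] balls[OF T(2)] by blast
    qed
    fix T assume T: "T \<in> \<K>"
    have "param \<T> T ` ref_of \<T> T = T"
      using bil[of T] K T by (auto simp: bi_lipschitz_onto_def bij_betw_def)
    then have "param \<T> T ` interior (ref_of \<T> T) \<subseteq> T" using interior_subset by blast
    then show "ball (param \<T> T c) s \<subseteq> cball z (\<rho> * ?d)" using balls[OF T] sub[OF T] by blast
  qed (rule s)
  also have "\<rho> * ?d / s = 2 * ?n * Csr * \<bar>Cqu\<bar> * \<rho>"
    unfolding s_def using d(1)[OF T0] Cqu by (simp add: field_simps)
  finally show ?thesis by simp
qed (use \<rho> Csr in simp)

text \<open>The index set for cubes. It contains the one for simplices, whose missing coefficients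
  are set to zero, so both shapes share one coefficient space.\<close>

definition multi_indices :: "nat \<Rightarrow> ('m::finite \<Rightarrow> nat) set" where
  "multi_indices p = {\<alpha>. \<forall>i. \<alpha> i \<le> p}"

lemma finite_multi_indices: "finite (multi_indices p :: ('m::finite \<Rightarrow> nat) set)"
proof -
  have "multi_indices p = PiE UNIV (\<lambda>_::'m. {..p})" by (auto simp: multi_indices_def PiE_def extensional_def)
  then show ?thesis by (simp add: finite_PiE)
qed

lemma ref_polys_coefficients:
  assumes "q \<in> ref_polys s p"
  shows "\<exists>a. \<forall>x. q x = (\<Sum>\<alpha>\<in>multi_indices p. a \<alpha> * (\<Prod>i\<in>UNIV. complex_of_real (x $ i) ^ \<alpha> i))"
proof -
  define J :: "('a \<Rightarrow> nat) set" where "J = (case s of Simplex \<Rightarrow> {\<alpha>. (\<Sum>i\<in>UNIV. \<alpha> i) \<le> p} | Cube \<Rightarrow> {\<alpha>. \<forall>i. \<alpha> i \<le> p})"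
  obtain a where a: "\<And>x. q x = (\<Sum>\<alpha>\<in>J. a \<alpha> * (\<Prod>i\<in>UNIV. complex_of_real (x $ i) ^ \<alpha> i))"
    using assms unfolding ref_polys_def J_def by blast
  have "\<alpha> i \<le> p" if "\<alpha> \<in> J" for \<alpha> i
    using that member_le_sum[of i UNIV \<alpha>] by (cases s) (auto simp: J_def)
  then have sub: "J \<subseteq> multi_indices p" by (auto simp: multi_indices_def)
  have "q x = (\<Sum>\<alpha>\<in>multi_indices p. (if \<alpha> \<in> J then a \<alpha> else 0) * (\<Prod>i\<in>UNIV. complex_of_real (x $ i) ^ \<alpha> i))" for x
    unfolding a by (rule sum.mono_neutral_cong_left[OF finite_multi_indices sub]) auto
  then show ?thesis by (intro exI[of _ "\<lambda>\<alpha>. if \<alpha> \<in> J then a \<alpha> else 0"] allI)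
qed

text \<open>Lipschitz maps between spaces of equal dimension preserve null sets. This carries
  statements almost everywhere on the reference element over to the cell.\<close>

lemma negligible_cell_image:
  fixes \<T> :: "('n::finite, 'n) mesh"
  assumes "bi_lipschitz_onto (param \<T> T) (ref_of \<T> T) T" "negligible N" "N \<subseteq> ref_of \<T> T"
  shows "negligible (param \<T> T ` N)"
proof (rule negligible_locally_Lipschitz_image[OF order_refl assms(2)])
  fix x assume x: "x \<in> N"
  obtain C where "lipschitz_on C (ref_of \<T> T) (param \<T> T)"
    using assms(1) by (auto simp: bi_lipschitz_onto_def)
  then have "norm (param \<T> T y - param \<T> T x) \<le> C * norm (y - x)" if "y \<in> N" for y
    using that x assms(3) unfolding lipschitz_on_def dist_norm by blast
  then show "\<exists>U B. open U \<and> x \<in> U \<and> (\<forall>y\<in>N \<inter> U. norm (param \<T> T y - param \<T> T x) \<le> B * norm (y - x))"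
    by (intro exI[of _ UNIV] exI[of _ C]) auto
qed

lemma AE_zero_off_ess_supp:
  fixes M :: "'a::second_countable_topology measure"
  assumes "space M \<subseteq> S"
  shows "AE y in M. y \<notin> ess_supp M S f \<longrightarrow> f y = 0"
proof -
  have "AE y in M. y \<in> S - ess_supp M S f \<longrightarrow> f y = 0"
    by (rule AE_locally) (auto simp: ess_supp_def)
  with AE_space show ?thesis by eventually_elim (use assms in auto)
qed

text \<open>With more functions than local coefficients on the cells of \<open>\<K>\<close>, a
  nontrivial combination has all these coefficients zero. It vanishes on \<open>\<Union>\<K>\<close>
  by this and elsewhere by the supports, against linear independence.\<close>

lemma card_basis_functions_le:
  fixes \<T> :: "('n::finite, 'n) mesh"
  assumes part: "partition_of X \<T>" and \<Omega>: "open \<Omega>"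
    and basis: "ae_basis (lebesgue_on \<Omega>) (W \<inter> piecewise_poly p \<T>) nd v"
    and J: "J \<subseteq> {..<nd}" and K: "\<K> \<subseteq> cells \<T>"
    and supp: "\<And>j. j \<in> J \<Longrightarrow> vol_supp \<Omega> (v j) \<subseteq> \<Union>\<K>"
  shows "card J \<le> card \<K> * card (multi_indices p :: ('n \<Rightarrow> nat) set)"
proof (rule ccontr)
  let ?A = "multi_indices p :: ('n \<Rightarrow> nat) set"
  let ?m = "\<lambda>\<alpha> y. \<Prod>i\<in>UNIV. complex_of_real ((y :: real^'n) $ i) ^ \<alpha> i"
  assume "\<not> card J \<le> card \<K> * card ?A"
  then have less: "card (\<K> \<times> ?A) < card J" by (simp add: card_cartesian_product)
  have finK: "finite \<K>" using part K finite_subset by (auto simp: partition_of_def)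
  have finJ: "finite J" using J finite_subset by blast
  have ex: "\<exists>c. AE y in lebesgue_on (ref_of \<T> T). v j (param \<T> T y) = (\<Sum>\<alpha>\<in>?A. c \<alpha> * ?m \<alpha> y)"
    if "j \<in> J" "T \<in> \<K>" for j T
  proof -
    have "j < nd" using J that(1) by auto
    moreover have "\<forall>j<nd. v j \<in> W \<inter> piecewise_poly p \<T>"
      using basis unfolding ae_basis_def by (rule conjunct1)
    ultimately have "v j \<in> piecewise_poly p \<T>" by simp
    moreover have "T \<in> cells \<T>" using K that(2) by (rule subsetD)
    ultimately obtain q where q: "q \<in> ref_polys (kind \<T> T) p" "AE y in lebesgue_on (ref_of \<T> T). v j (param \<T> T y) = q y"
      unfolding piecewise_poly_def by blast
    obtain a where "\<forall>x. q x = (\<Sum>\<alpha>\<in>?A. a \<alpha> * ?m \<alpha> x)"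
      using ref_polys_coefficients[OF q(1)] by (rule exE)
    then show ?thesis using q(2) by (intro exI[of _ a]) simp
  qed
  define c where "c j T = (SOME c. AE y in lebesgue_on (ref_of \<T> T). v j (param \<T> T y) = (\<Sum>\<alpha>\<in>?A. c \<alpha> * ?m \<alpha> y))" for j T
  have c: "AE y in lebesgue_on (ref_of \<T> T). v j (param \<T> T y) = (\<Sum>\<alpha>\<in>?A. c j T \<alpha> * ?m \<alpha> y)"
    if "j \<in> J" "T \<in> \<K>" for j T
    unfolding c_def by (rule someI_ex[OF ex[OF that]])
  \<comment> \<open>One unknown per basis function, one equation per pair of a cell and a
    multi-index.\<close>
  have "\<exists>x. (\<exists>j\<in>J. x j \<noteq> 0) \<and> (\<forall>k\<in>\<K> \<times> ?A. (\<Sum>j\<in>J. x j * c j (fst k) (snd k)) = 0)"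
    using finK finite_multi_indices finJ less by (intro underdetermined_system) auto
  then obtain x where x0: "\<exists>j\<in>J. x j \<noteq> 0" "\<And>k. k \<in> \<K> \<times> ?A \<Longrightarrow> (\<Sum>j\<in>J. x j * c j (fst k) (snd k)) = 0"
    by blast
  have x: "\<exists>j\<in>J. x j \<noteq> 0" "\<And>T \<alpha>. T \<in> \<K> \<Longrightarrow> \<alpha> \<in> ?A \<Longrightarrow> (\<Sum>j\<in>J. x j * c j T \<alpha>) = 0"
    using x0(1) x0(2)[of "(T, \<alpha>)" for T \<alpha>] by auto
  let ?s = "\<lambda>y. \<Sum>j\<in>J. x j * v j y"
  have bil: "bi_lipschitz_onto (param \<T> T) (ref_of \<T> T) T" if "T \<in> \<K>" for T
    using part K that by (auto simp: partition_of_def)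
  have cell: "negligible (param \<T> T ` {y \<in> ref_of \<T> T. ?s (param \<T> T y) \<noteq> 0})" if T: "T \<in> \<K>" for T
  proof (rule negligible_cell_image[OF bil[OF T]])
    have "AE y in lebesgue_on (ref_of \<T> T). \<forall>j\<in>J. v j (param \<T> T y) = (\<Sum>\<alpha>\<in>?A. c j T \<alpha> * ?m \<alpha> y)"
      using c T finJ by (intro AE_finite_allI) auto
    then have "AE y in lebesgue_on (ref_of \<T> T). ?s (param \<T> T y) = 0"
    proof eventually_elim
      case (elim y)
      have "?s (param \<T> T y) = (\<Sum>j\<in>J. \<Sum>\<alpha>\<in>?A. x j * c j T \<alpha> * ?m \<alpha> y)"
        using elim by (intro sum.cong) (simp_all add: sum_distrib_left mult.assoc)
      also have "\<dots> = (\<Sum>\<alpha>\<in>?A. \<Sum>j\<in>J. x j * c j T \<alpha> * ?m \<alpha> y)" by (rule sum.swap)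
      also have "\<dots> = (\<Sum>\<alpha>\<in>?A. (\<Sum>j\<in>J. x j * c j T \<alpha>) * ?m \<alpha> y)" by (simp only: sum_distrib_right)
      also have "\<dots> = 0" using x(2)[OF T] by simp
      finally show ?case .
    qed
    from AE_lebesgue_on_negligible[OF this sets_lebesgue_ref_elem]
    show "negligible {y \<in> ref_of \<T> T. ?s (param \<T> T y) \<noteq> 0}" .
  qed auto
  \<comment> \<open>Images of the reference null sets. Off \<open>?N\<close> the combination
    vanishes at every point of every cell in \<open>\<K>\<close>, including points shared by several
    cells.\<close>
  let ?N = "\<Union>T\<in>\<K>. param \<T> T ` {y \<in> ref_of \<T> T. ?s (param \<T> T y) \<noteq> 0}"
  have "negligible ?N" using finK cell by (intro negligible_Union) auto
  then have "AE y in lebesgue. y \<notin> ?N" unfolding negligible_iff_null_sets by (rule AE_not_in)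
  then have "AE y in lebesgue_on \<Omega>. y \<notin> ?N"
    using \<Omega> by (subst AE_restrict_space_iff) (auto elim!: eventually_mono)
  moreover have "AE y in lebesgue_on \<Omega>. \<forall>j\<in>J. y \<notin> vol_supp \<Omega> (v j) \<longrightarrow> v j y = 0"
    using finJ closure_subset by (intro AE_finite_allI AE_zero_off_ess_supp) auto
  ultimately have zero: "AE y in lebesgue_on \<Omega>. ?s y = 0"
  proof eventually_elim
    case (elim y)
    show ?case
    proof (cases "y \<in> \<Union>\<K>")
      case True
      then obtain T where T: "T \<in> \<K>" "y \<in> T" by blast
      then obtain z where z: "z \<in> ref_of \<T> T" "y = param \<T> T z"
        using bil[OF T(1)] unfolding bi_lipschitz_onto_def bij_betw_def by blast
      show ?thesis
      proof (rule ccontr)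
        assume "?s y \<noteq> 0"
        then have "y \<in> param \<T> T ` {y \<in> ref_of \<T> T. ?s (param \<T> T y) \<noteq> 0}" using z by blast
        then show False using elim(1) T(1) by blast
      qed
    next
      case False
      then have "v j y = 0" if "j \<in> J" for j using elim(2) supp[OF that] that by blast
      then show ?thesis by simp
    qed
  qed
  \<comment> \<open>Extension by zero to all \<open>nd\<close> indices, the form in which
    \<open>ae_basis\<close> states independence.\<close>
  define a where "a j = (if j \<in> J then x j else 0)" for j
  have "(\<Sum>j<nd. a j * v j y) = ?s y" for y
    by (rule sum.mono_neutral_cong_right) (use J in \<open>auto simp: a_def\<close>)
  then have "AE y in lebesgue_on \<Omega>. (\<Sum>j<nd. a j * v j y) = 0" using zero by simp
  then have "\<forall>j<nd. a j = 0" using basis unfolding ae_basis_def by blast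
  then show False using x(1) J by (auto simp: a_def)
qed

section \<open>The cost of the Galerkin matrix\<close>

lemma dist_le_mesh_size:
  assumes "partition_of X \<T>" "T \<in> cells \<T>" "x \<in> T" "y \<in> T"
  shows "dist x y \<le> mesh_size \<T>"
proof -
  have "bounded T" using assms(1,2) by (intro bounded_cell[of \<T>]) (simp add: partition_of_def)
  then have "dist x y \<le> diameter T" using assms(3,4) by (rule diameter_bounded_bound)
  also have "\<dots> \<le> mesh_size \<T>"
    unfolding mesh_size_def using assms(1,2) by (intro Max_ge) (auto simp: partition_of_def)
  finally show ?thesis .
qed

lemma bounded_of_partition:
  assumes "partition_of X \<T>" shows "bounded X"
  using assms bounded_cell[of \<T>] unfolding partition_of_def by (auto intro!: bounded_Union)

lemma lipschitz_interface_subset: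
  assumes "lipschitz_interface \<Omega> \<Gamma>N S" "\<Gamma>N \<subseteq> frontier \<Omega>"
  shows "S \<subseteq> closure \<Omega>"
proof -
  have "S \<subseteq> \<Omega> \<or> S \<subseteq> \<Gamma>N" using assms(1) unfolding lipschitz_interface_def by blast
  moreover have "frontier \<Omega> \<subseteq> closure \<Omega>" by (simp add: frontier_def)
  ultimately show ?thesis using assms(2) closure_subset[of \<Omega>] by blast
qed

text \<open>For \<open>g = g l\<close> this is the index set of the degrees of freedom near one
  surface function; \<open>vicinity\<close> is its union over \<open>l < nh\<close>.\<close>

definition touching :: "(real^'n) set \<Rightarrow> (real^'n) set \<Rightarrow> nat \<Rightarrow> (nat \<Rightarrow> real^'n \<Rightarrow> complex) \<Rightarrow>
    (real^'n \<Rightarrow> complex) \<Rightarrow> nat set" where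
  "touching \<Omega> S nd v g = {j. j < nd \<and> vol_supp \<Omega> (v j) \<inter> surf_supp S g \<noteq> {}}"

text \<open>The factor \<open>3 + \<bar>C\<bar>\<close> measures a chain from \<open>z\<close> to
  any point of a patch: one panel, of size at most \<open>\<bar>C\<bar>\<close> mesh sizes, then the
  element carrying the common support point, the central element \<open>T0\<close> and an element
  adjacent to it.\<close>

lemma card_touching_le:
  fixes \<T> :: "('n::finite, 'n) mesh" and \<P> :: "('m::finite, 'n) mesh"
  assumes \<Omega>: "open \<Omega>"
    and T: "partition_of X \<T>" "shape_regular p Csr bd \<T>" "p \<ge> 1" "Csr > 0" "quasi_uniform Cqu \<T>"
    and P: "partition_of S \<P>" "mesh_size \<P> \<le> C * mesh_size \<T>"
    and v: "ae_basis (lebesgue_on \<Omega>) (W \<inter> piecewise_poly p \<T>) nd v" "local_vol_basis \<Omega> \<T> nd v"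
    and g: "local_surf_basis S \<P> nh g" "l < nh"
  shows "real (card (touching \<Omega> S nd v (g l))) \<le>
    (2 * real CARD('n) * Csr * \<bar>Cqu\<bar> * (3 + \<bar>C\<bar>)) ^ CARD('n) * real (card (multi_indices p :: ('n \<Rightarrow> nat) set))"
proof (cases "touching \<Omega> S nd v (g l) = {}")
  case False
  let ?d = "mesh_size \<T>" and ?J = "touching \<Omega> S nd v (g l)"
  obtain \<tau> where \<tau>: "\<tau> \<in> cells \<P>" "surf_supp S (g l) \<subseteq> \<tau>"
    using g unfolding local_surf_basis_def by blast
  \<comment> \<open>Chosen once in the panel, independently of \<open>j\<close>, so that a single
    ball captures the patches of all touching functions.\<close>
  obtain z where z: "z \<in> \<tau>" using False \<tau>(2) unfolding touching_def by blast
  define \<K> where "\<K> = {K \<in> cells \<T>. K \<subseteq> cball z ((3 + \<bar>C\<bar>) * ?d)}"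
  have fin: "finite \<K>" using T(1) by (simp add: partition_of_def \<K>_def)
  have supp: "vol_supp \<Omega> (v j) \<subseteq> \<Union>\<K>" if j: "j \<in> ?J" for j
  proof -
    obtain y where y: "y \<in> vol_supp \<Omega> (v j)" "y \<in> \<tau>" and jn: "j < nd"
      using j \<tau>(2) unfolding touching_def by blast
    obtain T0 where T0: "T0 \<in> cells \<T>" "vol_supp \<Omega> (v j) \<subseteq> \<Union>{K \<in> cells \<T>. T0 \<inter> K \<noteq> {}}"
      using v(2) jn unfolding local_vol_basis_def by blast
    obtain K a where K: "K \<in> cells \<T>" "y \<in> K" "a \<in> T0" "a \<in> K" using y(1) T0(2) by blast
    have d: "0 \<le> ?d" using dist_le_mesh_size[OF T(1) K(1) K(2) K(2)] by simp
    have "K' \<subseteq> cball z ((3 + \<bar>C\<bar>) * ?d)" if K': "K' \<in> cells \<T>" "b \<in> T0" "b \<in> K'" for K' b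
    proof
      fix w assume w: "w \<in> K'"
      have "dist z y \<le> C * ?d" using dist_le_mesh_size[OF P(1) \<tau>(1) z y(2)] P(2) by linarith
      also have "\<dots> \<le> \<bar>C\<bar> * ?d" using d by (intro mult_right_mono) auto
      finally have "dist z y \<le> \<bar>C\<bar> * ?d" .
      moreover have "dist y a \<le> ?d" by (rule dist_le_mesh_size[OF T(1) K(1,2,4)])
      moreover have "dist a b \<le> ?d" by (rule dist_le_mesh_size[OF T(1) T0(1) K(3) K'(2)])
      moreover have "dist b w \<le> ?d" by (rule dist_le_mesh_size[OF T(1) K'(1,3) w])
      moreover have "dist z w \<le> dist z y + dist y a + dist a b + dist b w"
        using dist_triangle[of z w y] dist_triangle[of y w a] dist_triangle[of a w b] by linarith
      ultimately have "dist z w \<le> (3 + \<bar>C\<bar>) * ?d" unfolding distrib_right by linarith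
      then show "w \<in> cball z ((3 + \<bar>C\<bar>) * ?d)" by simp
    qed
    then have "{K \<in> cells \<T>. T0 \<inter> K \<noteq> {}} \<subseteq> \<K>" unfolding \<K>_def by blast
    then show ?thesis using T0(2) by blast
  qed
  have "card ?J \<le> card \<K> * card (multi_indices p :: ('n \<Rightarrow> nat) set)"
    by (rule card_basis_functions_le[OF T(1) \<Omega> v(1) _ _ supp]) (auto simp: touching_def \<K>_def)
  then have "real (card ?J) \<le> real (card \<K>) * real (card (multi_indices p :: ('n \<Rightarrow> nat) set))"
    by (simp only: of_nat_le_iff of_nat_mult[symmetric])
  also have "\<dots> \<le> (2 * real CARD('n) * Csr * \<bar>Cqu\<bar> * (3 + \<bar>C\<bar>)) ^ CARD('n) * real (card (multi_indices p :: ('n \<Rightarrow> nat) set))"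
    by (rule mult_right_mono[OF card_cells_le[OF T(1,2,3,4,5)]]) (auto simp: \<K>_def)
  finally show ?thesis .
qed (use T(4) in simp)

lemma card_UN_lessThan_le:
  assumes "\<And>l. l < n \<Longrightarrow> real (card (A l)) \<le> B"
  shows "real (card (\<Union>l<n. A l)) \<le> real n * B"
proof -
  have "card (\<Union>l<n. A l) \<le> (\<Sum>l<n. card (A l))" by (rule card_UN_le) simp
  then have "real (card (\<Union>l<n. A l)) \<le> (\<Sum>l<n. real (card (A l)))" by (simp only: of_nat_sum[symmetric] of_nat_le_iff)
  also have "\<dots> \<le> (\<Sum>l<n. B)" by (rule sum_mono) (use assms in auto)
  finally show ?thesis by simp
qed

text \<open>The witness is \<open>\<kappa> * (B + 1) * B\<close>, because \<open>card I + nh\<close>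
  is at most \<open>(B + 1) * nh\<close> and \<open>nnz R\<close> at most \<open>B * nh\<close>.
  \<open>B\<close> is built from \<open>CARD('n)\<close>, \<open>p\<close>, \<open>Csr\<close>,
  \<open>Cqu\<close> and \<open>C\<^sub>h\<^sub>d\<close> alone, so it sees neither meshes nor
  bases.\<close>

theorem theoremC:
  fixes \<Omega> \<Gamma>D \<Gamma>N S :: "(real^'n) set"
    and \<gamma> \<gamma>S :: "(real^'n \<Rightarrow> complex) \<Rightarrow> real^'n \<Rightarrow> complex"
    and A :: "real^'n \<Rightarrow> complex^'n^'n"
    and b :: "real^'n \<Rightarrow> complex^'n"
    and c :: "real^'n \<Rightarrow> complex"
    and G :: "(real^'n \<Rightarrow> complex) \<Rightarrow> (real^'n \<Rightarrow> complex) \<Rightarrow> complex"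
    and p k :: nat
    and Csr Cqu C\<^sub>h\<^sub>d \<kappa> :: real
  assumes "CARD('n) \<ge> 2" and "CARD('m) = CARD('n) - 1"
    and "lipschitz_domain \<Omega>"
    and "closedin (top_of_set (frontier \<Omega>)) \<Gamma>D" and "\<Gamma>N = frontier \<Omega> - \<Gamma>D"
    and "dirichlet_trace \<Omega> (frontier \<Omega>) \<gamma>"
    and "A \<in> Linf (lebesgue_on \<Omega>)" and "hermitian_uniformly_pd \<Omega> A"
    and "b \<in> Linf (lebesgue_on \<Omega>)" and "c \<in> Linf (lebesgue_on \<Omega>)"
    and "bounded_into_dual \<Omega> \<Gamma>D (H1_D \<Omega> \<gamma> \<Gamma>D) G"
    and "coercive \<Omega> (H1_D \<Omega> \<gamma> \<Gamma>D) (ell \<Omega> A b c G \<gamma>)"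
    and "lipschitz_interface \<Omega> \<Gamma>N S"
    and "dirichlet_trace \<Omega> S \<gamma>S"
    and "p \<ge> 1" and "Csr > 0" and "\<kappa> > 0"
  shows "\<exists>C. \<forall>(\<T> :: ('n, 'n) mesh) (\<P> :: ('m::finite, 'n) mesh) nd nh v g N.
      partition_of (closure \<Omega>) \<T> \<and> shape_regular p Csr (frontier \<Omega>) \<T> \<and> quasi_uniform Cqu \<T> \<and>
      (\<exists>\<F> \<subseteq> mesh_faces \<T>. \<Gamma>D = \<Union> \<F>) \<and>
      partition_of S \<P> \<and> shape_regular k Csr {} \<P> \<and> quasi_uniform Cqu \<P> \<and>
      mesh_size \<P> \<le> C\<^sub>h\<^sub>d * mesh_size \<T> \<and>
      ae_basis (lebesgue_on \<Omega>)
        (H1_D \<Omega> \<gamma> \<Gamma>D \<inter> Linf (lebesgue_on \<Omega>) \<inter> piecewise_poly p \<T>) nd v \<and>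
      local_vol_basis \<Omega> \<T> nd v \<and>
      ae_basis (surface S) (Linf (surface S) \<inter> piecewise_poly k \<P>) nh g \<and>
      local_surf_basis S \<P> nh g \<and>
      N \<in> carrier_mat nd nd \<and>
      inverts_mat (stiffness_matrix (ell \<Omega> A b c G \<gamma>) nd v) N \<and>
      inverts_mat N (stiffness_matrix (ell \<Omega> A b c G \<gamma>) nd v) \<longrightarrow>
      (let R = transfer_matrix S \<gamma>S nd v nh g;
           I = vicinity \<Omega> S nd v nh g
       in \<exists>cost. computable \<kappa> {R} {submatrix N I I} (mat_adjoint R * N * R) cost \<and>
            cost \<le> C * (real nh)\<^sup>2)"
proof -
  define B where "B = (2 * real CARD('n) * Csr * \<bar>Cqu\<bar> * (3 + \<bar>C\<^sub>h\<^sub>d\<bar>)) ^ CARD('n) *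
    real (card (multi_indices p :: ('n \<Rightarrow> nat) set))"
  have B: "B \<ge> 0" using \<open>Csr > 0\<close> by (simp add: B_def)
  have op: "open \<Omega>" using \<open>lipschitz_domain \<Omega>\<close> by (simp add: lipschitz_domain_def lipschitz_set_def)
  have S_sub: "S \<subseteq> closure \<Omega>"
    using \<open>lipschitz_interface \<Omega> \<Gamma>N S\<close> \<open>\<Gamma>N = frontier \<Omega> - \<Gamma>D\<close> by (intro lipschitz_interface_subset) auto
  have main: "\<exists>cost. computable \<kappa> {R} {submatrix N I I} (mat_adjoint R * N * R) cost \<and>
      cost \<le> \<kappa> * (B + 1) * B * (real nh)\<^sup>2"
    if T: "partition_of (closure \<Omega>) \<T>" "shape_regular p Csr (frontier \<Omega>) \<T>" "quasi_uniform Cqu \<T>"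
      and P: "partition_of S \<P>" "mesh_size \<P> \<le> C\<^sub>h\<^sub>d * mesh_size \<T>"
      and v: "ae_basis (lebesgue_on \<Omega>)
        (H1_D \<Omega> \<gamma> \<Gamma>D \<inter> Linf (lebesgue_on \<Omega>) \<inter> piecewise_poly p \<T>) nd v" "local_vol_basis \<Omega> \<T> nd v"
      and g: "local_surf_basis S \<P> nh g" and N: "N \<in> carrier_mat nd nd"
      and R_def: "R = transfer_matrix S \<gamma>S nd v nh g" and I_def: "I = vicinity \<Omega> S nd v nh g"
    for \<T> :: "('n, 'n) mesh" and \<P> :: "('m, 'n) mesh" and nd nh v g N R I
  proof -
    \<comment> \<open>\<open>lipschitz_domain\<close> allows unbounded sets; boundedness comes from
      the finite partition into bounded cells.\<close>
    have bdd: "bounded \<Omega>"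
      using bounded_of_partition[OF T(1)] closure_subset by (rule bounded_subset)
    have H1: "v j \<in> H1 \<Omega>" if "j < nd" for j
    proof -
      have "\<forall>j<nd. v j \<in> H1_D \<Omega> \<gamma> \<Gamma>D \<inter> Linf (lebesgue_on \<Omega>) \<inter> piecewise_poly p \<T>"
        using v(1) unfolding ae_basis_def by (rule conjunct1)
      then show ?thesis using that by (simp add: H1_D_def)
    qed
    have count: "real (card (touching \<Omega> S nd v (g l))) \<le> B" if "l < nh" for l
      unfolding B_def using card_touching_le[OF op T(1,2) \<open>p \<ge> 1\<close> \<open>Csr > 0\<close> T(3) P v g that] .
    have I: "I = (\<Union>l<nh. touching \<Omega> S nd v (g l))"
      by (simp add: I_def vicinity_def touching_def)
    have R: "R \<in> carrier_mat nd nh" by (simp add: R_def transfer_matrix_def)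
    have zero: "R $$ (j, l) = 0" if "j < nd" "l < nh" "j \<notin> touching \<Omega> S nd v (g l)" for j l
    proof -
      have "vol_supp \<Omega> (v j) \<inter> surf_supp S (g l) = {}" using that by (simp add: touching_def)
      from surface_pairing_eq_zero[OF \<open>dirichlet_trace \<Omega> S \<gamma>S\<close> op bdd H1[OF that(1)] S_sub this]
      show ?thesis using that by (simp add: R_def transfer_matrix_def)
    qed
    have "real (card I) \<le> real nh * B" unfolding I by (rule card_UN_lessThan_le[OF count])
    \<comment> \<open>Column \<open>l\<close> has nonzero entries only in the rows touching
      \<open>g l\<close>, hence at most \<open>B\<close> of them.\<close>
    moreover have "real (nnz R) \<le> real nh * B"
    proof -
      have "{(j, l). j < dim_row R \<and> l < dim_col R \<and> R $$ (j, l) \<noteq> 0} \<subseteq>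
        (\<Union>l<nh. (\<lambda>j. (j, l)) ` touching \<Omega> S nd v (g l))"
        using R zero by auto
      moreover have "finite (\<Union>l<nh. (\<lambda>j. (j, l)) ` touching \<Omega> S nd v (g l))"
        by (simp add: touching_def)
      ultimately have "nnz R \<le> card (\<Union>l<nh. (\<lambda>j. (j, l)) ` touching \<Omega> S nd v (g l))"
        unfolding nnz_def by (intro card_mono)
      also have "real \<dots> \<le> real nh * B"
        using count by (intro card_UN_lessThan_le) (simp add: card_image inj_on_def)
      finally show ?thesis by simp
    qed
    moreover obtain cost where cost: "computable \<kappa> {R} {submatrix N I I} (mat_adjoint R * N * R) cost"
      "cost \<le> \<kappa> * real (card I + nh) * real (nnz R)"
    proof -
      have "\<exists>cost. computable \<kappa> {R} {submatrix N I I} (mat_adjoint R * N * R) cost \<and>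
          cost \<le> \<kappa> * real (card I + nh) * real (nnz R)"
      proof (rule computable_congruence[OF N R])
        show "I \<subseteq> {..<nd}" unfolding I touching_def by auto
        show "R $$ (i, j) = 0" if "i < nd" "i \<notin> I" "j < nh" for i j
          using that by (intro zero) (auto simp: I)
      qed (use \<open>\<kappa> > 0\<close> in simp)
      then show ?thesis using that by blast
    qed
    ultimately have "\<kappa> * real (card I + nh) * real (nnz R) \<le> \<kappa> * (real nh * B + real nh) * (real nh * B)"
      using \<open>\<kappa> > 0\<close> B by (intro mult_mono) auto
    also have "\<dots> = \<kappa> * (B + 1) * B * (real nh)\<^sup>2" by (simp add: power2_eq_square algebra_simps)
    finally show ?thesis using cost by (intro exI[of _ cost] conjI) auto
  qed
  show ?thesis
    unfolding Let_def
  proof (rule exI[of _ "\<kappa> * (B + 1) * B"], intro allI impI)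
    fix \<T> :: "('n, 'n) mesh" and \<P> :: "('m, 'n) mesh" and nd nh v g N
    assume "partition_of (closure \<Omega>) \<T> \<and> shape_regular p Csr (frontier \<Omega>) \<T> \<and> quasi_uniform Cqu \<T> \<and>
      (\<exists>\<F> \<subseteq> mesh_faces \<T>. \<Gamma>D = \<Union> \<F>) \<and>
      partition_of S \<P> \<and> shape_regular k Csr {} \<P> \<and> quasi_uniform Cqu \<P> \<and>
      mesh_size \<P> \<le> C\<^sub>h\<^sub>d * mesh_size \<T> \<and>
      ae_basis (lebesgue_on \<Omega>)
        (H1_D \<Omega> \<gamma> \<Gamma>D \<inter> Linf (lebesgue_on \<Omega>) \<inter> piecewise_poly p \<T>) nd v \<and>
      local_vol_basis \<Omega> \<T> nd v \<and>
      ae_basis (surface S) (Linf (surface S) \<inter> piecewise_poly k \<P>) nh g \<and>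
      local_surf_basis S \<P> nh g \<and>
      N \<in> carrier_mat nd nd \<and>
      inverts_mat (stiffness_matrix (ell \<Omega> A b c G \<gamma>) nd v) N \<and>
      inverts_mat N (stiffness_matrix (ell \<Omega> A b c G \<gamma>) nd v)"
    then show "\<exists>cost. computable \<kappa> {transfer_matrix S \<gamma>S nd v nh g}
        {submatrix N (vicinity \<Omega> S nd v nh g) (vicinity \<Omega> S nd v nh g)}
        (mat_adjoint (transfer_matrix S \<gamma>S nd v nh g) * N * transfer_matrix S \<gamma>S nd v nh g) cost \<and>
      cost \<le> \<kappa> * (B + 1) * B * (real nh)\<^sup>2"
      by (elim conjE) (rule main[OF _ _ _ _ _ _ _ _ _ refl refl])
  qed
qed

end
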